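(* Let $(X,0)$ be a complex normal surface singularity whose link is a rational homology sphere, with a fixed good resolution with dual graph $\Gamma$ and vertex set $V$. Let $\emptyset\neq I\subset V$ and $\ell'_0\in\mathcal S'$ with $[\ell'_0]=h_0\in H$, and put $\check\ell_0:=\ell'_0+r_{-h_0}\in L$. Then: (a) $\mathrm{mpc}^{\pi_I(\mathcal S'_{\mathbb R})}\big((f_{\ell'_0})_0(\mathbf t_I)\big)=\widetilde q_{-h_0,I}(-\check\ell_0)=q_{[Z_K]+h_0,\,I}(Z_K+\ell'_0)$; (b) $\mathrm{pc}^{\pi_I(\mathcal S'_{\mathbb R})}\big((f_{\ell'_0})_0(\mathbf t_I)\big)=\widetilde Q_{-h_0,I}(-\check\ell_0)=Q_{[Z_K]+h_0,\,I}(Z_K+\ell'_0)$.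
   Context: Lattices. Let $\tilde X\to X$ be the good resolution, $\{E_v\}_{v\in V}$ the irreducible exceptional curves; since the link $\Sigma$ is a rational homology sphere, $\Gamma$ is a connected tree and all $E_v$ are rational. $L=\bigoplus_v\mathbb Z E_v$ carries the negative definite intersection form $(\cdot,\cdot)$; $L'=\{\ell'\in L\otimes\mathbb Q:(\ell',\ell)\in\mathbb Z\ \forall\ell\in L\}$; it is freely generated by the $E_v^*$ with $(E_u^*,E_v)=-\delta_{u,v}$. $H:=L'/L$, and $[\ell']$ is the class of $\ell'$ in $H$. For $h\in H$, $r_h=\sum_v l'_vE_v\in L'$ is the unique representative of $h$ with all $0\le l'_v<1$. $Z_K\in L'$ is determined by $(Z_K,E_v)=(E_v,E_v)+2$ for all $v$. The Lipman cone is $\mathcal S'=\{\ell'\in L':(\ell',E_v)\le0\ \forall v\}=\mathbb Z_{\ge0}\langle E_v^*\rangle_v$, and $\mathcal S'_{\mathbb R}$ is the real cone generated by the $E^*_v$. For $I\subset V$, $\pi_I$ is the projection $\sum_{v\in V}l_vE_v\mapsto\sum_{v\in I}l_vE_v$, also written $\ell'|_I$; $L_I=\pi_I(L)$, $L'_I=\pi_I(L')$. For $x,y$ in $L'_I$: $x\ge y$ means $x_v\ge y_v$ for all $v\in I$; $x\prec y$ means $x_v<y_v$ for all $v\in I$. Series. For $\ell'=\sum_vl'_vE_v$, $\mathbf t^{\ell'}=\prod_vt_v^{l'_v}$. Let $f(\mathbf t)=\prod_{v\in V}(1-\mathbf t^{E_v^*})^{\mathrm{val}(v)-2}$, with $\mathrm{val}(v)$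 the valence of $v$ in $\Gamma$, and let $Z(\mathbf t)=\sum_{\ell'}z(\ell')\mathbf t^{\ell'}$ be its Taylor expansion at the origin (supported in $\mathcal S'$). The twisted zeta function is $f_{\ell'_0}(\mathbf t)=\mathbf t^{\ell'_0}f(\mathbf t)$, with Taylor expansion at the origin $\mathbf t^{\ell'_0}Z(\mathbf t)$. The $h$-part of a series $S(\mathbf t)=\sum_{\ell'\in L'} a(\ell')\mathbf t^{\ell'}$ is $S_h(\mathbf t)=\sum_{[\ell']=h}a(\ell')\mathbf t^{\ell'}$, and $S_h(\mathbf t_I):=S_h(\mathbf t)|_{t_v=1,\,v\notin I}$. The symbol $(f_{\ell'_0})_0(\mathbf t_I)$ denotes the reduced $0$-part (the part of trivial class $0\in H$) of the Taylor expansion of $f_{\ell'_0}$ at the origin, i.e. $\mathbf t_I^{\ell'_0}Z_{-h_0}(\mathbf t_I)$, where $\mathbf t_I^{\ell'_0}:=\mathbf t^{\ell'_0}|_{t_v=1,\,v\notin I}$. Counting functions. For $x\in L'$ put $Q^{(S)}_{h,I}(x)=\sum a(\ell')$ over $\ell'$ with $[\ell']=h$ and $\ell'|_I\not\ge x|_I$, and $q^{(S)}_{h,I}(x)=\sum a(\ell')$ over $\ell'$ with $[\ell']=h$ and $\ell'|_I\prec x|_I$ (for the series considered here these sums are finite). For $S=Z$ write $Q_{h,I}$ and $q_{h,I}$. Periodic constants. Let $\mathcal K\subset L'_I\otimes\mathbb R$ be a full-dimensional closed real cone. $Q^{(S)}_{h,I}$ admits a quasi-polynomial in $\mathcal K$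 if there are $\ell'_*\in\mathcal K$, a finite index sublattice $\widetilde L\subset L_I$ and a quasi-polynomial $\widetilde Q^{(S)}_{h,I}$ on $\widetilde L$ with $\widetilde Q^{(S)}_{h,I}(\ell)=Q^{(S)}_{h,I}(r_h|_I+\ell)$ for all $\ell\in(\ell'_*+\mathcal K)\cap\widetilde L$ (here the counting function is viewed as a function of the projection of its argument to $L'_I$). Then $\mathrm{pc}^{\mathcal K}(S_h(\mathbf t_I)):=\widetilde Q^{(S)}_{h,I}(0)$. Replacing $Q$ by $q$ one obtains $\widetilde q^{(S)}_{h,I}$ and $\mathrm{mpc}^{\mathcal K}(S_h(\mathbf t_I)):=\widetilde q^{(S)}_{h,I}(0)$. These numbers do not depend on the choice of $\ell'_*$ and $\widetilde L$. It is known that $Q_{h,I}$ and $q_{h,I}$ (and the counting functions of the twisted series) admit quasi-polynomials in the cone $\pi_I(\mathcal S'_{\mathbb R})$, defined on $L_I$; those of $Z_h(\mathbf t_I)$ are denoted $\widetilde Q_{h,I}$ and $\widetilde q_{h,I}$, and they are evaluated on elements of $L$ through the projection $L\to L_I$. *)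

theory Defs
  imports "HOL-Analysis.Analysis" "HOL-Algebra.Coset"
begin

section \<open>Resolution graphs\<close>

text \<open>
  The vertex set is the finite type of the vertices. By Grauert's theorem the weighted
  graphs below are exactly the dual graphs of good resolutions of complex normal surface
  singularities with rational homology sphere link; all invariants used here depend on the
  weighted graph only.
\<close>

record 'v weighted_graph =
  adjacent :: "'v \<Rightarrow> 'v \<Rightarrow> bool"
  self_int :: "'v \<Rightarrow> int"

definition is_cycle :: "('v \<Rightarrow> 'v \<Rightarrow> bool) \<Rightarrow> 'v list \<Rightarrow> bool" where
  "is_cycle adj p \<longleftrightarrow> 3 \<le> length p \<and> distinct p \<and> successively adj p \<and> adj (last p) (hd p)"

definition is_tree :: "('v \<Rightarrow> 'v \<Rightarrow> bool) \<Rightarrow> bool" where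
  "is_tree adj \<longleftrightarrow>
     (\<forall>u v. adj u v \<longrightarrow> adj v u) \<and> (\<forall>v. \<not> adj v v) \<and>
     (\<forall>u v. adj\<^sup>*\<^sup>* u v) \<and> (\<nexists>p. is_cycle adj p)"

definition int_matrix :: "'v::finite weighted_graph \<Rightarrow> real^'v^'v" where
  "int_matrix \<Gamma> = (\<chi> u v. if u = v then of_int (self_int \<Gamma> u)
                           else if adjacent \<Gamma> u v then 1 else 0)"

definition int_form :: "'v::finite weighted_graph \<Rightarrow> real^'v \<Rightarrow> real^'v \<Rightarrow> real" where
  "int_form \<Gamma> x y = x \<bullet> (int_matrix \<Gamma> *v y)"

definition QHS_resolution_graph :: "'v::finite weighted_graph \<Rightarrow> bool" where
  "QHS_resolution_graph \<Gamma> \<longleftrightarrow>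
     is_tree (adjacent \<Gamma>) \<and> (\<forall>x. x \<noteq> 0 \<longrightarrow> int_form \<Gamma> x x < 0)"

definition valency :: "'v::finite weighted_graph \<Rightarrow> 'v \<Rightarrow> nat" where
  "valency \<Gamma> v = card {u. adjacent \<Gamma> v u}"


section \<open>Lattices\<close>

definition E :: "'v::finite \<Rightarrow> real^'v" where
  "E v = axis v 1"

definition latt :: "(real^'v::finite) set" where
  "latt = {x. \<forall>v. x $ v \<in> \<int>}"

definition dual_latt :: "'v::finite weighted_graph \<Rightarrow> (real^'v) set" where
  "dual_latt \<Gamma> = {x. (\<forall>v. x $ v \<in> \<rat>) \<and> (\<forall>l\<in>latt. int_form \<Gamma> x l \<in> \<int>)}"

definition E_dual :: "'v::finite weighted_graph \<Rightarrow> 'v \<Rightarrow> real^'v" where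
  "E_dual \<Gamma> u = (THE x. x \<in> dual_latt \<Gamma> \<and>
                    (\<forall>v. int_form \<Gamma> x (E v) = (if u = v then -1 else 0)))"

definition add_group :: "'a::ab_group_add set \<Rightarrow> 'a monoid" where
  "add_group A = \<lparr>carrier = A, mult = (+), one = 0\<rparr>"

definition H_group :: "'v::finite weighted_graph \<Rightarrow> (real^'v) set monoid" where
  "H_group \<Gamma> = add_group (dual_latt \<Gamma>) Mod latt"

definition H_class :: "'v::finite weighted_graph \<Rightarrow> real^'v \<Rightarrow> (real^'v) set" where
  "H_class \<Gamma> x = latt #>\<^bsub>add_group (dual_latt \<Gamma>)\<^esub> x"

definition r_rep :: "(real^'v::finite) set \<Rightarrow> real^'v" where
  "r_rep h = (THE x. x \<in> h \<and> (\<forall>v. 0 \<le> x $ v \<and> x $ v < 1))"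

definition Z_K :: "'v::finite weighted_graph \<Rightarrow> real^'v" where
  "Z_K \<Gamma> = (THE x. x \<in> dual_latt \<Gamma> \<and>
               (\<forall>v. int_form \<Gamma> x (E v) = int_form \<Gamma> (E v) (E v) + 2))"

definition lipman :: "'v::finite weighted_graph \<Rightarrow> (real^'v) set" where
  "lipman \<Gamma> = {x \<in> dual_latt \<Gamma>. \<forall>v. int_form \<Gamma> x (E v) \<le> 0}"

definition lipman_real :: "'v::finite weighted_graph \<Rightarrow> (real^'v) set" where
  "lipman_real \<Gamma> = convex_cone hull (range (E_dual \<Gamma>))"

definition proj :: "'v::finite set \<Rightarrow> real^'v \<Rightarrow> real^'v" where
  "proj I x = (\<Sum>v\<in>I. (x $ v) *\<^sub>R E v)"

definition ge_on :: "'v::finite set \<Rightarrow> real^'v \<Rightarrow> real^'v \<Rightarrow> bool" where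
  "ge_on I x y \<longleftrightarrow> (\<forall>v\<in>I. x $ v \<ge> y $ v)"

definition prec_on :: "'v::finite set \<Rightarrow> real^'v \<Rightarrow> real^'v \<Rightarrow> bool" where
  "prec_on I x y \<longleftrightarrow> (\<forall>v\<in>I. x $ v < y $ v)"


section \<open>Series\<close>

text \<open>
  A series is given by its coefficient function on exponents. The exponents are rational, so
  functions are evaluated at \<open>t\<close> with positive real coordinates.
\<close>

definition monomial :: "real^'v::finite \<Rightarrow> real^'v \<Rightarrow> real" where
  "monomial l t = (\<Prod>v\<in>UNIV. (t $ v) powr (l $ v))"

definition zeta_fun :: "'v::finite weighted_graph \<Rightarrow> real^'v \<Rightarrow> real" where
  "zeta_fun \<Gamma> t = (\<Prod>v\<in>UNIV. (1 - monomial (E_dual \<Gamma> v) t) powi (int (valency \<Gamma> v) - 2))"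

definition twisted_zeta_fun :: "'v::finite weighted_graph \<Rightarrow> real^'v \<Rightarrow> real^'v \<Rightarrow> real" where
  "twisted_zeta_fun \<Gamma> l0 t = monomial l0 t * zeta_fun \<Gamma> t"

text \<open>
  With \<open>d\<close> the order of \<open>L'/L\<close>, all exponents lie in \<open>(1/d) L\<close>. In the variables
  \<open>s\<^sub>v = t\<^sub>v powr (1/d)\<close> this is the usual power series expansion at \<open>s = 0\<close>, which is
  determined by its (absolutely convergent) values at small positive arguments.
\<close>

definition taylor_at_origin ::
  "'v::finite weighted_graph \<Rightarrow> (real^'v \<Rightarrow> real) \<Rightarrow> (real^'v \<Rightarrow> real)" where
  "taylor_at_origin \<Gamma> F = (THE a.
     (\<forall>l. l \<notin> {l \<in> dual_latt \<Gamma>. \<forall>v. 0 \<le> l $ v} \<longrightarrow> a l = 0) \<and>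
     (\<exists>\<epsilon>>0. \<forall>t. (\<forall>v. 0 < t $ v \<and> t $ v < \<epsilon>) \<longrightarrow>
        ((\<lambda>l. a l * monomial l t) has_sum F t) {l \<in> dual_latt \<Gamma>. \<forall>v. 0 \<le> l $ v}))"

definition Z_series :: "'v::finite weighted_graph \<Rightarrow> real^'v \<Rightarrow> real" where
  "Z_series \<Gamma> = taylor_at_origin \<Gamma> (zeta_fun \<Gamma>)"

definition twisted_Z_series :: "'v::finite weighted_graph \<Rightarrow> real^'v \<Rightarrow> real^'v \<Rightarrow> real" where
  "twisted_Z_series \<Gamma> l0 = taylor_at_origin \<Gamma> (twisted_zeta_fun \<Gamma> l0)"


section \<open>Counting functions\<close>

text \<open>
  The classes \<open>h\<close> are cosets of \<open>L\<close>, so \<open>[l] = h\<close> reads \<open>l \<in> h\<close>. The condition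
  \<open>a l \<noteq> 0\<close> makes the index sets finite for the series considered here. Both functions
  depend on \<open>x\<close> through \<open>proj I x\<close> only.
\<close>

definition Q_count ::
  "(real^'v::finite \<Rightarrow> real) \<Rightarrow> (real^'v) set \<Rightarrow> 'v set \<Rightarrow> real^'v \<Rightarrow> real" where
  "Q_count a h I x = (\<Sum>l | l \<in> h \<and> a l \<noteq> 0 \<and> \<not> ge_on I l x. a l)"

definition q_count ::
  "(real^'v::finite \<Rightarrow> real) \<Rightarrow> (real^'v) set \<Rightarrow> 'v set \<Rightarrow> real^'v \<Rightarrow> real" where
  "q_count a h I x = (\<Sum>l | l \<in> h \<and> a l \<noteq> 0 \<and> prec_on I l x. a l)"


section \<open>Quasi-polynomials and periodic constants\<close>

definition finite_index_sublattice :: "'a::ab_group_add set \<Rightarrow> 'a set \<Rightarrow> bool" where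
  "finite_index_sublattice M \<Lambda> \<longleftrightarrow>
     subgroup M (add_group \<Lambda>) \<and> finite (rcosets\<^bsub>add_group \<Lambda>\<^esub> M)"

definition quasi_polynomial_on ::
  "'a::real_normed_vector set \<Rightarrow> ('a \<Rightarrow> real) \<Rightarrow> bool" where
  "quasi_polynomial_on \<Lambda> g \<longleftrightarrow>
     (\<exists>M. finite_index_sublattice M \<Lambda> \<and>
       (\<forall>c \<in> rcosets\<^bsub>add_group \<Lambda>\<^esub> M.
          \<exists>p. real_polynomial_function p \<and> (\<forall>x\<in>c. g x = p x)))"

definition is_quasi_polynomial_of ::
  "(real^'v::finite) set \<Rightarrow> 'v set \<Rightarrow> (real^'v) set \<Rightarrow> (real^'v \<Rightarrow> real) \<Rightarrow>
   (real^'v) set \<Rightarrow> (real^'v \<Rightarrow> real) \<Rightarrow> bool" where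
  "is_quasi_polynomial_of K I h F \<Lambda> g \<longleftrightarrow>
     quasi_polynomial_on \<Lambda> g \<and>
     (\<exists>ls\<in>K. \<forall>l\<in>\<Lambda>. l \<in> (\<lambda>k. ls + k) ` K \<longrightarrow> g l = F (proj I (r_rep h) + l))"

definition periodic_constant_of ::
  "(real^'v::finite) set \<Rightarrow> 'v set \<Rightarrow> (real^'v) set \<Rightarrow> (real^'v \<Rightarrow> real) \<Rightarrow> real" where
  "periodic_constant_of K I h F = (THE c. \<exists>\<Lambda> g.
     finite_index_sublattice \<Lambda> (proj I ` latt) \<and> is_quasi_polynomial_of K I h F \<Lambda> g \<and> c = g 0)"

definition pc ::
  "(real^'v::finite) set \<Rightarrow> (real^'v \<Rightarrow> real) \<Rightarrow> (real^'v) set \<Rightarrow> 'v set \<Rightarrow> real" where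
  "pc K a h I = periodic_constant_of K I h (Q_count a h I)"

definition mpc ::
  "(real^'v::finite) set \<Rightarrow> (real^'v \<Rightarrow> real) \<Rightarrow> (real^'v) set \<Rightarrow> 'v set \<Rightarrow> real" where
  "mpc K a h I = periodic_constant_of K I h (q_count a h I)"

text \<open>
  The value at \<open>l \<in> L\<close> of the quasi-polynomial that is defined on all of \<open>L\<^sub>I\<close>; elements of
  \<open>L\<close> are projected to \<open>L\<^sub>I\<close>.
\<close>

definition quasi_polynomial_value ::
  "(real^'v::finite) set \<Rightarrow> 'v set \<Rightarrow> (real^'v) set \<Rightarrow> (real^'v \<Rightarrow> real) \<Rightarrow> real^'v \<Rightarrow> real" where
  "quasi_polynomial_value K I h F l =
     (THE c. \<exists>g. is_quasi_polynomial_of K I h F (proj I ` latt) g \<and> c = g (proj I l))"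

definition Q_tilde ::
  "'v::finite weighted_graph \<Rightarrow> (real^'v) set \<Rightarrow> 'v set \<Rightarrow> real^'v \<Rightarrow> real" where
  "Q_tilde \<Gamma> h I =
     quasi_polynomial_value (proj I ` lipman_real \<Gamma>) I h (Q_count (Z_series \<Gamma>) h I)"

definition q_tilde ::
  "'v::finite weighted_graph \<Rightarrow> (real^'v) set \<Rightarrow> 'v set \<Rightarrow> real^'v \<Rightarrow> real" where
  "q_tilde \<Gamma> h I =
     quasi_polynomial_value (proj I ` lipman_real \<Gamma>) I h (q_count (Z_series \<Gamma>) h I)"

end

theory Submission
  imports Defs "HOL-Library.Poly_Mapping"
begin

text \<open>
  Write \<open>a\<^sub>v(x) = -(x, E\<^sub>v)\<close>. The coefficient of \<open>Z\<close> at \<open>l\<close> is the product over the vertices of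
  the coefficients of \<open>X^a\<^sub>v(l)\<close> in \<open>(1 - X)^(val(v) - 2)\<close>. For a fixed class of \<open>x\<close> every
  counting function is therefore a sum over \<open>y \<in> \<int>\<^sup>V\<close>, with \<open>l = x + y\<close>, that depends on \<open>x\<close>
  only through the integer vector \<open>A = a(x)\<close>. What has to be shown is that one quasi-polynomial
  \<open>p(A)\<close> equals the count over \<open>y\<^sub>I < 0\<close> when \<open>A\<close> is deep in the cone and equals a dual count
  over \<open>y\<^sub>I \<ge> 0\<close> when \<open>A \<le> 0\<close>. In the dual count all factors are expanded at \<open>X = \<infinity>\<close> instead
  of \<open>X = 0\<close>; the substitution \<open>l \<mapsto> Z\<^sub>K - E - l\<close>, with \<open>E\<close> the sum of all \<open>E\<^sub>v\<close>, turns
  it into the count at \<open>Z\<^sub>K - x\<close>,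
  which for \<open>x = -l\<^sub>0\<close> is the right-hand side of the corollary. The twisted series has the
  counting function of \<open>Z\<close> shifted by \<open>l\<^sub>0\<close>, so that both its periodic constant and the value
  at \<open>-(l\<^sub>0 + r)\<close> of the quasi-polynomial for \<open>-h\<^sub>0\<close> are \<open>p(a(-l\<^sub>0))\<close>.

  The quasi-polynomial is produced by eliminating the leaves of the tree one after the other.
  When the coordinate of a leaf \<open>e\<close> is summed out, one of the factors \<open>1 - X\<close> at its
  neighbour \<open>p\<close> is used up in a summation by parts: the sum turns into integration against a
  finitely supported signed measure, the jumps of a tail function of the leaf. The
  state thus consists of a family of signed measures on the integers at every remaining vertex, and
  after the last step only a sum over one integer is left (lemma \<open>state_sum_eliminate\<close>).

  Three such eliminations run in parallel: one for the expansion at zero, one for the expansion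
  at infinity, and a regularized one without any cut-off inequalities, in which a leaf of \<open>I\<close>
  contributes its jump measure minus its total mass placed at the cut-off. Negative definiteness yields a
  positive vector \<open>h\<close> whose image under the negative of the intersection matrix is positive, and
  \<open>h\<close> bounds the supports of
  all measures by linear functions. These bounds show that the first system agrees with the
  regularized one for deep \<open>A\<close> at negative arguments, and the second one for \<open>A \<le> 0\<close> at
  nonnegative arguments (lemma \<open>compatible_eliminate\<close>). At the root, \<open>p\<close> is the
  regularized sum in which negative arguments are counted with the expansion at zero and the
  others with the expansion at infinity; far out in either direction one of the two halves
  vanishes (theorem \<open>state_sum_reciprocity\<close>).

  The regularized measures are combinations of families that are
  periodic up to translation, both in their argument and in \<open>A\<close>. Changing \<open>A\<close> by a multiple
  of a common period merely moves the cut-off of the root sum, and the two expansions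
  differ by the linear function \<open>a + 1\<close>; hence \<open>p\<close> is a quasi-polynomial
  (lemma \<open>quasi_poly_root_sum\<close>).

  It remains to identify the Taylor coefficients (a nonzero generalized power series has
  a unique leading exponent along a suitable curve and hence does not vanish near the origin), to pass to the
  projected lattice (\<open>p\<close> is invariant under the coordinates outside \<open>I\<close>, because two
  quasi-polynomials that agree deep in the cone are equal), and to obtain the statement for
  \<open>Q\<close> from the one for \<open>q\<close> by inclusion and exclusion over the inequalities.
\<close>

section \<open>Signed measures on the integers and summation by parts\<close>

type_synonym measure_int = "int \<Rightarrow>\<^sub>0 real"

abbreviation supp :: "measure_int \<Rightarrow> int set" where
  "supp \<equiv> Poly_Mapping.keys"

abbreviation mass_at :: "measure_int \<Rightarrow> int \<Rightarrow> real" where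
  "mass_at \<equiv> Poly_Mapping.lookup"

definition integ :: "measure_int \<Rightarrow> (int \<Rightarrow> real) \<Rightarrow> real" where
  "integ \<kappa> g = (\<Sum>a\<in>supp \<kappa>. mass_at \<kappa> a * g a)"

abbreviation point :: "int \<Rightarrow> measure_int" where
  "point a \<equiv> Poly_Mapping.single a 1"

abbreviation mass :: "measure_int \<Rightarrow> real" where
  "mass \<kappa> \<equiv> integ \<kappa> (\<lambda>_. 1)"

lemma integ_superset:
  assumes "finite S" "supp \<kappa> \<subseteq> S"
  shows "integ \<kappa> g = (\<Sum>a\<in>S. mass_at \<kappa> a * g a)"
  unfolding integ_def using assms
  by (intro sum.mono_neutral_left) (auto simp: in_keys_iff)

lemma integ_zero [simp]: "integ 0 g = 0"
  by (simp add: integ_def)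

lemma integ_single [simp]: "integ (Poly_Mapping.single a c) g = c * g a"
  by (subst integ_superset[of "{a}"]) (auto simp: lookup_single)

lemma integ_add: "integ (\<kappa> + \<nu>) g = integ \<kappa> g + integ \<nu> g"
proof -
  let ?S = "supp \<kappa> \<union> supp \<nu>"
  have "integ \<mu> g = (\<Sum>a\<in>?S. mass_at \<mu> a * g a)" if "supp \<mu> \<subseteq> ?S" for \<mu>
    using that by (intro integ_superset) auto
  moreover have "supp (\<kappa> + \<nu>) \<subseteq> ?S" by (rule keys_add)
  ultimately show ?thesis
    by (simp add: lookup_add distrib_right sum.distrib)
qed

lemma integ_sum: "integ (\<Sum>i\<in>S. \<kappa> i) g = (\<Sum>i\<in>S. integ (\<kappa> i) g)"
  by (induction S rule: infinite_finite_induct) (auto simp: integ_add)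

lemma integ_cong:
  assumes "\<And>a. a \<in> supp \<kappa> \<Longrightarrow> f a = g a"
  shows "integ \<kappa> f = integ \<kappa> g"
  unfolding integ_def using assms by (intro sum.cong) auto

lemma integ_add_fun: "integ \<kappa> (\<lambda>a. f a + g a) = integ \<kappa> f + integ \<kappa> g"
  by (simp add: integ_def distrib_left sum.distrib)

lemma integ_diff_fun: "integ \<kappa> (\<lambda>a. f a - g a) = integ \<kappa> f - integ \<kappa> g"
  by (simp add: integ_def right_diff_distrib sum_subtractf)

lemma integ_scale_fun: "integ \<kappa> (\<lambda>a. c * f a) = c * integ \<kappa> f"
  by (simp add: integ_def sum_distrib_left algebra_simps)

lemma integ_const: "integ \<kappa> (\<lambda>a. c) = c * mass \<kappa>"
  using integ_scale_fun[of \<kappa> c "\<lambda>_. 1"] by simp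

lemma decompose_single:
  "\<kappa> = (\<Sum>a\<in>supp \<kappa>. Poly_Mapping.single a (mass_at \<kappa> a))"
  by (rule poly_mapping_eqI)
     (simp add: lookup_sum lookup_single when_def sum.delta in_keys_iff)

lemma integ_mult: "integ (\<kappa> * \<nu>) g = integ \<kappa> (\<lambda>a. integ \<nu> (\<lambda>b. g (a + b)))"
proof -
  let ?K = "supp \<kappa>" and ?L = "supp \<nu>"
  have "\<kappa> * \<nu> = (\<Sum>a\<in>?K. \<Sum>b\<in>?L. Poly_Mapping.single (a + b)
            (mass_at \<kappa> a * mass_at \<nu> b))"
    by (subst decompose_single[of \<kappa>], subst decompose_single[of \<nu>])
       (simp add: sum_product mult_single)
  then show ?thesis
    by (simp add: integ_sum) (simp add: integ_def sum_distrib_left mult.assoc)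
qed

lemma integ_shift: "integ (point b * \<kappa>) g = integ \<kappa> (\<lambda>a. g (b + a))"
  by (simp add: integ_mult)

text \<open>
  The mass at \<open>-t\<close> is the jump of \<open>\<phi>\<close> at \<open>t\<close>. The reflection makes the elimination of a leaf a
  convolution: the neighbours enter the exponent of a vertex with a negative sign.
\<close>

definition jumps :: "(int \<Rightarrow> real) \<Rightarrow> measure_int" where
  "jumps \<phi> = Abs_poly_mapping (\<lambda>s. \<phi> (- s) - \<phi> (- s - 1))"

definition eventually_const :: "(int \<Rightarrow> real) \<Rightarrow> real \<Rightarrow> real \<Rightarrow> bool" where
  "eventually_const \<phi> c d \<longleftrightarrow> (\<exists>T. (\<forall>t\<ge>T. \<phi> t = d) \<and> (\<forall>t\<le>-T. \<phi> t = c))"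

lemma eventually_const_finite:
  assumes "eventually_const \<phi> c d"
  shows "finite {t. \<phi> t \<noteq> \<phi> (t - 1)}"
proof -
  obtain T where T: "\<forall>t\<ge>T. \<phi> t = d" "\<forall>t\<le>-T. \<phi> t = c"
    using assms by (auto simp: eventually_const_def)
  have "{t. \<phi> t \<noteq> \<phi> (t - 1)} \<subseteq> {-T..T}"
  proof
    fix t assume t: "t \<in> {t. \<phi> t \<noteq> \<phi> (t - 1)}"
    have "\<not> t > T" using T(1) t by auto
    moreover have "\<not> t < -T" using T(2) t by auto
    ultimately show "t \<in> {-T..T}" by auto
  qed
  then show ?thesis by (rule finite_subset) simp
qed

lemma lookup_jumps:
  assumes "eventually_const \<phi> c d"
  shows "mass_at (jumps \<phi>) s = \<phi> (- s) - \<phi> (- s - 1)"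
proof -
  have "{s. \<phi> (- s) - \<phi> (- s - 1) \<noteq> 0} = uminus ` {t. \<phi> t \<noteq> \<phi> (t - 1)}"
    by force
  then have "finite {s. \<phi> (- s) - \<phi> (- s - 1) \<noteq> 0}"
    using eventually_const_finite[OF assms] by simp
  then show ?thesis by (simp add: jumps_def)
qed

lemma keys_jumps:
  assumes "eventually_const \<phi> c d"
  shows "s \<in> supp (jumps \<phi>) \<longleftrightarrow> \<phi> (- s) \<noteq> \<phi> (- s - 1)"
  using lookup_jumps[OF assms] by (simp add: in_keys_iff)

lemma integ_jumps_interval:
  assumes "eventually_const \<phi> c d" "finite S" "\<And>t. \<phi> t \<noteq> \<phi> (t - 1) \<Longrightarrow> t \<in> S"
  shows "integ (jumps \<phi>) g = (\<Sum>t\<in>S. (\<phi> t - \<phi> (t - 1)) * g (- t))"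
proof -
  have "integ (jumps \<phi>) g = (\<Sum>s\<in>uminus ` S. mass_at (jumps \<phi>) s * g s)"
    using assms by (intro integ_superset) (force simp: keys_jumps[OF assms(1)])+
  also have "\<dots> = (\<Sum>t\<in>S. (\<phi> t - \<phi> (t - 1)) * g (- t))"
    by (subst sum.reindex) (auto simp: lookup_jumps[OF assms(1)])
  finally show ?thesis .
qed

lemma integ_jumps:
  assumes "eventually_const \<phi> c d"
  shows "integ (jumps \<phi>) g = Sum_any (\<lambda>t. (\<phi> t - \<phi> (t - 1)) * g (- t))"
proof -
  have "integ (jumps \<phi>) g = (\<Sum>t | \<phi> t \<noteq> \<phi> (t - 1). (\<phi> t - \<phi> (t - 1)) * g (- t))"
    using assms eventually_const_finite[OF assms] by (intro integ_jumps_interval) auto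
  also have "\<dots> = Sum_any (\<lambda>t. (\<phi> t - \<phi> (t - 1)) * g (- t))"
    using eventually_const_finite[OF assms]
    by (intro Sum_any.expand_superset[symmetric]) auto
  finally show ?thesis .
qed

lemma sum_telescope_int:
  fixes \<phi> :: "int \<Rightarrow> real"
  assumes "a \<le> b"
  shows "(\<Sum>t\<in>{a<..b}. \<phi> t - \<phi> (t - 1)) = \<phi> b - \<phi> a"
  using assms
proof (induction b rule: int_ge_induct)
  case base then show ?case by simp
next
  case (step b)
  have "{a<..b+1} = insert (b+1) {a<..b}" using step by auto
  then show ?case using step by simp
qed

lemma mass_jumps:
  assumes "eventually_const \<phi> c d"
  shows "mass (jumps \<phi>) = d - c"
proof -
  obtain T where T: "\<forall>t\<ge>T. \<phi> t = d" "\<forall>t\<le>-T. \<phi> t = c"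
    using assms by (auto simp: eventually_const_def)
  define a where "a = - \<bar>T\<bar>"
  define b where "b = \<bar>T\<bar>"
  have ab: "a \<le> b" "\<And>t. t \<le> a \<Longrightarrow> \<phi> t = c" "\<And>t. t \<ge> b \<Longrightarrow> \<phi> t = d"
    using T by (auto simp: a_def b_def)
  have "mass (jumps \<phi>) = (\<Sum>t\<in>{a<..b}. \<phi> t - \<phi> (t - 1))"
  proof (subst integ_jumps_interval[OF assms, of "{a<..b}"])
    fix t assume t: "\<phi> t \<noteq> \<phi> (t - 1)"
    have "\<not> t \<le> a" using ab(2)[of t] ab(2)[of "t - 1"] t by auto
    moreover have "\<not> t > b" using ab(3)[of t] ab(3)[of "t - 1"] t by auto
    ultimately show "t \<in> {a<..b}" by auto
  qed auto
  also have "\<dots> = d - c" using sum_telescope_int[OF ab(1)] ab by simp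
  finally show ?thesis .
qed

lemma jumps_eqI:
  assumes "\<And>t. \<phi> t - \<phi> (t - 1) = \<psi> t - \<psi> (t - 1)"
  shows "jumps \<phi> = jumps \<psi>"
  unfolding jumps_def using assms by (metis minus_diff_eq)

lemma jumps_shift:
  assumes "eventually_const \<phi> c d"
  shows "jumps (\<lambda>t. \<phi> (t + n)) = point n * jumps \<phi>"
proof (rule poly_mapping_eqI)
  fix s
  obtain T where T: "\<forall>t\<ge>T. \<phi> t = d" "\<forall>t\<le>-T. \<phi> t = c"
    using assms by (auto simp: eventually_const_def)
  have ec: "eventually_const (\<lambda>t. \<phi> (t + n)) c d"
    unfolding eventually_const_def using T by (intro exI[of _ "\<bar>T\<bar> + \<bar>n\<bar>"]) auto
  have "mass_at (point n * jumps \<phi>) s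
      = integ (point n * jumps \<phi>) (\<lambda>a. if a = s then 1 else 0)"
    by (simp add: integ_def if_distrib[of "\<lambda>x. _ * x"] sum.delta in_keys_iff cong: if_cong)
  also have "\<dots> = integ (jumps \<phi>) (\<lambda>a. if n + a = s then 1 else 0)"
    by (rule integ_shift)
  also have "\<dots> = integ (jumps \<phi>) (\<lambda>a. if a = s - n then 1 else 0)"
    by (intro integ_cong) auto
  also have "\<dots> = mass_at (jumps \<phi>) (s - n)"
    by (simp add: integ_def if_distrib[of "\<lambda>x. _ * x"] sum.delta in_keys_iff cong: if_cong)
  finally show "mass_at (jumps (\<lambda>t. \<phi> (t + n))) s
      = mass_at (point n * jumps \<phi>) s"
    by (simp add: lookup_jumps[OF assms] lookup_jumps[OF ec] algebra_simps)
qed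

lemma jumps_add:
  assumes "eventually_const \<phi> c d" "eventually_const \<psi> c' d'"
  shows "jumps (\<lambda>t. \<phi> t + \<psi> t) = jumps \<phi> + jumps \<psi>"
proof (rule poly_mapping_eqI)
  fix s
  obtain T where T: "\<forall>t\<ge>T. \<phi> t = d" "\<forall>t\<le>-T. \<phi> t = c"
    using assms by (auto simp: eventually_const_def)
  obtain T' where T': "\<forall>t\<ge>T'. \<psi> t = d'" "\<forall>t\<le>-T'. \<psi> t = c'"
    using assms by (auto simp: eventually_const_def)
  have ec: "eventually_const (\<lambda>t. \<phi> t + \<psi> t) (c + c') (d + d')"
    unfolding eventually_const_def using T T' by (intro exI[of _ "max T T'"]) auto
  show "mass_at (jumps (\<lambda>t. \<phi> t + \<psi> t)) s
      = mass_at (jumps \<phi> + jumps \<psi>) s"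
    by (simp add: lookup_jumps[OF assms(1)] lookup_jumps[OF assms(2)] lookup_jumps[OF ec] lookup_add)
qed

lemma jumps_scale:
  assumes "eventually_const \<phi> c d"
  shows "jumps (\<lambda>t. r * \<phi> t) = Poly_Mapping.single 0 r * jumps \<phi>"
proof (rule poly_mapping_eqI)
  fix s
  obtain T where T: "\<forall>t\<ge>T. \<phi> t = d" "\<forall>t\<le>-T. \<phi> t = c"
    using assms by (auto simp: eventually_const_def)
  have ec: "eventually_const (\<lambda>t. r * \<phi> t) (r * c) (r * d)"
    unfolding eventually_const_def using T by (intro exI[of _ T]) auto
  have "mass_at (Poly_Mapping.single 0 r * jumps \<phi>) s
      = integ (Poly_Mapping.single 0 r * jumps \<phi>) (\<lambda>a. if a = s then 1 else 0)"
    by (simp add: integ_def if_distrib[of "\<lambda>x. _ * x"] sum.delta in_keys_iff cong: if_cong)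
  also have "\<dots> = r * integ (jumps \<phi>) (\<lambda>a. if a = s then 1 else 0)"
    by (simp add: integ_mult)
  also have "\<dots> = r * mass_at (jumps \<phi>) s"
    by (simp add: integ_def if_distrib[of "\<lambda>x. _ * x"] sum.delta in_keys_iff cong: if_cong)
  finally show "mass_at (jumps (\<lambda>t. r * \<phi> t)) s
      = mass_at (Poly_Mapping.single 0 r * jumps \<phi>) s"
    by (simp add: lookup_jumps[OF assms] lookup_jumps[OF ec] algebra_simps)
qed

text \<open>
  A cut-off at \<open>0\<close> contributes a point mass; in the regularized elimination it represents the
  upper boundary of the inequality at a vertex of \<open>I\<close>.
\<close>

lemma jumps_step: "jumps (\<lambda>t. if t \<ge> 0 then c else 0) = Poly_Mapping.single 0 c"
proof (rule poly_mapping_eqI)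
  fix s
  have ec: "eventually_const (\<lambda>t. if t \<ge> 0 then c else 0) 0 c"
    unfolding eventually_const_def by (intro exI[of _ 1]) auto
  show "mass_at (jumps (\<lambda>t. if t \<ge> 0 then c else 0)) s
      = mass_at (Poly_Mapping.single 0 c) s"
    by (auto simp: lookup_jumps[OF ec] lookup_single when_def)
qed

text \<open>
  The boundary terms are absent as soon as the products have finite support; in the
  application \<open>\<phi>\<close> vanishes on one side and \<open>g\<close> on the other.
\<close>

lemma sum_by_parts:
  fixes \<phi> g :: "int \<Rightarrow> real"
  assumes "finite {t. \<phi> t \<noteq> 0 \<and> g t \<noteq> 0}" "finite {t. \<phi> t \<noteq> 0 \<and> g (t + 1) \<noteq> 0}"
  shows "Sum_any (\<lambda>t. \<phi> t * (g t - g (t + 1))) = Sum_any (\<lambda>t. (\<phi> t - \<phi> (t - 1)) * g t)"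
proof -
  have f1: "finite {t. \<phi> t * g t \<noteq> 0}" and f2: "finite {t. \<phi> t * g (t + 1) \<noteq> 0}"
    using assms by auto
  have f3: "finite {t. \<phi> (t - 1) * g t \<noteq> 0}"
  proof -
    have "{t. \<phi> (t - 1) * g t \<noteq> 0} = (\<lambda>t. t + 1) ` {t. \<phi> t * g (t + 1) \<noteq> 0}"
      by (auto simp: image_iff) (metis diff_add_cancel)
    then show ?thesis using f2 by simp
  qed
  have re: "Sum_any (\<lambda>t. \<phi> t * g (t + 1)) = Sum_any (\<lambda>t. \<phi> (t - 1) * g t)"
    by (rule Sum_any.reindex_cong[of "\<lambda>t. t - 1"])
       (auto simp: bij_def inj_def surj_def fun_eq_iff intro: exI[of _ "_ + 1"])
  have "Sum_any (\<lambda>t. \<phi> t * (g t - g (t + 1)))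
      = Sum_any (\<lambda>t. \<phi> t * g t + - (\<phi> t * g (t + 1)))"
    by (simp add: algebra_simps)
  also have "\<dots> = Sum_any (\<lambda>t. \<phi> t * g t) + Sum_any (\<lambda>t. - (\<phi> t * g (t + 1)))"
    using f1 f2 by (intro Sum_any.distrib) auto
  also have "Sum_any (\<lambda>t. - (\<phi> t * g (t + 1))) = - Sum_any (\<lambda>t. \<phi> t * g (t + 1))"
    using Sum_any_right_distrib[OF f2, of "-1"] by simp
  also have "\<dots> = - Sum_any (\<lambda>t. \<phi> (t - 1) * g t)" using re by simp
  also have "\<dots> = Sum_any (\<lambda>t. - (\<phi> (t - 1) * g t))"
    using Sum_any_right_distrib[OF f3, of "-1"] by simp
  also have "Sum_any (\<lambda>t. \<phi> t * g t) + Sum_any (\<lambda>t. - (\<phi> (t - 1) * g t))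
      = Sum_any (\<lambda>t. \<phi> t * g t + - (\<phi> (t - 1) * g t))"
    using f1 f3 by (intro Sum_any.distrib[symmetric]) auto
  finally show ?thesis by (simp add: algebra_simps)
qed

section \<open>Coefficients of powers of \<open>1 - X\<close>\<close>

text \<open>
  With \<open>R\<close> the coefficients of an expansion of \<open>(1 - X)\<^sup>-\<^sup>2\<close>, these are the coefficients of the
  corresponding expansion of \<open>(1 - X)^(k - 2)\<close>.
\<close>

primrec binom_coeff :: "(int \<Rightarrow> real) \<Rightarrow> nat \<Rightarrow> int \<Rightarrow> real" where
  "binom_coeff R 0 n = R n"
| "binom_coeff R (Suc k) n = binom_coeff R k n - binom_coeff R k (n - 1)"

text \<open>
  The expansions of \<open>(1 - X)\<^sup>-\<^sup>2\<close> at \<open>X = 0\<close> and at \<open>X = \<infinity>\<close>. Their difference is the linear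
  function \<open>n + 1\<close>, the source of all polynomial behaviour below.
\<close>

definition inv_sq_zero :: "int \<Rightarrow> real" where
  "inv_sq_zero n = max 0 (of_int n + 1)"

definition inv_sq_infinity :: "int \<Rightarrow> real" where
  "inv_sq_infinity n = max 0 (- (of_int n + 1))"

definition heaviside :: "int \<Rightarrow> real" where
  "heaviside n = (if n \<ge> 0 then 1 else 0)"

lemma binom_coeff_zero_1: "binom_coeff inv_sq_zero (Suc 0) n = heaviside n"
  by (auto simp: inv_sq_zero_def heaviside_def max_def)

lemma binom_coeff_infinity_1: "binom_coeff inv_sq_infinity (Suc 0) n = heaviside n - 1"
  by (auto simp: inv_sq_infinity_def heaviside_def max_def)

lemma binom_coeff_zero_neg: "n < 0 \<Longrightarrow> binom_coeff inv_sq_zero k n = 0"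
  by (induction k arbitrary: n) (auto simp: inv_sq_zero_def max_def)

lemma binom_coeff_infinity_large: "n \<ge> int k - 1 \<Longrightarrow> binom_coeff inv_sq_infinity k n = 0"
  by (induction k arbitrary: n) (auto simp: inv_sq_infinity_def max_def)

section \<open>Linear bounds for the supports of kernels\<close>

type_synonym kernel = "int \<Rightarrow> measure_int"

text \<open>
  For a vertex with argument \<open>t\<close> the support stays above a line of slope \<open>c\<close> for \<open>t \<ge> 0\<close> and
  below such a line for \<open>t \<le> 0\<close>. The constants matter: \<open>L \<le> -c\<close> is the deep range and
  \<open>M = 0\<close> the range of nonpositive \<open>A\<close>, and both are stable under elimination.
\<close>

definition slope_bound :: "real \<Rightarrow> real \<Rightarrow> real \<Rightarrow> kernel \<Rightarrow> bool" where
  "slope_bound c L M \<kappa> \<longleftrightarrow>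
     (\<forall>t\<ge>0. \<forall>a\<in>supp (\<kappa> t). c * of_int t - L \<le> of_int a) \<and>
     (\<forall>t\<le>0. \<forall>a\<in>supp (\<kappa> t). of_int a \<le> c * of_int t + M)"

text \<open>
  The weights with which leaves are eliminated have this common form; \<open>d\<close> is the factor by
  which the mass of the leaf is multiplied, namely \<open>0\<close> at the vertices of \<open>I\<close> and \<open>1\<close> elsewhere.
\<close>

definition admissible :: "real \<Rightarrow> (int \<Rightarrow> int \<Rightarrow> real) \<Rightarrow> bool" where
  "admissible d \<psi> \<longleftrightarrow>
     (\<exists>c. (\<forall>t\<ge>0. \<forall>n\<ge>0. \<psi> t n = c + d) \<and> (\<forall>t<0. \<forall>n<0. \<psi> t n = c))"

text \<open>
  Here \<open>t\<close> is the argument of a leaf and \<open>\<eta>\<close> the argument of its neighbour. With the weights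
  used below this is, up to truncation and a constant, the tail at \<open>\<eta>\<close> of the leaf measure.
\<close>

definition profile :: "(int \<Rightarrow> int \<Rightarrow> real) \<Rightarrow> kernel \<Rightarrow> int \<Rightarrow> int \<Rightarrow> real" where
  "profile \<psi> \<kappa> \<eta> t = integ (\<kappa> t) (\<lambda>a. \<psi> t (a - \<eta>))"

definition push :: "(int \<Rightarrow> int \<Rightarrow> real) \<Rightarrow> kernel \<Rightarrow> kernel" where
  "push \<psi> \<kappa> \<eta> = jumps (profile \<psi> \<kappa> \<eta>)"

locale bounded_kernel =
  fixes c L M m :: real and \<kappa> :: kernel
  assumes c_pos: "c > 0" and bound: "slope_bound c L M \<kappa>" and mass_const: "\<And>t. mass (\<kappa> t) = m"
begin

lemma profile_high:
  assumes "\<And>t n. t \<ge> 0 \<Longrightarrow> n \<ge> 0 \<Longrightarrow> \<psi> t n = b" "t \<ge> 0" "of_int \<eta> + L \<le> c * of_int t"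
  shows "profile \<psi> \<kappa> \<eta> t = b * m"
proof -
  have "profile \<psi> \<kappa> \<eta> t = integ (\<kappa> t) (\<lambda>a. b)"
    unfolding profile_def
  proof (rule integ_cong)
    fix a assume "a \<in> supp (\<kappa> t)"
    then have "c * of_int t - L \<le> of_int a" using bound assms(2) by (auto simp: slope_bound_def)
    then have "a - \<eta> \<ge> 0" using assms(3) by linarith
    then show "\<psi> t (a - \<eta>) = b" using assms(1,2) by simp
  qed
  then show ?thesis by (simp add: integ_const[of _ b] mass_const)
qed

lemma profile_low:
  assumes "\<And>t n. t < 0 \<Longrightarrow> n < 0 \<Longrightarrow> \<psi> t n = b" "t < 0" "c * of_int t + M < of_int \<eta>"
  shows "profile \<psi> \<kappa> \<eta> t = b * m"
proof -
  have "profile \<psi> \<kappa> \<eta> t = integ (\<kappa> t) (\<lambda>a. b)"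
    unfolding profile_def
  proof (rule integ_cong)
    fix a assume "a \<in> supp (\<kappa> t)"
    then have "of_int a \<le> c * of_int t + M" using bound assms(2) by (auto simp: slope_bound_def)
    then have "a - \<eta> < 0" using assms(3) by linarith
    then show "\<psi> t (a - \<eta>) = b" using assms(1,2) by simp
  qed
  then show ?thesis by (simp add: integ_const[of _ b] mass_const)
qed

lemma profile_eventually_const':
  assumes hi: "\<And>t n. t \<ge> 0 \<Longrightarrow> n \<ge> 0 \<Longrightarrow> \<psi> t n = b'"
    and lo: "\<And>t n. t < 0 \<Longrightarrow> n < 0 \<Longrightarrow> \<psi> t n = b"
  shows "eventually_const (profile \<psi> \<kappa> \<eta>) (b * m) (b' * m)"
proof -
  define T where "T = max 1 (max \<lceil>(of_int \<eta> + L) / c\<rceil> (\<lceil>- ((of_int \<eta> - M) / c)\<rceil> + 1))"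
  have T: "T \<ge> 1" "(of_int \<eta> + L) / c \<le> of_int T" "- ((of_int \<eta> - M) / c) + 1 \<le> of_int T"
  proof -
    have "T \<ge> \<lceil>(of_int \<eta> + L) / c\<rceil>" "T \<ge> \<lceil>- ((of_int \<eta> - M) / c)\<rceil> + 1" "T \<ge> 1"
      unfolding T_def by simp_all
    then show "T \<ge> 1" "(of_int \<eta> + L) / c \<le> of_int T" "- ((of_int \<eta> - M) / c) + 1 \<le> of_int T"
      by linarith+
  qed
  have "profile \<psi> \<kappa> \<eta> t = b' * m" if "t \<ge> T" for t
  proof (rule profile_high[OF hi])
    have "(of_int \<eta> + L) / c \<le> of_int t" using T(2) that by linarith
    then show "of_int \<eta> + L \<le> c * of_int t" using c_pos by (simp add: field_simps)
  qed (use T that in auto)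
  moreover have "profile \<psi> \<kappa> \<eta> t = b * m" if "t \<le> - T" for t
  proof (rule profile_low[OF lo])
    have "of_int t < (of_int \<eta> - M) / c" using T(3) that by linarith
    then show "c * of_int t + M < of_int \<eta>" using c_pos by (simp add: field_simps)
  qed (use T that in auto)
  ultimately show ?thesis unfolding eventually_const_def by blast
qed

lemma profile_eventually_const:
  assumes "admissible d \<psi>"
  shows "\<exists>b. eventually_const (profile \<psi> \<kappa> \<eta>) (b * m) ((b + d) * m)"
proof -
  obtain b where "\<forall>t\<ge>0. \<forall>n\<ge>0. \<psi> t n = b + d" "\<forall>t<0. \<forall>n<0. \<psi> t n = b"
    using assms by (auto simp: admissible_def)
  then show ?thesis by (intro exI[of _ b] profile_eventually_const') auto
qed

text \<open>
  The mass of a jump measure is the difference of the two limits of the profile.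
\<close>

lemma mass_push:
  assumes "admissible d \<psi>"
  shows "mass (push \<psi> \<kappa> \<eta>) = d * m"
proof -
  obtain b where "eventually_const (profile \<psi> \<kappa> \<eta>) (b * m) ((b + d) * m)"
    using profile_eventually_const[OF assms] by blast
  then show ?thesis by (simp add: push_def mass_jumps algebra_simps)
qed

lemma keys_push_lower:
  assumes "admissible d \<psi>" "s \<in> supp (push \<psi> \<kappa> \<eta>)"
  shows "of_int s \<ge> - max 0 (1 + (of_int \<eta> + L) / c)"
proof (rule ccontr)
  assume "\<not> ?thesis"
  then have s: "- real_of_int s > 0" "- real_of_int s > 1 + (of_int \<eta> + L) / c" by auto
  obtain b where b: "\<And>t n. t \<ge> 0 \<Longrightarrow> n \<ge> 0 \<Longrightarrow> \<psi> t n = b + d" "\<And>t n. t < 0 \<Longrightarrow> n < 0 \<Longrightarrow> \<psi> t n = b"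
    using assms(1) by (auto simp: admissible_def)
  have ne: "profile \<psi> \<kappa> \<eta> (- s) \<noteq> profile \<psi> \<kappa> \<eta> (- s - 1)"
    using assms(2) profile_eventually_const[OF assms(1), of \<eta>] keys_jumps by (auto simp: push_def)
  have "- s \<ge> 1" using s(1) by linarith
  have "c * (- real_of_int s - 1) \<ge> of_int \<eta> + L"
    using s(2) c_pos by (simp add: field_simps)
  then have "c * of_int (- s - 1) \<ge> of_int \<eta> + L" by simp
  moreover have "c * of_int (- s) \<ge> c * of_int (- s - 1)"
    using c_pos by (intro mult_left_mono) auto
  ultimately have "profile \<psi> \<kappa> \<eta> (- s) = (b + d) * m" "profile \<psi> \<kappa> \<eta> (- s - 1) = (b + d) * m"
    using \<open>- s \<ge> 1\<close> by (auto intro!: profile_high[OF b(1)])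
  then show False using ne by simp
qed

lemma keys_push_upper:
  assumes "admissible d \<psi>" "s \<in> supp (push \<psi> \<kappa> \<eta>)" "\<eta> \<le> 0" "M \<ge> 0"
  shows "of_int s \<le> (M - of_int \<eta>) / c"
proof (rule ccontr)
  assume "\<not> ?thesis"
  then have s: "real_of_int s * c > M - of_int \<eta>" using c_pos by (simp add: field_simps)
  obtain b where b: "\<And>t n. t \<ge> 0 \<Longrightarrow> n \<ge> 0 \<Longrightarrow> \<psi> t n = b + d" "\<And>t n. t < 0 \<Longrightarrow> n < 0 \<Longrightarrow> \<psi> t n = b"
    using assms(1) by (auto simp: admissible_def)
  have ne: "profile \<psi> \<kappa> \<eta> (- s) \<noteq> profile \<psi> \<kappa> \<eta> (- s - 1)"
    using assms(2) profile_eventually_const[OF assms(1), of \<eta>] keys_jumps by (auto simp: push_def)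
  have "real_of_int s * c > 0" using s assms(3,4) by linarith
  then have "s > 0" using c_pos by (simp add: zero_less_mult_iff)
  have "c * of_int (- s) + M < of_int \<eta>" using s by (simp add: algebra_simps)
  moreover have "c * of_int (- s - 1) \<le> c * of_int (- s)"
    using c_pos by (intro mult_left_mono) auto
  ultimately have "profile \<psi> \<kappa> \<eta> (- s) = b * m" "profile \<psi> \<kappa> \<eta> (- s - 1) = b * m"
    using \<open>s > 0\<close> by (auto intro!: profile_low[OF b(2)])
  then show False using ne by simp
qed

text \<open>
  One step of Gaussian elimination on the level of supports: the slope \<open>cp\<close> decreases by
  \<open>1 / c\<close>. The correction of the lower constant is \<open>0\<close> exactly when \<open>L \<le> -c\<close>, and the correction
  of the upper one is \<open>0\<close> when \<open>M = 0\<close>.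
\<close>

lemma slope_bound_push:
  assumes adm: "admissible d \<psi>" and M: "M \<ge> 0" and p: "slope_bound cp Lp Mp \<kappa>p"

  shows "slope_bound (cp - 1 / c) (Lp + max 0 (1 + L / c)) (Mp + M / c) (\<lambda>\<eta>. \<kappa>p \<eta> * push \<psi> \<kappa> \<eta>)"
  unfolding slope_bound_def
proof (intro conjI allI impI ballI)
  fix t :: int and a assume t: "0 \<le> t" and a: "a \<in> supp (\<kappa>p t * push \<psi> \<kappa> t)"
  then obtain a1 s where as: "a = a1 + s" "a1 \<in> supp (\<kappa>p t)"
      "s \<in> supp (push \<psi> \<kappa> t)"
    using keys_mult[of "\<kappa>p t" "push \<psi> \<kappa> t"] by blast
  have 1: "cp * of_int t - Lp \<le> of_int a1" using p as(2) t by (auto simp: slope_bound_def)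
  have 2: "- max 0 (1 + (of_int t + L) / c) \<le> of_int s" by (rule keys_push_lower[OF adm as(3)])
  have "(of_int t + L) / c = of_int t / c + L / c" "of_int t / c \<ge> 0"
    using t c_pos by (auto simp: add_divide_distrib)
  then show "(cp - 1 / c) * of_int t - (Lp + max 0 (1 + L / c)) \<le> of_int a"
    using 1 2 as(1) by (simp add: left_diff_distrib max_def split: if_splits)
next
  fix t :: int and a assume t: "t \<le> 0" and a: "a \<in> supp (\<kappa>p t * push \<psi> \<kappa> t)"
  then obtain a1 s where as: "a = a1 + s" "a1 \<in> supp (\<kappa>p t)"
      "s \<in> supp (push \<psi> \<kappa> t)"
    using keys_mult[of "\<kappa>p t" "push \<psi> \<kappa> t"] by blast
  have 1: "of_int a1 \<le> cp * of_int t + Mp" using p as(2) t by (auto simp: slope_bound_def)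
  have 2: "of_int s \<le> (M - of_int t) / c" by (rule keys_push_upper[OF adm as(3) t M])
  show "of_int a \<le> (cp - 1 / c) * of_int t + (Mp + M / c)"
    using 1 2 as(1) by (simp add: left_diff_distrib diff_divide_distrib)
qed

end

lemma slope_bound_weaken:
  assumes "slope_bound c L M \<kappa>" "c' \<le> c" "L \<le> L'" "M \<le> M'"
  shows "slope_bound c' L' M' \<kappa>"
proof -
  have "c' * of_int t \<le> c * of_int t" if "t \<ge> 0" for t :: int
    using that assms(2) by (intro mult_right_mono) auto
  moreover have "c * of_int t \<le> c' * of_int t" if "t \<le> 0" for t :: int
    using that assms(2) by (intro mult_right_mono_neg) auto
  ultimately show ?thesis
    using assms(1,3,4) unfolding slope_bound_def by fastforce
qed

section \<open>Trees grown from a root and elimination of a leaf\<close>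

text \<open>
  Read backwards, the construction is an order in which all vertices except the root can be removed
  as leaves.
\<close>

inductive tree_on :: "('v \<Rightarrow> 'v \<Rightarrow> bool) \<Rightarrow> 'v \<Rightarrow> 'v set \<Rightarrow> bool" for adj r where
  root: "tree_on adj r {r}"
| leaf: "tree_on adj r U \<Longrightarrow> p \<in> U \<Longrightarrow> e \<notin> U \<Longrightarrow> adj e p \<Longrightarrow> (\<And>w. w \<in> U \<Longrightarrow> adj e w \<Longrightarrow> w = p)
         \<Longrightarrow> tree_on adj r (insert e U)"

locale graph =
  fixes adj :: "'v::finite \<Rightarrow> 'v \<Rightarrow> bool"
  assumes adj_sym: "adj u v \<Longrightarrow> adj v u" and adj_irrefl: "\<not> adj v v"
begin

definition nbrs :: "'v set \<Rightarrow> 'v \<Rightarrow> 'v set" where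
  "nbrs U u = {w\<in>U. adj u w}"

text \<open>
  Every vertex \<open>u\<close> carries a family of measures \<open>\<kappa> u t\<close>, the distribution of what is left of
  the exponent \<open>a\<^sub>u\<close> after the eliminated neighbours have been taken into account. Initially it is
  a point mass. Summation over all functions is made to mean summation over \<open>\<int>\<^sup>U\<close> by
  extending with \<open>0\<close>.
\<close>

definition state_sum_term ::
  "(int \<Rightarrow> real) \<Rightarrow> ('v \<Rightarrow> int \<Rightarrow> real) \<Rightarrow> 'v set \<Rightarrow> ('v \<Rightarrow> kernel) \<Rightarrow> ('v \<Rightarrow> int) \<Rightarrow> real" where
  "state_sum_term R \<omega> U \<kappa> y =
     (if \<forall>v. v \<notin> U \<longrightarrow> y v = 0 then
       \<Prod>u\<in>U. \<omega> u (y u) * integ (\<kappa> u (y u))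
          (\<lambda>a. binom_coeff R (card (nbrs U u)) (a - (\<Sum>w\<in>nbrs U u. y w)))
      else 0)"

definition eliminate :: "(int \<Rightarrow> int \<Rightarrow> real) \<Rightarrow> 'v \<Rightarrow> 'v \<Rightarrow> ('v \<Rightarrow> kernel) \<Rightarrow> 'v \<Rightarrow> kernel" where
  "eliminate \<psi> e p \<kappa> = \<kappa>(p := (\<lambda>\<eta>. \<kappa> p \<eta> * push \<psi> (\<kappa> e) \<eta>))"

definition leaf_of :: "'v \<Rightarrow> 'v \<Rightarrow> 'v set \<Rightarrow> bool" where
  "leaf_of e p U \<longleftrightarrow> p \<in> U \<and> e \<notin> U \<and> adj e p \<and> (\<forall>w\<in>U. adj e w \<longrightarrow> w = p)"

lemma nbrs_leaf:
  assumes "leaf_of e p U"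
  shows "nbrs (insert e U) e = {p}"
    and "nbrs (insert e U) p = insert e (nbrs U p)" "e \<notin> nbrs U p"
    and "u \<in> U \<Longrightarrow> u \<noteq> p \<Longrightarrow> nbrs (insert e U) u = nbrs U u"
  using assms adj_sym adj_irrefl unfolding leaf_of_def nbrs_def by auto

text \<open>
  With the leaf \<open>e\<close> the valency of \<open>p\<close> drops by one, so its factor for \<open>insert e U\<close> is a
  difference of two factors for \<open>U\<close>, and summation by parts moves this difference onto the
  profile of the leaf.
\<close>

lemma sum_state_sum_term_leaf:
  fixes \<kappa> :: "'v \<Rightarrow> kernel"
  defines "k U u \<equiv> card (nbrs U u)"
  assumes lf: "leaf_of e p U" and y: "\<forall>v. v \<notin> U \<longrightarrow> y v = 0"
    and ec: "eventually_const (profile \<psi> (\<kappa> e) (y p)) c d"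
    and \<psi>: "\<And>t n. \<psi> t n = \<omega> e t * binom_coeff R (Suc 0) n"
    and side: "c = 0 \<and> (\<forall>k. \<exists>T. \<forall>n\<le>T. binom_coeff R k n = 0)
             \<or> d = 0 \<and> (\<forall>k. \<exists>T. \<forall>n\<ge>T. binom_coeff R k n = 0)"
  shows "Sum_any (\<lambda>t. state_sum_term R \<omega> (insert e U) \<kappa> (y(e := t)))
       = state_sum_term R \<omega> U (eliminate \<psi> e p \<kappa>) y"
proof -
  define \<phi> where "\<phi> = profile \<psi> (\<kappa> e) (y p)"
  define s where "s = (\<Sum>w\<in>nbrs U p. y w)"
  define g where "g = (\<lambda>t. integ (\<kappa> p (y p)) (\<lambda>a. binom_coeff R (k U p) (a - s - t)))"
  define rest where "rest = (\<Prod>u\<in>U - {p}. \<omega> u (y u) * integ (\<kappa> u (y u))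
          (\<lambda>a. binom_coeff R (k U u) (a - (\<Sum>w\<in>nbrs U u. y w))))"
  have lf': "p \<in> U" "e \<notin> U" "e \<noteq> p" using lf by (auto simp: leaf_of_def)
  note nb = nbrs_leaf[OF lf]
  have summand: "state_sum_term R \<omega> (insert e U) \<kappa> (y(e := t))
      = \<phi> t * (g t - g (t + 1)) * (\<omega> p (y p) * rest)" for t
  proof -
    let ?y = "y(e := t)"
    let ?f = "\<lambda>u. \<omega> u (?y u) * integ (\<kappa> u (?y u))
          (\<lambda>a. binom_coeff R (k (insert e U) u) (a - (\<Sum>w\<in>nbrs (insert e U) u. ?y w)))"
    have "\<forall>v. v \<notin> insert e U \<longrightarrow> ?y v = 0" using y by auto
    then have "state_sum_term R \<omega> (insert e U) \<kappa> ?y = (\<Prod>u\<in>insert e U. ?f u)"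
      by (simp add: state_sum_term_def k_def)
    also have "\<dots> = ?f e * (?f p * (\<Prod>u\<in>U - {p}. ?f u))"
      using lf' by (simp add: prod.remove)
    also have "?f e = \<phi> t"
      using lf' by (simp add: nb(1) k_def \<phi>_def profile_def \<psi> integ_scale_fun)
    also have "?f p = \<omega> p (y p) * (g t - g (t + 1))"
    proof -
      have "(\<Sum>w\<in>nbrs U p. (y(e := t)) w) = s"
        unfolding s_def using nb(3) by (intro sum.cong) auto
      then have "(\<Sum>w\<in>nbrs (insert e U) p. (y(e := t)) w) = t + s"
        by (subst nb(2)) (use nb(3) in \<open>simp del: fun_upd_apply, simp\<close>)
      moreover have "k (insert e U) p = Suc (k U p)"
        unfolding k_def using nb(3) by (simp add: nb(2))
      moreover have "(\<lambda>a. binom_coeff R (k U p) (a - (t + s))) = (\<lambda>a. binom_coeff R (k U p) (a - s - t))"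
        "(\<lambda>a. binom_coeff R (k U p) (a - (t + s) - 1)) = (\<lambda>a. binom_coeff R (k U p) (a - s - (t + 1)))"
        by (simp_all add: algebra_simps)
      ultimately show ?thesis
        using lf' by (simp only: g_def integ_diff_fun binom_coeff.simps(2)) simp
    qed
    also have "(\<Prod>u\<in>U - {p}. ?f u) = rest"
      unfolding rest_def
    proof (rule prod.cong[OF refl])
      fix u assume u: "u \<in> U - {p}"
      then have "u \<noteq> e" using lf' by auto
      moreover have "nbrs (insert e U) u = nbrs U u" using nb(4) u by auto
      moreover have "(\<Sum>w\<in>nbrs U u. ?y w) = (\<Sum>w\<in>nbrs U u. y w)"
        using lf' by (intro sum.cong) (auto simp: nbrs_def)
      ultimately show "?f u = \<omega> u (y u) * integ (\<kappa> u (y u))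
          (\<lambda>a. binom_coeff R (k U u) (a - (\<Sum>w\<in>nbrs U u. y w)))"
        by (simp add: k_def)
    qed
    finally show ?thesis by (simp only: mult_ac)
  qed
  \<comment> \<open>The profile dies out on one side and the expansion coefficients on the other one.\<close>
  have fin: "finite {t. \<phi> t \<noteq> 0 \<and> g (t + j) \<noteq> 0}" for j
  proof -
    obtain T where T: "\<forall>t\<ge>T. \<phi> t = d" "\<forall>t\<le>-T. \<phi> t = c"
      using ec by (auto simp: eventually_const_def \<phi>_def)
    let ?K = "supp (\<kappa> p (y p))"
    from side show ?thesis
    proof
      assume "c = 0 \<and> (\<forall>k. \<exists>T. \<forall>n\<le>T. binom_coeff R k n = 0)"
      then obtain N where N: "c = 0" "\<forall>n\<le>N. binom_coeff R (k U p) n = 0" by blast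
      have "g (t + j) = 0" if "\<forall>a\<in>?K. a - s - (t + j) \<le> N" for t
        using that N unfolding g_def by (subst integ_cong[where g = "\<lambda>_. 0"]) (auto simp: integ_def)
      moreover have "\<forall>a\<in>?K. a - s - (t + j) \<le> N" if "t \<ge> Max (insert 0 ?K) - s - j - N" for t
      proof
        fix a assume "a \<in> ?K"
        then have "a \<le> Max (insert 0 ?K)" by (intro Max_ge) auto
        then show "a - s - (t + j) \<le> N" using that by linarith
      qed
      ultimately have "{t. \<phi> t \<noteq> 0 \<and> g (t + j) \<noteq> 0} \<subseteq> {-T .. Max (insert 0 ?K) - s - j - N}"
        using T N(1) by (intro subsetI) (metis (mono_tags, lifting) atLeastAtMost_iff mem_Collect_eq linorder_le_cases)
      then show ?thesis by (rule finite_subset) simp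
    next
      assume "d = 0 \<and> (\<forall>k. \<exists>T. \<forall>n\<ge>T. binom_coeff R k n = 0)"
      then obtain N where N: "d = 0" "\<forall>n\<ge>N. binom_coeff R (k U p) n = 0" by blast
      have "g (t + j) = 0" if "\<forall>a\<in>?K. a - s - (t + j) \<ge> N" for t
        using that N unfolding g_def by (subst integ_cong[where g = "\<lambda>_. 0"]) (auto simp: integ_def)
      moreover have "\<forall>a\<in>?K. a - s - (t + j) \<ge> N" if "t \<le> Min (insert 0 ?K) - s - j - N" for t
      proof
        fix a assume "a \<in> ?K"
        then have "a \<ge> Min (insert 0 ?K)" by (intro Min_le) auto
        then show "a - s - (t + j) \<ge> N" using that by linarith
      qed
      ultimately have "{t. \<phi> t \<noteq> 0 \<and> g (t + j) \<noteq> 0} \<subseteq> {Min (insert 0 ?K) - s - j - N .. T}"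
        using T N(1) by (intro subsetI) (metis (mono_tags, lifting) atLeastAtMost_iff mem_Collect_eq linorder_le_cases)
      then show ?thesis by (rule finite_subset) simp
    qed
  qed
  have fin2: "finite {t. \<phi> t * (g t - g (t + 1)) \<noteq> 0}"
    by (rule finite_subset[OF _ finite_UnI[OF fin[of 0] fin[of 1]]]) auto
  have "Sum_any (\<lambda>t. state_sum_term R \<omega> (insert e U) \<kappa> (y(e := t)))
      = Sum_any (\<lambda>t. \<phi> t * (g t - g (t + 1))) * (\<omega> p (y p) * rest)"
    unfolding summand by (rule Sum_any_left_distrib[OF fin2, symmetric])
  also have "Sum_any (\<lambda>t. \<phi> t * (g t - g (t + 1))) = Sum_any (\<lambda>t. (\<phi> t - \<phi> (t - 1)) * g t)"
    using fin[of 0] fin[of 1] by (intro sum_by_parts) simp_all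
  also have "\<dots> = integ (jumps \<phi>) (\<lambda>b. g (- b))"
    by (subst integ_jumps[OF ec[folded \<phi>_def]]) simp
  also have "\<dots> = integ (\<kappa> p (y p) * push \<psi> (\<kappa> e) (y p)) (\<lambda>a. binom_coeff R (k U p) (a - s))"
  proof -
    have "integ (\<kappa> p (y p) * push \<psi> (\<kappa> e) (y p)) (\<lambda>a. binom_coeff R (k U p) (a - s))
        = integ (push \<psi> (\<kappa> e) (y p) * \<kappa> p (y p)) (\<lambda>a. binom_coeff R (k U p) (a - s))"
      by (simp add: mult.commute)
    also have "\<dots> = integ (jumps \<phi>) (\<lambda>b. g (- b))"
      by (simp add: integ_mult push_def \<phi>_def[symmetric] g_def algebra_simps)
    finally show ?thesis by simp
  qed
  also have "\<dots> * (\<omega> p (y p) * rest) = state_sum_term R \<omega> U (eliminate \<psi> e p \<kappa>) y"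
  proof -
    have "(\<Prod>u\<in>U - {p}. \<omega> u (y u) * integ (eliminate \<psi> e p \<kappa> u (y u))
          (\<lambda>a. binom_coeff R (k U u) (a - (\<Sum>w\<in>nbrs U u. y w)))) = rest"
      unfolding rest_def by (intro prod.cong) (auto simp: eliminate_def)
    then show ?thesis
      using y lf'(1) unfolding state_sum_term_def
      by (simp add: prod.remove[OF _ lf'(1)] k_def s_def eliminate_def mult_ac)
  qed
  finally show ?thesis .
qed

text \<open>
  Fubini for one coordinate; the remaining functions are represented by those that vanish at
  \<open>e\<close>.
\<close>

lemma Sum_any_fun_upd:
  fixes F :: "('v \<Rightarrow> int) \<Rightarrow> real" and e :: 'v
  assumes fin: "finite {y. F y \<noteq> 0}"
  defines "G \<equiv> (\<lambda>y. if y e = 0 then Sum_any (\<lambda>t. F (y(e := t))) else 0)"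
  shows "finite {y. G y \<noteq> 0}" "Sum_any F = Sum_any G"
proof -
  let ?S = "{y. F y \<noteq> 0}"
  let ?P = "(\<lambda>y. y(e := 0)) ` ?S"
  have sub: "{y. G y \<noteq> 0} \<subseteq> ?P"
  proof
    fix y assume "y \<in> {y. G y \<noteq> 0}"
    then have 0: "y e = 0" and "Sum_any (\<lambda>t. F (y(e := t))) \<noteq> 0"
      by (auto simp: G_def split: if_splits)
    then obtain t where "F (y(e := t)) \<noteq> 0"
      using Sum_any.not_neutral_obtains_not_neutral by blast
    moreover have "y = (y(e := t))(e := 0)" using 0 by auto
    ultimately show "y \<in> ?P" by blast
  qed
  show "finite {y. G y \<noteq> 0}" by (rule finite_subset[OF sub]) (use fin in simp)
  have "Sum_any F = sum F ?S" using fin by (intro Sum_any.expand_superset) auto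
  also have "\<dots> = (\<Sum>y\<in>?P. \<Sum>x\<in>{x\<in>?S. x(e := 0) = y}. F x)"
    using fin by (intro sum.group[symmetric]) auto
  also have "\<dots> = (\<Sum>y\<in>?P. G y)"
  proof (rule sum.cong[OF refl])
    fix y assume y: "y \<in> ?P"
    then have ye: "y e = 0" by auto
    let ?X = "{x\<in>?S. x(e := 0) = y}"
    have inj: "inj_on (\<lambda>x. x e) ?X"
      by (rule inj_onI) (smt (verit, best) fun_upd_triv fun_upd_upd mem_Collect_eq)
    have x_eq: "x = y(e := x e)" if "x \<in> ?X" for x using that by auto
    have "(\<Sum>x\<in>?X. F x) = (\<Sum>x\<in>?X. F (y(e := x e)))"
      using x_eq by (intro sum.cong) auto
    also have "\<dots> = (\<Sum>t\<in>(\<lambda>x. x e) ` ?X. F (y(e := t)))"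
      by (subst sum.reindex[OF inj]) simp
    also have "\<dots> = Sum_any (\<lambda>t. F (y(e := t)))"
    proof (rule Sum_any.expand_superset[symmetric])
      show "finite ((\<lambda>x. x e) ` ?X)" using fin by simp
      show "{t. F (y(e := t)) \<noteq> 0} \<subseteq> (\<lambda>x. x e) ` ?X"
      proof
        fix t assume "t \<in> {t. F (y(e := t)) \<noteq> 0}"
        then have "y(e := t) \<in> ?X" using ye by (auto intro!: ext)
        then show "t \<in> (\<lambda>x. x e) ` ?X" by (rule rev_image_eqI) simp
      qed
    qed
    finally show "(\<Sum>x\<in>?X. F x) = G y" using ye by (simp add: G_def)
  qed
  also have "\<dots> = Sum_any G"
    using fin sub by (intro Sum_any.expand_superset[symmetric]) auto
  finally show "Sum_any F = Sum_any G" .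
qed

lemma state_sum_eliminate:
  fixes \<kappa> :: "'v \<Rightarrow> kernel"
  assumes lf: "leaf_of e p U"
    and ec: "\<And>\<eta>. eventually_const (profile \<psi> (\<kappa> e) \<eta>) c d"
    and \<psi>: "\<And>t n. \<psi> t n = \<omega> e t * binom_coeff R (Suc 0) n"
    and side: "c = 0 \<and> (\<forall>k. \<exists>T. \<forall>n\<le>T. binom_coeff R k n = 0)
             \<or> d = 0 \<and> (\<forall>k. \<exists>T. \<forall>n\<ge>T. binom_coeff R k n = 0)"
    and fin: "finite {y. state_sum_term R \<omega> (insert e U) \<kappa> y \<noteq> 0}"
  shows "finite {y. state_sum_term R \<omega> U (eliminate \<psi> e p \<kappa>) y \<noteq> 0}"
    and "Sum_any (state_sum_term R \<omega> (insert e U) \<kappa>)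
       = Sum_any (state_sum_term R \<omega> U (eliminate \<psi> e p \<kappa>))"
proof -
  let ?F = "state_sum_term R \<omega> (insert e U) \<kappa>"
  let ?F' = "state_sum_term R \<omega> U (eliminate \<psi> e p \<kappa>)"
  have e: "e \<notin> U" using lf by (simp add: leaf_of_def)
  have "(if y e = 0 then Sum_any (\<lambda>t. ?F (y(e := t))) else 0) = ?F' y" for y
  proof (cases "\<forall>v. v \<notin> U \<longrightarrow> y v = 0")
    case True
    then have "y e = 0" using e by simp
    then show ?thesis
      using sum_state_sum_term_leaf[where y = y and R = R and \<omega> = \<omega> and \<psi> = \<psi> and \<kappa> = \<kappa> and e = e and p = p and U = U,
          OF lf True ec[of "y p"] \<psi> side] by simp
  next
    case False
    have "?F (y(e := t)) = 0" if "y e = 0" for t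
    proof -
      obtain v where "v \<notin> U" "y v \<noteq> 0" using False by blast
      moreover have "v \<noteq> e" using that \<open>y v \<noteq> 0\<close> by auto
      ultimately have "\<not> (\<forall>v. v \<notin> insert e U \<longrightarrow> (y(e := t)) v = 0)" by auto
      then show ?thesis unfolding state_sum_term_def by (rule if_not_P)
    qed
    then have "(if y e = 0 then Sum_any (\<lambda>t. ?F (y(e := t))) else 0) = 0" by simp
    moreover have "?F' y = 0" unfolding state_sum_term_def using False by (rule if_not_P)
    ultimately show ?thesis by simp
  qed
  then have eq: "(if y e = 0 then Sum_any (\<lambda>t. ?F (y(e := t))) else 0) = ?F' y" for y .
  then show "finite {y. ?F' y \<noteq> 0}" "Sum_any ?F = Sum_any ?F'"
    using Sum_any_fun_upd[OF fin, of e] by (simp_all only: eq)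
qed

end

section \<open>Quasi-polynomials on integer vectors\<close>

definition quasi_poly :: "(('v::finite \<Rightarrow> int) \<Rightarrow> real) \<Rightarrow> bool" where
  "quasi_poly p \<longleftrightarrow> (\<exists>N>0. \<forall>A. \<exists>P :: real^'v \<Rightarrow> real. real_polynomial_function P \<and>
      (\<forall>n. p (\<lambda>u. A u + N * n u) = P (\<chi> u. of_int (n u))))"

lemma real_polynomial_function_scaled:
  fixes P :: "real^'v::finite \<Rightarrow> real"
  assumes "real_polynomial_function P"
  shows "real_polynomial_function (\<lambda>x. P (c *\<^sub>R x))"
proof -
  have "polynomial_function (\<lambda>x::real^'v. c *\<^sub>R x)"
    by (rule polynomial_function_bounded_linear) (rule bounded_linear_scaleR_right)
  from real_polynomial_function_compose[OF this assms] show ?thesis by (simp add: o_def)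
qed

lemma quasi_poly_multiple:
  fixes p :: "('v::finite \<Rightarrow> int) \<Rightarrow> real" and P :: "real^'v \<Rightarrow> real"
  assumes "real_polynomial_function P" "\<And>n. p (\<lambda>u. A u + N * n u) = P (\<chi> u. of_int (n u))"
  shows "\<exists>P :: real^'v \<Rightarrow> real. real_polynomial_function P \<and>
      (\<forall>n. p (\<lambda>u. A u + (N * k) * n u) = P (\<chi> u. of_int (n u)))"
proof (intro exI conjI allI)
  show "real_polynomial_function (\<lambda>x. P (of_int k *\<^sub>R x))"
    by (rule real_polynomial_function_scaled) fact
  fix n
  have "p (\<lambda>u. A u + (N * k) * n u) = P (\<chi> u. of_int (k * n u))"
    using assms(2)[of "\<lambda>u. k * n u"] by (simp add: mult.assoc)
  also have "(\<chi> u. of_int (k * n u)) = of_int k *\<^sub>R ((\<chi> u. of_int (n u)) :: real^'v)"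
    by (simp add: vec_eq_iff)
  finally show "p (\<lambda>u. A u + (N * k) * n u) = P (of_int k *\<^sub>R (\<chi> u. of_int (n u)))" .
qed

lemma quasi_poly_add:
  fixes p q :: "('v::finite \<Rightarrow> int) \<Rightarrow> real"
  assumes "quasi_poly p" "quasi_poly q"
  shows "quasi_poly (\<lambda>A. p A + q A)"
proof -
  obtain N where N: "N > 0" "\<And>A. \<exists>P :: real^'v \<Rightarrow> real. real_polynomial_function P \<and>
      (\<forall>n. p (\<lambda>u. A u + N * n u) = P (\<chi> u. of_int (n u)))"
    using assms(1) unfolding quasi_poly_def by blast
  obtain M where M: "M > 0" "\<And>A. \<exists>P :: real^'v \<Rightarrow> real. real_polynomial_function P \<and>
      (\<forall>n. q (\<lambda>u. A u + M * n u) = P (\<chi> u. of_int (n u)))"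
    using assms(2) unfolding quasi_poly_def by blast
  show ?thesis
    unfolding quasi_poly_def
  proof (intro exI[of _ "N * M"] conjI allI)
    show "N * M > 0" using N M by simp
    fix A
    obtain P1 :: "real^'v \<Rightarrow> real" where P1: "real_polynomial_function P1"
        "\<forall>n. p (\<lambda>u. A u + (N * M) * n u) = P1 (\<chi> u. of_int (n u))"
      using N(2)[of A] quasi_poly_multiple[of _ p A N M] by blast
    obtain P2 :: "real^'v \<Rightarrow> real" where P2: "real_polynomial_function P2"
        "\<forall>n. q (\<lambda>u. A u + (M * N) * n u) = P2 (\<chi> u. of_int (n u))"
      using M(2)[of A] quasi_poly_multiple[of _ q A M N] by blast
    show "\<exists>P :: real^'v \<Rightarrow> real. real_polynomial_function P \<and>
      (\<forall>n. p (\<lambda>u. A u + (N * M) * n u) + q (\<lambda>u. A u + (N * M) * n u) = P (\<chi> u. of_int (n u)))"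
      using P1 P2 by (intro exI[of _ "\<lambda>x. P1 x + P2 x"])
        (auto simp: mult.commute[of N M] intro: real_polynomial_function.intros)
  qed
qed

lemma quasi_poly_scale:
  fixes p :: "('v::finite \<Rightarrow> int) \<Rightarrow> real"
  assumes "quasi_poly p"
  shows "quasi_poly (\<lambda>A. r * p A)"
proof -
  obtain N where N: "N > 0" "\<And>A. \<exists>P :: real^'v \<Rightarrow> real. real_polynomial_function P \<and>
      (\<forall>n. p (\<lambda>u. A u + N * n u) = P (\<chi> u. of_int (n u)))"
    using assms(1) unfolding quasi_poly_def by blast
  show ?thesis
    unfolding quasi_poly_def
  proof (intro exI[of _ N] conjI allI)
    fix A
    obtain P :: "real^'v \<Rightarrow> real" where "real_polynomial_function P"
      "\<forall>n. p (\<lambda>u. A u + N * n u) = P (\<chi> u. of_int (n u))" using N(2) by blast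
    then show "\<exists>P :: real^'v \<Rightarrow> real. real_polynomial_function P \<and>
      (\<forall>n. r * p (\<lambda>u. A u + N * n u) = P (\<chi> u. of_int (n u)))"
      by (intro exI[of _ "\<lambda>x. r * P x"]) (auto intro: real_polynomial_function.intros)
  qed (use N in auto)
qed

section \<open>Kernels that are periodic up to translation\<close>

type_synonym 'v family = "('v \<Rightarrow> int) \<Rightarrow> kernel"

text \<open>
  Periodicity up to translation in the argument and in the parameter \<open>A\<close>. The inequality
  compares the true slope \<open>B / N\<close> with the lower bound \<open>c\<close>; it keeps \<open>B\<close> positive when a leaf
  is eliminated.
\<close>

definition shift_kernel :: "real \<Rightarrow> ('v::finite) family \<Rightarrow> bool" where
  "shift_kernel c \<kappa> \<longleftrightarrow>
    (\<exists>N>0. \<exists>B s. c * of_int N \<le> of_int B \<and>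
      (\<forall>A t. \<kappa> A (t + N) = point B * \<kappa> A t) \<and>
      (\<forall>A n t. \<kappa> (\<lambda>u. A u + N * n u) t = point (\<Sum>u\<in>UNIV. n u * s u) * \<kappa> A t)) \<and>
    (\<forall>A t. mass (\<kappa> A t) = 1) \<and> (\<forall>A. \<exists>L M. M \<ge> 0 \<and> slope_bound c L M (\<kappa> A))"

lemma shift_kernelE:
  fixes \<kappa> :: "'v::finite family"
  assumes "shift_kernel c \<kappa>"
  obtains N B s where "N > 0" "c * of_int N \<le> of_int B"
    "\<And>A t. \<kappa> A (t + N) = point B * \<kappa> A t"
    "\<And>A n t. \<kappa> (\<lambda>u. A u + N * n u) t = point (\<Sum>u\<in>UNIV. n u * s u) * \<kappa> A t"
proof -
  have "\<exists>N>0. \<exists>B s. c * of_int N \<le> of_int B \<and>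
      (\<forall>A t. \<kappa> A (t + N) = point B * \<kappa> A t) \<and>
      (\<forall>A n t. \<kappa> (\<lambda>u. A u + N * n u) t = point (\<Sum>u\<in>UNIV. n u * s u) * \<kappa> A t)"
    using assms unfolding shift_kernel_def by (rule conjunct1)
  then show thesis by (elim exE conjE) (rule that, auto)
qed

lemma single_single_mult:
  "point a * (point b * \<mu>) = point (a + b) * \<mu>"
  by (simp add: mult.assoc[symmetric] mult_single)

lemma shift_iterate:
  fixes \<kappa> :: kernel and N :: int
  assumes "\<And>t. \<kappa> (t + N) = point B * \<kappa> t"
  shows "\<kappa> (t + N * j) = point (B * j) * \<kappa> t"
proof (induction j rule: int_induct[where k = 0])
  case base then show ?case by simp
next
  case (step1 i)
  have "\<kappa> (t + N * (i + 1)) = \<kappa> (t + N * i + N)" by (simp add: algebra_simps)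
  also have "\<dots> = point B * (point (B * i) * \<kappa> t)"
    by (simp add: assms step1)
  also have "\<dots> = point (B * (i + 1)) * \<kappa> t"
    by (simp add: single_single_mult distrib_left add.commute)
  finally show ?case .
next
  case (step2 i)
  have "point (B * i) * \<kappa> t = \<kappa> (t + N * (i - 1) + N)"
    using step2 by (simp add: algebra_simps)
  also have "\<dots> = point B * \<kappa> (t + N * (i - 1))" by (rule assms)
  finally have "point (- B) * (point (B * i) * \<kappa> t)
      = point (- B) * (point B * \<kappa> (t + N * (i - 1)))" by simp
  then show ?case
    by (simp add: single_single_mult right_diff_distrib)
qed

abbreviation free_weight :: "int \<Rightarrow> int \<Rightarrow> real" where
  "free_weight \<equiv> (\<lambda>t n. heaviside n)"

lemma admissible_free: "admissible 1 free_weight"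
  unfolding admissible_def by (intro exI[of _ 0]) (auto simp: heaviside_def)

text \<open>
  A translation of a leaf measure by \<open>Be\<close> has the same effect on the tail at \<open>\<eta> + Be\<close> as a
  translation of its argument by \<open>Ne\<close>. Hence pushing exchanges the period \<open>Ne\<close> and the
  translation \<open>Be\<close>, and the slope of the result is \<open>Bp / Np - Ne / Be\<close>.
\<close>

lemma shift_kernel_push:
  fixes \<kappa>e \<kappa>p :: "'v::finite family"
  assumes e: "shift_kernel ce \<kappa>e" and p: "shift_kernel cp \<kappa>p" and ce: "ce > 0"
  shows "shift_kernel (cp - 1 / ce) (\<lambda>A \<eta>. \<kappa>p A \<eta> * push free_weight (\<kappa>e A) \<eta>)"
proof -
  obtain Ne Be se where Ne: "Ne > 0" "ce * of_int Ne \<le> of_int Be"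
      and e1': "\<forall>A t. \<kappa>e A (t + Ne) = point Be * \<kappa>e A t"
      and e2': "\<forall>A n t. \<kappa>e (\<lambda>u. A u + Ne * n u) t = point (\<Sum>u\<in>UNIV. n u * se u) * \<kappa>e A t"
    using e by (rule shift_kernelE) blast
  note e1 = e1'[rule_format] and e2 = e2'[rule_format]
  obtain Np Bp sp where Np: "Np > 0" "cp * of_int Np \<le> of_int Bp"
      and p1': "\<forall>A t. \<kappa>p A (t + Np) = point Bp * \<kappa>p A t"
      and p2': "\<forall>A n t. \<kappa>p (\<lambda>u. A u + Np * n u) t = point (\<Sum>u\<in>UNIV. n u * sp u) * \<kappa>p A t"
    using p by (rule shift_kernelE) blast
  note p1 = p1'[rule_format] and p2 = p2'[rule_format]
  have me: "\<And>A t. mass (\<kappa>e A t) = 1" and mp: "\<And>A t. mass (\<kappa>p A t) = 1"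
    using e p by (auto simp: shift_kernel_def)
  have be: "\<And>A. \<exists>L M. M \<ge> 0 \<and> slope_bound ce L M (\<kappa>e A)"
    and bp: "\<And>A. \<exists>L M. M \<ge> 0 \<and> slope_bound cp L M (\<kappa>p A)"
    using e p by (auto simp: shift_kernel_def)
  have "ce * of_int Ne > 0" using ce Ne by simp
  then have Be: "Be > 0" using Ne by linarith
  have bk: "\<exists>L M. M \<ge> 0 \<and> bounded_kernel ce L M 1 (\<kappa>e A)" for A
    using be[of A] me ce by (auto simp: bounded_kernel_def)
  have ec: "\<exists>b. eventually_const (profile free_weight (\<kappa>e A) \<eta>) b (b + 1)" for A \<eta>
    using bk[of A] bounded_kernel.profile_eventually_const[OF _ admissible_free] by fastforce
  have prof: "profile free_weight (\<kappa>e A) (\<eta> + Be * j) t = profile free_weight (\<kappa>e A) \<eta> (t + - (Ne * j))"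
    for A \<eta> j t
  proof -
    have "\<kappa>e A t = point (Be * j) * \<kappa>e A (t - Ne * j)"
      using shift_iterate[of "\<kappa>e A", OF e1, of "t - Ne * j" j] by simp
    then show ?thesis
      by (simp add: profile_def integ_shift algebra_simps)
  qed
  have push1: "push free_weight (\<kappa>e A) (\<eta> + Be * j)
      = point (- (Ne * j)) * push free_weight (\<kappa>e A) \<eta>" for A \<eta> j
  proof -
    have "push free_weight (\<kappa>e A) (\<eta> + Be * j)
        = jumps (\<lambda>t. profile free_weight (\<kappa>e A) \<eta> (t + - (Ne * j)))"
      unfolding push_def by (intro jumps_eqI) (simp only: prof)
    then show ?thesis using ec[of A \<eta>] jumps_shift by (metis push_def)
  qed
  have push2: "push free_weight (\<kappa>e (\<lambda>u. A u + Ne * (Be * n u))) \<eta>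
      = point (Ne * (\<Sum>u\<in>UNIV. n u * se u)) * push free_weight (\<kappa>e A) \<eta>" for A n \<eta>
  proof -
    let ?S = "\<Sum>u\<in>UNIV. n u * se u"
    have S: "(\<Sum>u\<in>UNIV. Be * n u * se u) = Be * ?S" by (simp add: sum_distrib_left mult.assoc)
    have "push free_weight (\<kappa>e (\<lambda>u. A u + Ne * (Be * n u))) \<eta> = push free_weight (\<kappa>e A) (\<eta> + Be * (- ?S))"
    proof -
      have "profile free_weight (\<kappa>e (\<lambda>u. A u + Ne * (Be * n u))) \<eta> t
          = profile free_weight (\<kappa>e A) (\<eta> + Be * (- ?S)) t" for t
        unfolding profile_def e2[of A "\<lambda>u. Be * n u"] S integ_shift
        by (intro integ_cong) (simp add: algebra_simps)
      then show ?thesis unfolding push_def by (intro jumps_eqI) simp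
    qed
    then show ?thesis by (simp only: push1) simp
  qed
  show ?thesis
    unfolding shift_kernel_def
  proof (intro conjI allI)
    show "\<exists>N>0. \<exists>B s. (cp - 1 / ce) * of_int N \<le> of_int B \<and>
      (\<forall>A t. \<kappa>p A (t + N) * push free_weight (\<kappa>e A) (t + N)
          = point B * (\<kappa>p A t * push free_weight (\<kappa>e A) t)) \<and>
      (\<forall>A n t. \<kappa>p (\<lambda>u. A u + N * n u) t * push free_weight (\<kappa>e (\<lambda>u. A u + N * n u)) t
          = point (\<Sum>u\<in>UNIV. n u * s u) * (\<kappa>p A t * push free_weight (\<kappa>e A) t))"
    proof -
      have pos: "Np * Ne * Be > 0" using Ne Np Be by simp
      have "of_int Ne \<le> of_int Be / ce" using Ne(2) ce by (simp add: field_simps)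
      then have "of_int (Np * Ne) * real_of_int Ne \<le> of_int (Np * Ne) * (of_int Be / ce)"
        using Ne Np by (intro mult_left_mono) auto
      moreover have "of_int (Ne * Be) * (cp * of_int Np) \<le> of_int (Ne * Be) * real_of_int Bp"
        using Np Ne Be by (intro mult_left_mono) auto
      ultimately have slope: "(cp - 1 / ce) * of_int (Np * Ne * Be) \<le> of_int (Ne * Be * Bp - Np * Ne * Ne)"
        by (simp add: algebra_simps)
      have shift_t: "\<kappa>p A (t + Np * Ne * Be) * push free_weight (\<kappa>e A) (t + Np * Ne * Be)
          = point (Ne * Be * Bp - Np * Ne * Ne) * (\<kappa>p A t * push free_weight (\<kappa>e A) t)" for A t
      proof -
      have "\<kappa>p A (t + Np * Ne * Be) = point (Bp * (Ne * Be)) * \<kappa>p A t"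
        using shift_iterate[of "\<kappa>p A", OF p1, of t "Ne * Be"] by (simp add: mult.assoc)
      moreover have "push free_weight (\<kappa>e A) (t + Np * Ne * Be)
          = point (- (Ne * (Np * Ne))) * push free_weight (\<kappa>e A) t"
        using push1[of A t "Np * Ne"] by (simp add: mult_ac)
      ultimately have "\<kappa>p A (t + Np * Ne * Be) * push free_weight (\<kappa>e A) (t + Np * Ne * Be)
          = (point (Bp * (Ne * Be)) * point (- (Ne * (Np * Ne))))
            * (\<kappa>p A t * push free_weight (\<kappa>e A) t)"
        by (simp only: mult_ac)
      then show ?thesis
        by (simp add: mult_single algebra_simps)
      qed
      have shift_A: "\<kappa>p (\<lambda>u. A u + Np * Ne * Be * n u) t
            * push free_weight (\<kappa>e (\<lambda>u. A u + Np * Ne * Be * n u)) t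
          = point (\<Sum>u\<in>UNIV. n u * (Ne * Be * sp u + Np * Ne * se u))
            * (\<kappa>p A t * push free_weight (\<kappa>e A) t)" for A :: "'v \<Rightarrow> int" and n t
      proof -
      let ?Sp = "\<Sum>u\<in>UNIV. n u * sp u" and ?Se = "\<Sum>u\<in>UNIV. n u * se u"
      have S: "(\<Sum>u\<in>UNIV. Ne * Be * n u * sp u) = Ne * Be * ?Sp"
          "(\<Sum>u\<in>UNIV. Np * n u * se u) = Np * ?Se"
        by (simp_all add: sum_distrib_left mult.assoc)
      have eq: "(\<lambda>u. A u + Np * Ne * Be * n u) = (\<lambda>u. A u + Np * (Ne * Be * n u))"
          "(\<lambda>u. A u + Np * Ne * Be * n u) = (\<lambda>u. A u + Ne * (Be * (Np * n u)))"
        by (simp_all add: mult_ac)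
      have "\<kappa>p (\<lambda>u. A u + Np * Ne * Be * n u) t = point (Ne * Be * ?Sp) * \<kappa>p A t"
        by (subst eq(1), subst p2, simp only: S)
      moreover have "push free_weight (\<kappa>e (\<lambda>u. A u + Np * Ne * Be * n u)) t
          = point (Ne * (Np * ?Se)) * push free_weight (\<kappa>e A) t"
        by (subst eq(2), subst push2, simp only: S)
      ultimately have "\<kappa>p (\<lambda>u. A u + Np * Ne * Be * n u) t
            * push free_weight (\<kappa>e (\<lambda>u. A u + Np * Ne * Be * n u)) t
          = (point (Ne * Be * ?Sp) * point (Ne * (Np * ?Se)))
            * (\<kappa>p A t * push free_weight (\<kappa>e A) t)"
        by (simp only: mult_ac)
      moreover have "Ne * Be * ?Sp + Ne * (Np * ?Se)
          = (\<Sum>u\<in>UNIV. n u * (Ne * Be * sp u + Np * Ne * se u))"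
        by (simp add: sum_distrib_left sum.distrib algebra_simps)
      ultimately show ?thesis
        by (simp add: mult_single)
      qed
      show ?thesis
        by (rule exI[of _ "Np * Ne * Be"], rule conjI, rule pos,
            rule exI[of _ "Ne * Be * Bp - Np * Ne * Ne"],
            rule exI[of _ "\<lambda>u. Ne * Be * sp u + Np * Ne * se u"],
            intro conjI allI, rule slope, rule shift_t, rule shift_A)
    qed
  next
    fix A :: "'v \<Rightarrow> int" and t
    obtain L M where bk': "bounded_kernel ce L M 1 (\<kappa>e A)" using bk by blast
    show "mass (\<kappa>p A t * push free_weight (\<kappa>e A) t) = 1"
      using bounded_kernel.mass_push[OF bk' admissible_free] by (simp add: integ_mult mp)
  next
    fix A :: "'v \<Rightarrow> int"
    obtain L M where bk': "M \<ge> 0" "bounded_kernel ce L M 1 (\<kappa>e A)" using bk by blast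
    obtain Lp Mp where bp': "Mp \<ge> 0" "slope_bound cp Lp Mp (\<kappa>p A)" using bp by blast
    show "\<exists>L M. 0 \<le> M \<and> slope_bound (cp - 1 / ce) L M (\<lambda>\<eta>. \<kappa>p A \<eta> * push free_weight (\<kappa>e A) \<eta>)"
      using bounded_kernel.slope_bound_push[OF bk'(2) admissible_free bk'(1) bp'(2)] bk'(1) bp'(1) ce
      by (intro exI[of _ "Lp + max 0 (1 + L / ce)"] exI[of _ "Mp + M / ce"]) auto
  qed
qed

text \<open>
  The regularized measures are signed combinations of shift kernels of different slopes, since
  removing a cut-off vertex changes the graph that the other terms see. Only
  the common lower bound \<open>c\<close> of the slopes is recorded.
\<close>

inductive kernel_span :: "real \<Rightarrow> ('v::finite) family \<Rightarrow> bool" for c where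
  base: "shift_kernel c \<kappa> \<Longrightarrow> kernel_span c \<kappa>"
| add: "kernel_span c \<kappa> \<Longrightarrow> kernel_span c \<mu> \<Longrightarrow> kernel_span c (\<lambda>A t. \<kappa> A t + \<mu> A t)"
| scale: "kernel_span c \<kappa> \<Longrightarrow> kernel_span c (\<lambda>A t. Poly_Mapping.single 0 r * \<kappa> A t)"

lemma slope_bound_add:
  assumes "slope_bound c L M \<kappa>" "slope_bound c L' M' \<mu>"
  shows "slope_bound c (max L L') (max M M') (\<lambda>t. \<kappa> t + \<mu> t)"
proof -
  have k: "a \<in> supp (\<kappa> t + \<mu> t) \<Longrightarrow> a \<in> supp (\<kappa> t) \<or> a \<in> supp (\<mu> t)"
    for a t using keys_add[of "\<kappa> t" "\<mu> t"] by blast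
  show ?thesis
    using assms unfolding slope_bound_def by (auto dest!: k) fastforce+
qed

lemma keys_scale: "supp (Poly_Mapping.single (0::int) (r::real) * \<mu>) \<subseteq> supp \<mu>"
proof
  fix a assume "a \<in> supp (Poly_Mapping.single 0 r * \<mu>)"
  then obtain s b where "a = s + b" "s \<in> supp (Poly_Mapping.single (0::int) r)"
      "b \<in> supp \<mu>"
    using keys_mult[of "Poly_Mapping.single 0 r" \<mu>] by blast
  then show "a \<in> supp \<mu>" by (auto split: if_splits)
qed

lemma slope_bound_scale:
  assumes "slope_bound c L M \<kappa>"
  shows "slope_bound c L M (\<lambda>t. Poly_Mapping.single 0 r * \<kappa> t)"
  using assms keys_scale[of r] unfolding slope_bound_def by blast

lemma kernel_span_bounds:
  assumes "kernel_span c \<kappa>"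
  shows "(\<exists>m. \<forall>A t. mass (\<kappa> A t) = m) \<and> (\<forall>A. \<exists>L M. M \<ge> 0 \<and> slope_bound c L M (\<kappa> A))"
  using assms
proof induction
  case (base \<kappa>)
  then show ?case by (auto simp: shift_kernel_def)
next
  case (add \<kappa> \<mu>)
  have "\<exists>L M. M \<ge> 0 \<and> slope_bound c L M (\<lambda>t. \<kappa> A t + \<mu> A t)" for A
  proof -
    obtain L M where "M \<ge> 0" "slope_bound c L M (\<kappa> A)" using add.IH(1) by blast
    moreover obtain L' M' where "M' \<ge> 0" "slope_bound c L' M' (\<mu> A)" using add.IH(2) by blast
    ultimately show ?thesis using slope_bound_add[of c L M "\<kappa> A" L' M' "\<mu> A"]
      by (meson max.coboundedI1)
  qed
  moreover have "\<exists>m. \<forall>A t. mass (\<kappa> A t + \<mu> A t) = m"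
    using add.IH by (auto simp: integ_add)
  ultimately show ?case by blast
next
  case (scale \<kappa> r)
  then show ?case using slope_bound_scale by (simp add: integ_mult integ_const[of _ r]) (metis integ_scale_fun)
qed

lemma kernel_span_bounded:
  assumes "kernel_span c \<kappa>" "c > 0"
  shows "\<exists>m. \<forall>A. \<exists>L M. M \<ge> 0 \<and> bounded_kernel c L M m (\<kappa> A)"
  using kernel_span_bounds[OF assms(1)] assms(2) unfolding bounded_kernel_def by blast

lemma shift_kernel_mono:
  fixes \<kappa> :: "'v::finite family"
  assumes k: "shift_kernel c \<kappa>" and c': "c' \<le> c"
  shows "shift_kernel c' \<kappa>"
proof -
  obtain N B s where N: "N > 0" "c * of_int N \<le> of_int B"
      and k1: "\<forall>A t. \<kappa> A (t + N) = point B * \<kappa> A t"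
      and k2: "\<forall>A n t. \<kappa> (\<lambda>u. A u + N * n u) t = point (\<Sum>u\<in>UNIV. n u * s u) * \<kappa> A t"
    using k by (rule shift_kernelE) blast
  have "c' * of_int N \<le> c * of_int N" using c' N(1) by (intro mult_right_mono) auto
  then have "c' * of_int N \<le> of_int B" using N(2) by linarith
  moreover have "\<forall>A. \<exists>L M. M \<ge> 0 \<and> slope_bound c' L M (\<kappa> A)"
    using k slope_bound_weaken[OF _ c' order_refl order_refl] unfolding shift_kernel_def by blast
  moreover have "\<forall>A t. mass (\<kappa> A t) = 1" using k by (simp add: shift_kernel_def)
  ultimately show ?thesis unfolding shift_kernel_def using N(1) k1 k2 by blast
qed

lemma kernel_span_mono: "kernel_span c \<kappa> \<Longrightarrow> c' \<le> c \<Longrightarrow> kernel_span c' \<kappa>"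
  by (induction rule: kernel_span.induct) (auto intro: kernel_span.intros shift_kernel_mono)

lemma kernel_span_push_free:
  fixes \<kappa>e \<kappa>p :: "'v::finite family"
  assumes e: "kernel_span ce \<kappa>e" and p: "kernel_span cp \<kappa>p" and ce: "ce > 0"
  shows "kernel_span (cp - 1 / ce) (\<lambda>A \<eta>. \<kappa>p A \<eta> * push free_weight (\<kappa>e A) \<eta>)"
  using e
proof induction
  case (base \<kappa>e)
  show ?case using p
  proof induction
    case (base \<kappa>)
    show ?case by (rule kernel_span.base) (rule shift_kernel_push[OF \<open>shift_kernel ce \<kappa>e\<close> base ce])
  next
    case (add \<kappa> \<mu>)
    then show ?case using kernel_span.add[OF add.IH] by (simp add: distrib_right)
  next
    case (scale \<kappa> r)
    then show ?case using kernel_span.scale[OF scale.IH, of r] by (simp add: mult.assoc)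
  qed
next
  case (add \<kappa> \<mu>)
  have "push free_weight (\<lambda>t. \<kappa> A t + \<mu> A t) \<eta> = push free_weight (\<kappa> A) \<eta> + push free_weight (\<mu> A) \<eta>" for A \<eta>
  proof -
    obtain L M m where 1: "bounded_kernel ce L M m (\<kappa> A)" using kernel_span_bounded[OF add.hyps(1) ce] by blast
    obtain L' M' m' where 2: "bounded_kernel ce L' M' m' (\<mu> A)" using kernel_span_bounded[OF add.hyps(2) ce] by blast
    have "profile free_weight (\<lambda>t. \<kappa> A t + \<mu> A t) \<eta>
        = (\<lambda>t. profile free_weight (\<kappa> A) \<eta> t + profile free_weight (\<mu> A) \<eta> t)"
      by (simp add: profile_def integ_add fun_eq_iff)
    then show ?thesis
      using bounded_kernel.profile_eventually_const[OF 1 admissible_free, of \<eta>]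
        bounded_kernel.profile_eventually_const[OF 2 admissible_free, of \<eta>]
      unfolding push_def by (auto intro!: jumps_add)
  qed
  then show ?case using kernel_span.add[OF add.IH] by (simp add: distrib_left)
next
  case (scale \<kappa> r)
  have "push free_weight (\<lambda>t. Poly_Mapping.single 0 r * \<kappa> A t) \<eta>
      = Poly_Mapping.single 0 r * push free_weight (\<kappa> A) \<eta>" for A \<eta>
  proof -
    obtain L M m where 1: "bounded_kernel ce L M m (\<kappa> A)" using kernel_span_bounded[OF scale.hyps(1) ce] by blast
    have "profile free_weight (\<lambda>t. Poly_Mapping.single 0 r * \<kappa> A t) \<eta>
        = (\<lambda>t. r * profile free_weight (\<kappa> A) \<eta> t)"
      by (simp add: profile_def integ_mult fun_eq_iff)
    then show ?thesis
      using bounded_kernel.profile_eventually_const[OF 1 admissible_free, of \<eta>]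
      unfolding push_def by (auto intro: jumps_scale)
  qed
  then show ?case using kernel_span.scale[OF scale.IH, of r] by (simp add: mult_ac)
qed

text \<open>
  At a vertex of \<open>I\<close> the step at \<open>t = 0\<close> subtracts the total mass, placed at the
  cut-off, from the free jump measure, without truncating the latter.
\<close>

definition reg_weight :: "bool \<Rightarrow> int \<Rightarrow> int \<Rightarrow> real" where
  "reg_weight b t n = heaviside n - (if b \<and> t \<ge> 0 then 1 else 0)"

lemma kernel_span_push_reg:
  fixes \<kappa>e \<kappa>p :: "'v::finite family"
  assumes e: "kernel_span ce \<kappa>e" and p: "kernel_span cp \<kappa>p" and ce: "ce > 0"
  shows "kernel_span (cp - 1 / ce) (\<lambda>A \<eta>. \<kappa>p A \<eta> * push (reg_weight b) (\<kappa>e A) \<eta>)"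
proof -
  obtain m where m: "\<And>A. \<exists>L M. M \<ge> 0 \<and> bounded_kernel ce L M m (\<kappa>e A)"
    using kernel_span_bounded[OF e ce] by blast
  define m' where "m' = (if b then m else 0)"
  have "push (reg_weight b) (\<kappa>e A) \<eta> = push free_weight (\<kappa>e A) \<eta> + Poly_Mapping.single 0 (- m')" for A \<eta>
  proof -
    obtain L M where 1: "bounded_kernel ce L M m (\<kappa>e A)" using m by blast
    have "profile (reg_weight b) (\<kappa>e A) \<eta> t
        = profile free_weight (\<kappa>e A) \<eta> t + (if t \<ge> 0 then - m' else 0)" for t
      using bounded_kernel.mass_const[OF 1]
      by (simp add: profile_def reg_weight_def integ_diff_fun m'_def integ_const[of _ 0])
    moreover have "eventually_const (\<lambda>t. if t \<ge> 0 then - m' else 0) 0 (- m')"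
      unfolding eventually_const_def by (intro exI[of _ 1]) auto
    moreover have "\<exists>b. eventually_const (profile free_weight (\<kappa>e A) \<eta>) (b * m) ((b + 1) * m)"
      by (rule bounded_kernel.profile_eventually_const[OF 1 admissible_free])
    ultimately show ?thesis
      unfolding push_def jumps_step[symmetric]
      by (elim exE) (subst jumps_add[symmetric], assumption+, rule jumps_eqI, simp)
  qed
  moreover have "kernel_span (cp - 1 / ce) (\<lambda>A \<eta>. Poly_Mapping.single 0 (- m') * \<kappa>p A \<eta>)"
    by (rule kernel_span.scale, rule kernel_span_mono[OF p]) (use ce in auto)
  ultimately show ?thesis
    using kernel_span.add[OF kernel_span_push_free[OF e p ce]] by (simp add: distrib_left mult.commute)
qed

section \<open>The regularized sum at the root\<close>

text \<open>
  Arguments below the cut-off use the expansion at zero, the others the expansion at infinity.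
  Each expansion vanishes far out on its own side, so the sum is finite although
  neither expansion alone would give a finite sum.
\<close>

definition cut_sum :: "kernel \<Rightarrow> int \<Rightarrow> real" where
  "cut_sum \<kappa> k = Sum_any (\<lambda>t. integ (\<kappa> t) (if t < k then inv_sq_zero else inv_sq_infinity))"

lemma cut_sum_finite:
  assumes "slope_bound c L M \<kappa>" "c > 0"
  shows "finite {t. integ (\<kappa> t) (if t < k then inv_sq_zero else inv_sq_infinity) \<noteq> 0}"
proof -
  define T where "T = max (max 0 k) \<lceil>L / c\<rceil>"
  define T' where "T' = min (min 0 k) (- \<lceil>(M + 1) / c\<rceil>)"
  have hi: "integ (\<kappa> t) (if t < k then inv_sq_zero else inv_sq_infinity) = 0" if "t \<ge> T" for t
  proof -
    have t: "t \<ge> 0" "\<not> t < k" "\<lceil>L / c\<rceil> \<le> t" using that by (auto simp: T_def)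
    have "L / c \<le> of_int t" using t(3) by linarith
    then have "L \<le> c * of_int t" using assms(2) by (simp add: field_simps)
    then have "inv_sq_infinity a = 0" if "a \<in> supp (\<kappa> t)" for a
    proof -
      have "c * of_int t - L \<le> of_int a" using assms(1) t(1) that by (auto simp: slope_bound_def)
      then show ?thesis using \<open>L \<le> c * of_int t\<close> by (simp add: inv_sq_infinity_def)
    qed
    then show ?thesis using t(2) by (simp add: integ_def)
  qed
  have lo: "integ (\<kappa> t) (if t < k then inv_sq_zero else inv_sq_infinity) = 0" if "t < T'" for t
  proof -
    have t: "t \<le> 0" "t < k" "t \<le> - \<lceil>(M + 1) / c\<rceil>" using that by (auto simp: T'_def)
    have "of_int t \<le> - ((M + 1) / c)" using t(3) by linarith
    then have "c * of_int t + M \<le> - 1" using assms(2) by (simp add: field_simps)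
    then have "inv_sq_zero a = 0" if "a \<in> supp (\<kappa> t)" for a
    proof -
      have "of_int a \<le> c * of_int t + M" using assms(1) t(1) that by (auto simp: slope_bound_def)
      then show ?thesis using \<open>c * of_int t + M \<le> - 1\<close> by (simp add: inv_sq_zero_def)
    qed
    then show ?thesis using t(2) by (simp add: integ_def)
  qed
  have "{t. integ (\<kappa> t) (if t < k then inv_sq_zero else inv_sq_infinity) \<noteq> 0} \<subseteq> {T'..T}"
  proof
    fix t assume t: "t \<in> {t. integ (\<kappa> t) (if t < k then inv_sq_zero else inv_sq_infinity) \<noteq> 0}"
    have "\<not> t \<ge> T" "\<not> t < T'" using hi[of t] lo[of t] t by auto
    then show "t \<in> {T'..T}" by simp
  qed
  then show ?thesis by (rule finite_subset) simp
qed

text \<open>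
  Moving the cut-off by one exchanges the two expansions at one argument, and these differ by
  \<open>a + 1\<close>.
\<close>

lemma cut_sum_step:
  assumes "slope_bound c L M \<kappa>" "c > 0"
  shows "cut_sum \<kappa> (k + 1) - cut_sum \<kappa> k = integ (\<kappa> k) (\<lambda>a. of_int a + 1)"
proof -
  let ?f = "\<lambda>k t. integ (\<kappa> t) (if t < k then inv_sq_zero else inv_sq_infinity)"
  have "inv_sq_zero = (\<lambda>a. inv_sq_infinity a + (of_int a + 1))"
    by (rule ext) (simp add: inv_sq_zero_def inv_sq_infinity_def max_def)
  then have "integ (\<kappa> k) inv_sq_zero = integ (\<kappa> k) inv_sq_infinity + integ (\<kappa> k) (\<lambda>a. of_int a + 1)"
    using integ_add_fun[of "\<kappa> k" inv_sq_infinity "\<lambda>a. of_int a + 1"] by (simp only:)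
  then have "?f (k + 1) t = ?f k t + (if t = k then integ (\<kappa> t) (\<lambda>a. of_int a + 1) else 0)" for t
    by auto
  then have "cut_sum \<kappa> (k + 1)
      = Sum_any (\<lambda>t. ?f k t + (if t = k then integ (\<kappa> t) (\<lambda>a. of_int a + 1) else 0))"
    unfolding cut_sum_def by simp
  also have "\<dots> = cut_sum \<kappa> k + Sum_any (\<lambda>t. if t = k then integ (\<kappa> t) (\<lambda>a. of_int a + 1) else 0)"
    unfolding cut_sum_def
    by (intro Sum_any.distrib cut_sum_finite[OF assms])
       (rule finite_subset[of _ "{k}"], auto)
  finally show ?thesis by simp
qed

lemma cut_sum_steps:
  assumes "slope_bound c L M \<kappa>" "c > 0"
  shows "cut_sum \<kappa> (k + int n) - cut_sum \<kappa> k = (\<Sum>i<n. integ (\<kappa> (k + int i)) (\<lambda>a. of_int a + 1))"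
proof (induction n)
  case (Suc n)
  then show ?case using cut_sum_step[OF assms, of "k + int n"] by (simp add: algebra_simps)
qed simp

lemma quadratic_of_affine_difference:
  fixes f :: "int \<Rightarrow> real"
  assumes "\<And>j. f (j + 1) - f j = a + b * of_int j"
  shows "f j = f 0 + a * of_int j + b * (of_int j * (of_int j - 1) / 2)"
proof (induction j rule: int_induct[where k = 0])
  case (step1 i)
  then show ?case using assms[of i] by (simp add: field_simps)
next
  case (step2 i)
  then show ?case using assms[of "i - 1"] by (simp add: field_simps)
qed simp

lemma affine_of_const_difference:
  fixes f :: "int \<Rightarrow> real"
  assumes "\<And>j. f (j + 1) - f j = b"
  shows "f j = f 0 + b * of_int j"
proof (induction j rule: int_induct[where k = 0])
  case (step1 i)
  then show ?case using assms[of i] by (simp add: field_simps)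
next
  case (step2 i)
  then show ?case using assms[of "i - 1"] by (simp add: field_simps)
qed simp

lemma real_polynomial_function_linear_form:
  "real_polynomial_function (\<lambda>x :: real^'v::finite. \<Sum>u\<in>UNIV. x $ u * s u)"
  by (rule real_polynomial_function.intros(1))
     (intro bounded_linear_sum bounded_linear_mult_left[THEN bounded_linear_compose] bounded_linear_vec_nth)

text \<open>
  Changing \<open>A\<close> along a multiple of the period translates the kernel by a linear form \<open>j\<close>, which
  amounts to moving the cut-off by \<open>N j\<close>. The increments of the cut sum are affine in \<open>j\<close>.
\<close>

lemma quasi_poly_root_sum_shift:
  fixes \<kappa> :: "'v::finite family"
  assumes k: "shift_kernel c \<kappa>" and c: "c > 0"
  shows "quasi_poly (\<lambda>A. cut_sum (\<kappa> A) 0)"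
proof -
  obtain N B s where N: "N > 0" "c * of_int N \<le> of_int B"
      and k1': "\<forall>A t. \<kappa> A (t + N) = point B * \<kappa> A t"
      and k2': "\<forall>A n t. \<kappa> (\<lambda>u. A u + N * n u) t = point (\<Sum>u\<in>UNIV. n u * s u) * \<kappa> A t"
    using k by (rule shift_kernelE) blast
  note k1 = k1'[rule_format] and k2 = k2'[rule_format]
  have mk: "\<And>A t. mass (\<kappa> A t) = 1" using k by (auto simp: shift_kernel_def)
  have "c * of_int N > 0" using c N by simp
  then have B: "B > 0" using N by linarith
  show ?thesis
    unfolding quasi_poly_def
  proof (intro exI[of _ "N * B"] conjI allI)
    show "N * B > 0" using N B by simp
    fix A :: "'v \<Rightarrow> int"
    obtain L M where LM: "slope_bound c L M (\<kappa> A)" using k unfolding shift_kernel_def by blast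
    define f where "f j = cut_sum (\<kappa> A) (N * j)" for j
    define V where "V j = f (j + 1) - f j" for j
    have V: "V j = (\<Sum>i<nat N. integ (\<kappa> A (N * j + int i)) (\<lambda>a. of_int a + 1))" for j
      using cut_sum_steps[OF LM c, of "N * j" "nat N"] N by (simp add: V_def f_def algebra_simps)
    have "V (j + 1) - V j = of_int (N * B)" for j
    proof -
      have "integ (\<kappa> A (N * (j + 1) + int i)) (\<lambda>a. of_int a + 1)
          = integ (\<kappa> A (N * j + int i)) (\<lambda>a. of_int a + 1) + of_int B" for i
      proof -
        have "\<kappa> A (N * (j + 1) + int i) = point B * \<kappa> A (N * j + int i)"
          using k1[of A "N * j + int i"] by (simp add: algebra_simps)
        then have "integ (\<kappa> A (N * (j + 1) + int i)) (\<lambda>a. of_int a + 1)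
            = integ (\<kappa> A (N * j + int i)) (\<lambda>a. of_int (B + a) + 1)"
          by (simp only: integ_shift)
        also have "\<dots> = integ (\<kappa> A (N * j + int i)) (\<lambda>a. (of_int a + 1) + of_int B)"
          by (intro integ_cong) simp
        also have "\<dots> = integ (\<kappa> A (N * j + int i)) (\<lambda>a. of_int a + 1) + of_int B"
          by (subst integ_add_fun) (simp add: integ_const[of _ "of_int B"] mk)
        finally show ?thesis .
      qed
      then show ?thesis using N by (simp add: V sum.distrib)
    qed
    then have "V j = V 0 + of_int (N * B) * of_int j" for j by (rule affine_of_const_difference)
    then have "f (j + 1) - f j = V 0 + of_int (N * B) * of_int j" for j by (simp add: V_def)
    then have f: "f j = f 0 + V 0 * of_int j + of_int (N * B) * (of_int j * (of_int j - 1) / 2)" for j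
      by (rule quadratic_of_affine_difference)
    have eq: "cut_sum (\<kappa> (\<lambda>u. A u + N * B * n u)) 0 = f (\<Sum>u\<in>UNIV. n u * s u)" for n
    proof -
      let ?j = "\<Sum>u\<in>UNIV. n u * s u"
      have S: "(\<Sum>u\<in>UNIV. B * n u * s u) = B * ?j" by (simp add: sum_distrib_left mult.assoc)
      have "\<kappa> (\<lambda>u. A u + N * B * n u) t = \<kappa> A (t + N * ?j)" for t
        using k2[of A "\<lambda>u. B * n u" t, unfolded S] shift_iterate[of "\<kappa> A", OF k1, of t ?j] by (simp add: mult.assoc)
      then have "cut_sum (\<kappa> (\<lambda>u. A u + N * B * n u)) 0
          = Sum_any (\<lambda>t. integ (\<kappa> A (t + N * ?j)) (if t < 0 then inv_sq_zero else inv_sq_infinity))"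
        by (simp add: cut_sum_def)
      also have "\<dots> = f ?j"
        unfolding f_def cut_sum_def
        by (rule Sum_any.reindex_cong[of "\<lambda>t. t - N * ?j"])
           (auto simp: bij_def inj_def surj_def fun_eq_iff intro: exI[of _ "_ + N * ?j"])
      finally show ?thesis .
    qed
    let ?l = "\<lambda>x :: real^'v. \<Sum>u\<in>UNIV. x $ u * of_int (s u)"
    have "real_polynomial_function (\<lambda>x. f 0 + V 0 * ?l x + of_int (N * B) * (?l x * (?l x - 1) / 2))"
      by (intro real_polynomial_function.intros(2-) real_polynomial_function_diff
          real_polynomial_function_divide real_polynomial_function_linear_form)
    then show "\<exists>P :: real^'v \<Rightarrow> real. real_polynomial_function P \<and>
        (\<forall>n. cut_sum (\<kappa> (\<lambda>u. A u + N * B * n u)) 0 = P (\<chi> u. of_int (n u)))"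
      by (intro exI conjI allI, assumption) (subst eq, subst f, simp)
  qed
qed

lemma quasi_poly_root_sum:
  fixes \<kappa> :: "'v::finite family"
  assumes "kernel_span c \<kappa>" and c: "c > 0"
  shows "quasi_poly (\<lambda>A. cut_sum (\<kappa> A) 0)"
  using assms(1)
proof induction
  case (base \<kappa>)
  then show ?case using quasi_poly_root_sum_shift c by blast
next
  case (add \<kappa> \<mu>)
  have "cut_sum (\<lambda>t. \<kappa> A t + \<mu> A t) 0 = cut_sum (\<kappa> A) 0 + cut_sum (\<mu> A) 0" for A
  proof -
    obtain L M where 1: "slope_bound c L M (\<kappa> A)" using kernel_span_bounds[OF add.hyps(1)] by blast
    obtain L' M' where 2: "slope_bound c L' M' (\<mu> A)" using kernel_span_bounds[OF add.hyps(2)] by blast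
    show ?thesis
      unfolding cut_sum_def integ_add
      by (intro Sum_any.distrib cut_sum_finite[OF 1 c] cut_sum_finite[OF 2 c])
  qed
  then show ?case using quasi_poly_add[OF add.IH] by simp
next
  case (scale \<kappa> r)
  have "cut_sum (\<lambda>t. Poly_Mapping.single 0 r * \<kappa> A t) 0 = r * cut_sum (\<kappa> A) 0" for A
  proof -
    obtain L M where 1: "slope_bound c L M (\<kappa> A)" using kernel_span_bounds[OF scale.hyps(1)] by blast
    show ?thesis
      unfolding cut_sum_def
      by (subst Sum_any_right_distrib[OF cut_sum_finite[OF 1 c]]) (simp add: integ_mult)
  qed
  then show ?case using quasi_poly_scale[OF scale.IH] by simp
qed

section \<open>Reciprocity for state sums on trees\<close>

text \<open>
  In the application \<open>h\<close> is mapped to a positive vector by the negative of the intersection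
  matrix. The summand \<open>\<epsilon>\<close> keeps the slope positive even when only the root is left.
\<close>

locale slope_graph = graph adj for adj :: "'v::finite \<Rightarrow> 'v \<Rightarrow> bool" +
  fixes h :: "'v \<Rightarrow> real" and \<epsilon> :: real and I :: "'v set"
  assumes h_pos: "h u > 0" and \<epsilon>_pos: "\<epsilon> > 0"
begin

definition slope :: "'v set \<Rightarrow> 'v \<Rightarrow> real" where
  "slope U u = (\<Sum>w\<in>nbrs U u. h w) / h u + \<epsilon>"

lemma slope_pos: "slope U u > 0"
  unfolding slope_def using \<epsilon>_pos h_pos
  by (intro add_nonneg_pos divide_nonneg_nonneg sum_nonneg) (auto intro: less_imp_le)

lemma slope_mono: "slope U u \<le> slope UNIV u"
  unfolding slope_def using h_pos
  by (intro add_right_mono divide_right_mono sum_mono2) (auto simp: nbrs_def intro: less_imp_le)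

text \<open>
  The bounds given by \<open>h\<close> survive elimination: the neighbour loses \<open>h e / h p\<close>, which is
  at least the inverse slope of the leaf.
\<close>

lemma slope_leaf:
  assumes "leaf_of e p U"
  shows "u \<in> U \<Longrightarrow> u \<noteq> p \<Longrightarrow> slope (insert e U) u = slope U u"
    and "slope U p \<le> slope (insert e U) p - 1 / slope (insert e U) e"
proof -
  note nb = nbrs_leaf[OF assms]
  show "u \<in> U \<Longrightarrow> u \<noteq> p \<Longrightarrow> slope (insert e U) u = slope U u" by (simp add: slope_def nb)
  have "slope (insert e U) e = h p / h e + \<epsilon>" by (simp add: slope_def nb(1))
  then have "h p / h e \<le> slope (insert e U) e" using \<epsilon>_pos by simp
  then have "1 / slope (insert e U) e \<le> 1 / (h p / h e)"
    using h_pos by (intro divide_left_mono mult_pos_pos slope_pos divide_pos_pos) auto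
  then have "1 / slope (insert e U) e \<le> h e / h p" by simp
  moreover have "slope (insert e U) p = slope U p + h e / h p"
    using nb(2,3) by (simp add: slope_def add_divide_distrib)
  ultimately show "slope U p \<le> slope (insert e U) p - 1 / slope (insert e U) e" by linarith
qed

definition bounded_state ::
  "'v set \<Rightarrow> ('v \<Rightarrow> real) \<Rightarrow> ('v \<Rightarrow> real) \<Rightarrow> ('v \<Rightarrow> real) \<Rightarrow> ('v \<Rightarrow> kernel) \<Rightarrow> bool" where
  "bounded_state U m L M \<kappa> \<longleftrightarrow>
     (\<forall>u\<in>U. (\<forall>t. mass (\<kappa> u t) = m u) \<and> slope_bound (slope U u) (L u) (M u) (\<kappa> u) \<and> M u \<ge> 0)"

lemma bounded_state_kernel:
  "bounded_state U m L M \<kappa> \<Longrightarrow> u \<in> U \<Longrightarrow> bounded_kernel (slope U u) (L u) (M u) (m u) (\<kappa> u)"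
  unfolding bounded_state_def bounded_kernel_def using slope_pos by blast

lemma bounded_state_eliminate:
  assumes lf: "leaf_of e p U" and b: "bounded_state (insert e U) m L M \<kappa>" and adm: "admissible d \<psi>"
  defines "c \<equiv> slope (insert e U) e"
  shows "bounded_state U (m(p := m p * (d * m e))) (L(p := L p + max 0 (1 + L e / c)))
           (M(p := M p + M e / c)) (eliminate \<psi> e p \<kappa>)"
  unfolding bounded_state_def
proof (intro ballI)
  fix u assume u: "u \<in> U"
  have pU: "p \<in> U" "e \<noteq> p" using lf by (auto simp: leaf_of_def)
  interpret e: bounded_kernel c "L e" "M e" "m e" "\<kappa> e"
    unfolding c_def by (rule bounded_state_kernel[OF b]) simp
  have Me: "M e \<ge> 0" "M p \<ge> 0" using b pU by (auto simp: bounded_state_def)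
  show "(\<forall>t. mass (eliminate \<psi> e p \<kappa> u t) = (m(p := m p * (d * m e))) u) \<and>
      slope_bound (slope U u) ((L(p := L p + max 0 (1 + L e / c))) u) ((M(p := M p + M e / c)) u)
        (eliminate \<psi> e p \<kappa> u) \<and> (M(p := M p + M e / c)) u \<ge> 0"
  proof (cases "u = p")
    case False
    then show ?thesis using b u slope_leaf(1)[OF lf u False]
      by (auto simp: bounded_state_def eliminate_def)
  next
    case True
    have mp: "\<And>t. mass (\<kappa> p t) = m p"
      and bp: "slope_bound (slope (insert e U) p) (L p) (M p) (\<kappa> p)"
      using b pU by (auto simp: bounded_state_def)
    have "mass (\<kappa> p t * push \<psi> (\<kappa> e) t) = m p * (d * m e)" for t
      by (simp add: integ_mult e.mass_push[OF adm] integ_const[of _ "d * m e"] mp)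
    moreover have "slope_bound (slope U p) (L p + max 0 (1 + L e / c)) (M p + M e / c)
        (\<lambda>\<eta>. \<kappa> p \<eta> * push \<psi> (\<kappa> e) \<eta>)"
      by (rule slope_bound_weaken[OF e.slope_bound_push[OF adm Me(1) bp]])
         (use slope_leaf(2)[OF lf] in \<open>auto simp: c_def\<close>)
    ultimately show ?thesis using True Me e.c_pos by (simp add: eliminate_def)
  qed
qed

text \<open>
  The inequalities of the counting function and of its dual, imposed at the vertices of \<open>I\<close> only.
\<close>

definition strict_ind :: "'v \<Rightarrow> int \<Rightarrow> real" where
  "strict_ind u t = (if u \<in> I \<longrightarrow> t < 0 then 1 else 0)"

definition weak_ind :: "'v \<Rightarrow> int \<Rightarrow> real" where
  "weak_ind u t = (if u \<in> I \<longrightarrow> t \<ge> 0 then 1 else 0)"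

abbreviation zero_term :: "'v set \<Rightarrow> ('v \<Rightarrow> kernel) \<Rightarrow> ('v \<Rightarrow> int) \<Rightarrow> real" where
  "zero_term \<equiv> state_sum_term inv_sq_zero strict_ind"

abbreviation infinity_term :: "'v set \<Rightarrow> ('v \<Rightarrow> kernel) \<Rightarrow> ('v \<Rightarrow> int) \<Rightarrow> real" where
  "infinity_term \<equiv> state_sum_term inv_sq_infinity weak_ind"

definition zero_weight :: "'v \<Rightarrow> int \<Rightarrow> int \<Rightarrow> real" where
  "zero_weight u t n = strict_ind u t * binom_coeff inv_sq_zero (Suc 0) n"

definition infinity_weight :: "'v \<Rightarrow> int \<Rightarrow> int \<Rightarrow> real" where
  "infinity_weight u t n = weak_ind u t * binom_coeff inv_sq_infinity (Suc 0) n"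

abbreviation retained :: "'v \<Rightarrow> real" where "retained u \<equiv> (if u \<in> I then 0 else 1)"

lemma admissible_zero: "admissible (retained u) (zero_weight u)"
  unfolding admissible_def zero_weight_def binom_coeff_zero_1
  by (intro exI[of _ 0]) (auto simp: heaviside_def strict_ind_def)

lemma admissible_infinity: "admissible (retained u) (infinity_weight u)"
  unfolding admissible_def infinity_weight_def binom_coeff_infinity_1
  by (intro exI[of _ "- retained u"]) (auto simp: heaviside_def weak_ind_def)

lemma admissible_reg: "admissible (retained u) (reg_weight (u \<in> I))"
  unfolding admissible_def reg_weight_def
  by (intro exI[of _ 0]) (auto simp: heaviside_def)

text \<open>
  For \<open>t < 0\<close> both weights are the plain tail. For \<open>t \<ge> 0\<close> the support lies above \<open>\<eta> < 0\<close>, and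
  both profiles equal the same constant: at a vertex of \<open>I\<close> one is cut off and the other has
  its total mass subtracted.
\<close>

lemma push_zero_eq_reg:
  assumes 0: "bounded_kernel c (- D) M m \<kappa>" and 1: "bounded_kernel c (- D) M m \<mu>" and D: "D \<ge> 0"
    and eq: "\<And>t. t < 0 \<Longrightarrow> \<kappa> t = \<mu> t" and \<eta>: "\<eta> < 0"
  shows "push (zero_weight e) \<kappa> \<eta> = push (reg_weight (e \<in> I)) \<mu> \<eta>"
proof -
  have c: "c > 0" using 0 by (simp add: bounded_kernel_def)
  have "profile (zero_weight e) \<kappa> \<eta> t = profile (reg_weight (e \<in> I)) \<mu> \<eta> t" for t
  proof (cases "t < 0")
    case True
    then show ?thesis
      by (simp add: profile_def eq zero_weight_def reg_weight_def strict_ind_def binom_coeff_zero_1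
          del: binom_coeff.simps)
  next
    case False
    have "c * of_int t \<ge> 0" using c False by simp
    then have "of_int \<eta> + (- D) \<le> c * of_int t" using D \<eta> by linarith
    moreover have "t \<ge> 0" using False by simp
    moreover have "zero_weight e s n = retained e" "reg_weight (e \<in> I) s n = retained e" if "s \<ge> 0" "n \<ge> 0" for s n
      using that by (simp_all add: zero_weight_def strict_ind_def binom_coeff_zero_1 heaviside_def
          reg_weight_def del: binom_coeff.simps)
    ultimately have "profile (zero_weight e) \<kappa> \<eta> t = retained e * m"
      "profile (reg_weight (e \<in> I)) \<mu> \<eta> t = retained e * m"
      using bounded_kernel.profile_high[OF 0] bounded_kernel.profile_high[OF 1] by blast+
    then show ?thesis by simp
  qed
  then show ?thesis unfolding push_def by (intro jumps_eqI) simp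
qed

text \<open>
  The two profiles differ by a constant, which the jumps do not see. For \<open>t < 0\<close> this holds
  because \<open>M = 0\<close> keeps the support strictly below \<open>\<eta> \<ge> 0\<close>.
\<close>

lemma push_infinity_eq_reg:
  assumes 0: "bounded_kernel c L 0 m \<kappa>" and 1: "bounded_kernel c L 0 m \<mu>"
    and eq: "\<And>t. t \<ge> 0 \<Longrightarrow> \<kappa> t = \<mu> t" and \<eta>: "\<eta> \<ge> 0"
  shows "push (infinity_weight e) \<kappa> \<eta> = push (reg_weight (e \<in> I)) \<mu> \<eta>"
proof -
  have c: "c > 0" using 0 by (simp add: bounded_kernel_def)
  have "profile (infinity_weight e) \<kappa> \<eta> t = profile (reg_weight (e \<in> I)) \<mu> \<eta> t - retained e * m" for t
  proof (cases "t \<ge> 0")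
    case True
    have "infinity_weight e t n = reg_weight (e \<in> I) t n - retained e" for n
      using True by (simp add: infinity_weight_def reg_weight_def weak_ind_def binom_coeff_infinity_1
          del: binom_coeff.simps)
    then show ?thesis
      using bounded_kernel.mass_const[OF 1]
      by (simp add: profile_def eq[OF True] integ_diff_fun integ_const[of _ "retained e"])
  next
    case False
    then have "c * of_int t < 0" using c by (simp add: mult_pos_neg)
    then have "c * of_int t + 0 < of_int \<eta>" using \<eta> by linarith
    moreover have "t < 0" using False by simp
    moreover have "infinity_weight e s n = - retained e" "reg_weight (e \<in> I) s n = 0" if "s < 0" "n < 0" for s n
      using that by (simp_all add: infinity_weight_def weak_ind_def binom_coeff_infinity_1 heaviside_def
          reg_weight_def del: binom_coeff.simps)
    ultimately have "profile (infinity_weight e) \<kappa> \<eta> t = (- retained e) * m"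
      "profile (reg_weight (e \<in> I)) \<mu> \<eta> t = 0 * m"
      using bounded_kernel.profile_low[OF 0] bounded_kernel.profile_low[OF 1] by blast+
    then show ?thesis by simp
  qed
  then show ?thesis unfolding push_def by (intro jumps_eqI) simp
qed

lemma Sum_any_singleton_state:
  assumes fin: "finite {y. state_sum_term R \<omega> {r} \<kappa> y \<noteq> 0}"
  shows "Sum_any (state_sum_term R \<omega> {r} \<kappa>) = Sum_any (\<lambda>t. \<omega> r t * integ (\<kappa> r t) R)"
proof -
  let ?F = "state_sum_term R \<omega> {r} \<kappa>"
  let ?G = "\<lambda>y. if y r = 0 then Sum_any (\<lambda>t. ?F (y(r := t))) else 0"
  have n: "nbrs {r} r = {}" using adj_irrefl by (auto simp: nbrs_def)
  have "?G y = 0" if "y \<noteq> (\<lambda>_. 0)" for y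
  proof (cases "y r = 0")
    case True
    then have "\<exists>v. v \<noteq> r \<and> y v \<noteq> 0" using that by (metis ext)
    then obtain v where "v \<noteq> r" "y v \<noteq> 0" by blast
    then have "\<not> (\<forall>v. v \<notin> {r} \<longrightarrow> (y(r := t)) v = 0)" for t by auto
    then have "?F (y(r := t)) = 0" for t unfolding state_sum_term_def by (rule if_not_P)
    then show ?thesis by simp
  qed simp
  then have "{y. ?G y \<noteq> 0} \<subseteq> {\<lambda>_. 0}" by blast
  then have "Sum_any ?G = sum ?G {\<lambda>_. 0}" by (intro Sum_any.expand_superset) auto
  moreover have "?F ((\<lambda>_. 0)(r := t)) = \<omega> r t * integ (\<kappa> r t) R" for t
    by (simp add: state_sum_term_def n)
  ultimately show ?thesis using Sum_any_fun_upd(2)[OF fin, of r] by simp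
qed

text \<open>
  The invariant of the elimination. \<open>deep\<close> and \<open>anti\<close> single out the parameters deep in the cone and
  those in the opposite cone. The truncated systems agree with the regularized one only on the
  half-line that the respective count at the root uses.
\<close>

definition compatible ::
  "real \<Rightarrow> (('v \<Rightarrow> int) \<Rightarrow> bool) \<Rightarrow> (('v \<Rightarrow> int) \<Rightarrow> bool) \<Rightarrow> 'v set \<Rightarrow> ('v \<Rightarrow> real) \<Rightarrow>
   (('v \<Rightarrow> int) \<Rightarrow> 'v \<Rightarrow> kernel) \<Rightarrow> (('v \<Rightarrow> int) \<Rightarrow> 'v \<Rightarrow> kernel) \<Rightarrow> (('v \<Rightarrow> int) \<Rightarrow> 'v \<Rightarrow> kernel) \<Rightarrow> bool"
where
  "compatible D deep anti U m \<kappa>0 \<kappa>inf \<kappa>reg \<longleftrightarrow>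
     (\<forall>u\<in>U. kernel_span (slope U u) (\<lambda>A. \<kappa>reg A u)) \<and>
     (\<forall>A. deep A \<longrightarrow> (\<exists>M. bounded_state U m (\<lambda>_. - D) M (\<kappa>0 A) \<and> bounded_state U m (\<lambda>_. - D) M (\<kappa>reg A)) \<and>
        (\<forall>u\<in>U. \<forall>t<0. \<kappa>0 A u t = \<kappa>reg A u t)) \<and>
     (\<forall>A. anti A \<longrightarrow> (\<exists>L. bounded_state U m L (\<lambda>_. 0) (\<kappa>inf A) \<and> bounded_state U m L (\<lambda>_. 0) (\<kappa>reg A)) \<and>
        (\<forall>u\<in>U. \<forall>t\<ge>0. \<kappa>inf A u t = \<kappa>reg A u t))"

lemma compatibleD:
  assumes "compatible D deep anti U m \<kappa>0 \<kappa>inf \<kappa>reg"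
  shows "u \<in> U \<Longrightarrow> kernel_span (slope U u) (\<lambda>A. \<kappa>reg A u)"
    and "deep A \<Longrightarrow> \<exists>M. bounded_state U m (\<lambda>_. - D) M (\<kappa>0 A) \<and> bounded_state U m (\<lambda>_. - D) M (\<kappa>reg A)"
    and "deep A \<Longrightarrow> u \<in> U \<Longrightarrow> t < 0 \<Longrightarrow> \<kappa>0 A u t = \<kappa>reg A u t"
    and "anti A \<Longrightarrow> \<exists>L. bounded_state U m L (\<lambda>_. 0) (\<kappa>inf A) \<and> bounded_state U m L (\<lambda>_. 0) (\<kappa>reg A)"
    and "anti A \<Longrightarrow> u \<in> U \<Longrightarrow> t \<ge> 0 \<Longrightarrow> \<kappa>inf A u t = \<kappa>reg A u t"
  using assms unfolding compatible_def by simp_all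

text \<open>
  The sign of the argument of \<open>p\<close> is the sign of \<open>\<eta>\<close> in the pushed leaf measure, so agreement
  on a half-line is inherited through \<open>push_zero_eq_reg\<close> and \<open>push_infinity_eq_reg\<close>.
\<close>

lemma compatible_eliminate:
  assumes lf: "leaf_of e p U" and D0: "D \<ge> 0" and D: "D \<ge> slope UNIV e"
    and co: "compatible D deep anti (insert e U) m \<kappa>0 \<kappa>inf \<kappa>reg"
  shows "compatible D deep anti U (m(p := m p * (retained e * m e)))
     (\<lambda>A. eliminate (zero_weight e) e p (\<kappa>0 A))
     (\<lambda>A. eliminate (infinity_weight e) e p (\<kappa>inf A))
     (\<lambda>A. eliminate (reg_weight (e \<in> I)) e p (\<kappa>reg A))"
proof -
  let ?V = "insert e U"
  let ?c = "slope ?V e"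
  let ?k0 = "\<lambda>A. eliminate (zero_weight e) e p (\<kappa>0 A)"
  let ?ki = "\<lambda>A. eliminate (infinity_weight e) e p (\<kappa>inf A)"
  let ?kr = "\<lambda>A. eliminate (reg_weight (e \<in> I)) e p (\<kappa>reg A)"
  let ?m = "m(p := m p * (retained e * m e))"
  have c_pos: "?c > 0" by (rule slope_pos)
  have c_D: "?c \<le> D" using slope_mono[of ?V e] D by linarith
  have pU: "p \<in> U" using lf by (simp add: leaf_of_def)
  have span: "kernel_span (slope U u) (\<lambda>A. ?kr A u)" if u: "u \<in> U" for u
  proof (cases "u = p")
    case True
    have "kernel_span (slope ?V p - 1 / ?c)
        (\<lambda>A \<eta>. \<kappa>reg A p \<eta> * push (reg_weight (e \<in> I)) (\<kappa>reg A e) \<eta>)"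
      using compatibleD(1)[OF co] pU by (intro kernel_span_push_reg c_pos) auto
    then show ?thesis using True kernel_span_mono[OF _ slope_leaf(2)[OF lf]] by (simp add: eliminate_def)
  next
    case False
    then show ?thesis using compatibleD(1)[OF co, of u] u slope_leaf(1)[OF lf u False]
      by (simp add: eliminate_def)
  qed
  have deep: "(\<exists>M. bounded_state U ?m (\<lambda>_. - D) M (?k0 A) \<and> bounded_state U ?m (\<lambda>_. - D) M (?kr A)) \<and>
        (\<forall>u\<in>U. \<forall>t<0. ?k0 A u t = ?kr A u t)" if A: "deep A" for A
  proof (intro conjI ballI allI impI)
    obtain M where M: "bounded_state ?V m (\<lambda>_. - D) M (\<kappa>0 A)" "bounded_state ?V m (\<lambda>_. - D) M (\<kappa>reg A)"
      using compatibleD(2)[OF co A] by blast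
    have eq: "\<kappa>0 A u t = \<kappa>reg A u t" if "u \<in> ?V" "t < 0" for u t
      using compatibleD(3)[OF co A that] .
    have "1 + (- D) / ?c \<le> 0" using c_D c_pos by (simp add: field_simps)
    then have L: "(\<lambda>_. - D)(p := - D + max 0 (1 + (- D) / ?c)) = (\<lambda>_. - D)" by auto
    show "\<exists>M. bounded_state U ?m (\<lambda>_. - D) M (?k0 A) \<and> bounded_state U ?m (\<lambda>_. - D) M (?kr A)"
      using bounded_state_eliminate[OF lf M(1) admissible_zero[of e]]
        bounded_state_eliminate[OF lf M(2) admissible_reg[of e]] unfolding L by blast
    fix u t assume ut: "u \<in> U" "(t::int) < 0"
    have "push (zero_weight e) (\<kappa>0 A e) t = push (reg_weight (e \<in> I)) (\<kappa>reg A e) t"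
      by (rule push_zero_eq_reg[OF bounded_state_kernel[OF M(1)] bounded_state_kernel[OF M(2)] D0 _ ut(2)])
         (use eq in auto)
    then show "?k0 A u t = ?kr A u t" using eq[of _ t] ut pU by (simp add: eliminate_def)
  qed
  have anti: "(\<exists>L. bounded_state U ?m L (\<lambda>_. 0) (?ki A) \<and> bounded_state U ?m L (\<lambda>_. 0) (?kr A)) \<and>
        (\<forall>u\<in>U. \<forall>t\<ge>0. ?ki A u t = ?kr A u t)" if A: "anti A" for A
  proof (intro conjI ballI allI impI)
    obtain L where L: "bounded_state ?V m L (\<lambda>_. 0) (\<kappa>inf A)" "bounded_state ?V m L (\<lambda>_. 0) (\<kappa>reg A)"
      using compatibleD(4)[OF co A] by blast
    have eq: "\<kappa>inf A u t = \<kappa>reg A u t" if "u \<in> ?V" "t \<ge> 0" for u t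
      using compatibleD(5)[OF co A that] .
    have M: "(\<lambda>_. 0::real)(p := 0 + 0 / ?c) = (\<lambda>_. 0)" by auto
    show "\<exists>L. bounded_state U ?m L (\<lambda>_. 0) (?ki A) \<and> bounded_state U ?m L (\<lambda>_. 0) (?kr A)"
      using bounded_state_eliminate[OF lf L(1) admissible_infinity[of e]]
        bounded_state_eliminate[OF lf L(2) admissible_reg[of e]] unfolding M by blast
    fix u t assume ut: "u \<in> U" "(t::int) \<ge> 0"
    have "push (infinity_weight e) (\<kappa>inf A e) t = push (reg_weight (e \<in> I)) (\<kappa>reg A e) t"
    proof (rule push_infinity_eq_reg[OF _ _ _ ut(2)])
      show "bounded_kernel ?c (L e) 0 (m e) (\<kappa>inf A e)" "bounded_kernel ?c (L e) 0 (m e) (\<kappa>reg A e)"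
        using bounded_state_kernel[OF L(1), of e] bounded_state_kernel[OF L(2), of e] by auto
    qed (use eq in auto)
    then show "?ki A u t = ?kr A u t" using eq[of _ t] ut pU by (simp add: eliminate_def)
  qed
  show ?thesis unfolding compatible_def using span deep anti by blast
qed

lemma state_sum_zero_eliminate:
  assumes lf: "leaf_of e p U" and b: "bounded_state (insert e U) m L M \<kappa>"
    and fin: "finite {y. zero_term (insert e U) \<kappa> y \<noteq> 0}"
  shows "finite {y. zero_term U (eliminate (zero_weight e) e p \<kappa>) y \<noteq> 0}"
    and "Sum_any (zero_term (insert e U) \<kappa>)
       = Sum_any (zero_term U (eliminate (zero_weight e) e p \<kappa>))"
proof -
  have ec: "eventually_const (profile (zero_weight e) (\<kappa> e) \<eta>) (0 * m e) (retained e * m e)" for \<eta>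
    by (rule bounded_kernel.profile_eventually_const'[OF bounded_state_kernel[OF b]])
       (auto simp: zero_weight_def strict_ind_def binom_coeff_zero_1 heaviside_def simp del: binom_coeff.simps)
  have "\<forall>k. \<exists>T. \<forall>n\<le>T. binom_coeff inv_sq_zero k n = 0"
    by (intro allI exI[of _ "-1"]) (auto intro: binom_coeff_zero_neg)
  then have side: "0 * m e = 0 \<and> (\<forall>k. \<exists>T. \<forall>n\<le>T. binom_coeff inv_sq_zero k n = 0)
     \<or> retained e * m e = 0 \<and> (\<forall>k. \<exists>T. \<forall>n\<ge>T. binom_coeff inv_sq_zero k n = 0)" by simp
  show "finite {y. zero_term U (eliminate (zero_weight e) e p \<kappa>) y \<noteq> 0}"
    "Sum_any (zero_term (insert e U) \<kappa>)
       = Sum_any (zero_term U (eliminate (zero_weight e) e p \<kappa>))"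
    using state_sum_eliminate[OF lf ec zero_weight_def side fin] by simp_all
qed

lemma state_sum_infinity_eliminate:
  assumes lf: "leaf_of e p U" and b: "bounded_state (insert e U) m L M \<kappa>"
    and fin: "finite {y. infinity_term (insert e U) \<kappa> y \<noteq> 0}"
  shows "finite {y. infinity_term U (eliminate (infinity_weight e) e p \<kappa>) y \<noteq> 0}"
    and "Sum_any (infinity_term (insert e U) \<kappa>)
       = Sum_any (infinity_term U (eliminate (infinity_weight e) e p \<kappa>))"
proof -
  have ec: "eventually_const (profile (infinity_weight e) (\<kappa> e) \<eta>) (- retained e * m e) (0 * m e)" for \<eta>
    by (rule bounded_kernel.profile_eventually_const'[OF bounded_state_kernel[OF b]])
       (auto simp: infinity_weight_def weak_ind_def binom_coeff_infinity_1 heaviside_def simp del: binom_coeff.simps)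
  have "\<forall>k. \<exists>T. \<forall>n\<ge>T. binom_coeff inv_sq_infinity k n = 0"
    using binom_coeff_infinity_large by blast
  then have side: "- retained e * m e = 0 \<and> (\<forall>k. \<exists>T. \<forall>n\<le>T. binom_coeff inv_sq_infinity k n = 0)
     \<or> 0 * m e = 0 \<and> (\<forall>k. \<exists>T. \<forall>n\<ge>T. binom_coeff inv_sq_infinity k n = 0)" by simp
  show "finite {y. infinity_term U (eliminate (infinity_weight e) e p \<kappa>) y \<noteq> 0}"
    "Sum_any (infinity_term (insert e U) \<kappa>)
       = Sum_any (infinity_term U (eliminate (infinity_weight e) e p \<kappa>))"
    using state_sum_eliminate[OF lf ec infinity_weight_def side fin] by simp_all
qed

text \<open>
  At the root the half of the cut sum with nonnegative arguments vanishes, because the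
  support of the measures is nonnegative there.
\<close>

lemma state_sum_root_zero:
  assumes rI: "r \<in> I" and D0: "D \<ge> 0" and M: "bounded_state {r} m (\<lambda>_. - D) M \<mu>"
    and eq: "\<And>t. t < 0 \<Longrightarrow> \<kappa> r t = \<mu> r t"
    and fin: "finite {y. zero_term {r} \<kappa> y \<noteq> 0}"
  shows "Sum_any (zero_term {r} \<kappa>) = cut_sum (\<mu> r) 0"
proof -
  let ?c = "slope {r} r"
  have "strict_ind r t * integ (\<kappa> r t) inv_sq_zero
      = integ (\<mu> r t) (if t < 0 then inv_sq_zero else inv_sq_infinity)" for t
  proof (cases "t < 0")
    case True
    then show ?thesis by (simp add: eq strict_ind_def)
  next
    case False
    have "inv_sq_infinity a = 0" if "a \<in> supp (\<mu> r t)" for a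
    proof -
      have "?c * of_int t + D \<le> of_int a"
        using M False that by (auto simp: bounded_state_def slope_bound_def)
      moreover have "?c * of_int t \<ge> 0" using slope_pos[of "{r}" r] False by simp
      ultimately show ?thesis using D0 by (simp add: inv_sq_infinity_def)
    qed
    then show ?thesis using False rI by (simp add: strict_ind_def integ_def)
  qed
  then show ?thesis by (simp add: Sum_any_singleton_state[OF fin] cut_sum_def)
qed

lemma state_sum_root_infinity:
  assumes rI: "r \<in> I" and L: "bounded_state {r} m L (\<lambda>_. 0) \<mu>"
    and eq: "\<And>t. t \<ge> 0 \<Longrightarrow> \<kappa> r t = \<mu> r t"
    and fin: "finite {y. infinity_term {r} \<kappa> y \<noteq> 0}"
  shows "Sum_any (infinity_term {r} \<kappa>) = cut_sum (\<mu> r) 0"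
proof -
  let ?c = "slope {r} r"
  have "weak_ind r t * integ (\<kappa> r t) inv_sq_infinity
      = integ (\<mu> r t) (if t < 0 then inv_sq_zero else inv_sq_infinity)" for t
  proof (cases "t < 0")
    case False
    then show ?thesis by (simp add: eq weak_ind_def)
  next
    case True
    have "inv_sq_zero a = 0" if "a \<in> supp (\<mu> r t)" for a
    proof -
      have "of_int a \<le> ?c * of_int t"
        using L True that by (auto simp: bounded_state_def slope_bound_def)
      moreover have "?c * of_int t < 0" using slope_pos[of "{r}" r] True by (simp add: mult_pos_neg)
      ultimately have "a < 0" by linarith
      then have "a + 1 \<le> 0" by simp
      then have "real_of_int a + 1 \<le> 0" by linarith
      then show ?thesis by (simp add: inv_sq_zero_def)
    qed
    then show ?thesis using True rI by (simp add: weak_ind_def integ_def)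
  qed
  then show ?thesis by (simp add: Sum_any_singleton_state[OF fin] cut_sum_def)
qed

theorem state_sum_reciprocity:
  assumes "tree_on adj r U" and rI: "r \<in> I" and D0: "D \<ge> 0" and D: "\<And>u. D \<ge> slope UNIV u"
    and "compatible D deep anti U m \<kappa>0 \<kappa>inf \<kappa>reg"
  shows "\<exists>p. quasi_poly p \<and>
    (\<forall>A. deep A \<longrightarrow> finite {y. zero_term U (\<kappa>0 A) y \<noteq> 0} \<longrightarrow>
        Sum_any (zero_term U (\<kappa>0 A)) = p A) \<and>
    (\<forall>A. anti A \<longrightarrow> finite {y. infinity_term U (\<kappa>inf A) y \<noteq> 0} \<longrightarrow>
        Sum_any (infinity_term U (\<kappa>inf A)) = p A)"
  using assms(1,5)
proof (induction arbitrary: \<kappa>0 \<kappa>inf \<kappa>reg m rule: tree_on.induct)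
  case root
  let ?p = "\<lambda>A. cut_sum (\<kappa>reg A r) 0"
  have "kernel_span (slope {r} r) (\<lambda>A. \<kappa>reg A r)" using compatibleD(1)[OF root.prems] by simp
  then have "quasi_poly ?p" using slope_pos by (intro quasi_poly_root_sum) auto
  moreover have "Sum_any (zero_term {r} (\<kappa>0 A)) = ?p A"
    if A: "deep A" and fin: "finite {y. zero_term {r} (\<kappa>0 A) y \<noteq> 0}" for A
  proof -
    obtain M where M: "bounded_state {r} m (\<lambda>_. - D) M (\<kappa>reg A)"
      using compatibleD(2)[OF root.prems A] by blast
    have "\<kappa>0 A r t = \<kappa>reg A r t" if "t < 0" for t
      using compatibleD(3)[OF root.prems A _ that] by simp
    then show ?thesis by (rule state_sum_root_zero[OF rI D0 M _ fin])
  qed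
  moreover have "Sum_any (infinity_term {r} (\<kappa>inf A)) = ?p A"
    if A: "anti A" and fin: "finite {y. infinity_term {r} (\<kappa>inf A) y \<noteq> 0}" for A
  proof -
    obtain L where L: "bounded_state {r} m L (\<lambda>_. 0) (\<kappa>reg A)"
      using compatibleD(4)[OF root.prems A] by blast
    have "\<kappa>inf A r t = \<kappa>reg A r t" if "t \<ge> 0" for t
      using compatibleD(5)[OF root.prems A _ that] by simp
    then show ?thesis by (rule state_sum_root_infinity[OF rI L _ fin])
  qed
  ultimately show ?case by blast
next
  case (leaf U p e)
  have lf: "leaf_of e p U" using leaf.hyps unfolding leaf_of_def by blast
  obtain q where q: "quasi_poly q"
    "\<And>A. deep A \<Longrightarrow> finite {y. zero_term U (eliminate (zero_weight e) e p (\<kappa>0 A)) y \<noteq> 0} \<Longrightarrow>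
        Sum_any (zero_term U (eliminate (zero_weight e) e p (\<kappa>0 A))) = q A"
    "\<And>A. anti A \<Longrightarrow> finite {y. infinity_term U (eliminate (infinity_weight e) e p (\<kappa>inf A)) y \<noteq> 0} \<Longrightarrow>
        Sum_any (infinity_term U (eliminate (infinity_weight e) e p (\<kappa>inf A))) = q A"
    using leaf.IH[OF compatible_eliminate[OF lf D0 D leaf.prems]] by (elim exE conjE) (rule that, blast+)
  have "Sum_any (zero_term (insert e U) (\<kappa>0 A)) = q A"
    if A: "deep A" and fin: "finite {y. zero_term (insert e U) (\<kappa>0 A) y \<noteq> 0}" for A
  proof -
    obtain M where "bounded_state (insert e U) m (\<lambda>_. - D) M (\<kappa>0 A)"
      using compatibleD(2)[OF leaf.prems A] by blast
    from state_sum_zero_eliminate[OF lf this fin] show ?thesis using q(2)[OF A] by simp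
  qed
  moreover have "Sum_any (infinity_term (insert e U) (\<kappa>inf A)) = q A"
    if A: "anti A" and fin: "finite {y. infinity_term (insert e U) (\<kappa>inf A) y \<noteq> 0}" for A
  proof -
    obtain L where "bounded_state (insert e U) m L (\<lambda>_. 0) (\<kappa>inf A)"
      using compatibleD(4)[OF leaf.prems A] by blast
    from state_sum_infinity_eliminate[OF lf this fin] show ?thesis using q(3)[OF A] by simp
  qed
  ultimately show ?case using q(1) by blast
qed

end

section \<open>Growing a tree from a root\<close>

text \<open>
  Simple paths inside the grown part; together with a second neighbour of a new vertex they would
  close a cycle.
\<close>

lemma tree_on_path:
  assumes "tree_on adj r U" and sym: "\<And>u v. adj u v \<Longrightarrow> adj v u" and "a \<in> U" "b \<in> U"
  shows "\<exists>p. p \<noteq> [] \<and> distinct p \<and> successively adj p \<and> set p \<subseteq> U \<and> hd p = a \<and> last p = b"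
  using assms(1,3,4)
proof (induction arbitrary: a b rule: tree_on.induct)
  case root
  then show ?case by (intro exI[of _ "[r]"]) auto
next
  case (leaf U p e)
  have to_e: "\<exists>q. q \<noteq> [] \<and> distinct q \<and> successively adj q \<and> set q \<subseteq> insert e U \<and> hd q = a \<and> last q = e"
    if a: "a \<in> U" for a
  proof -
    obtain q where q: "q \<noteq> []" "distinct q" "successively adj q" "set q \<subseteq> U" "hd q = a" "last q = p"
      using leaf.IH[OF a leaf.hyps(2)] by blast
    show ?thesis
      using q leaf.hyps(3) sym[OF leaf.hyps(4)]
      by (intro exI[of _ "q @ [e]"]) (auto simp: successively_append_iff)
  qed
  have from_e: "\<exists>q. q \<noteq> [] \<and> distinct q \<and> successively adj q \<and> set q \<subseteq> insert e U \<and> hd q = e \<and> last q = b"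
    if b: "b \<in> U" for b
  proof -
    obtain q where q: "q \<noteq> []" "distinct q" "successively adj q" "set q \<subseteq> U" "hd q = p" "last q = b"
      using leaf.IH[OF leaf.hyps(2) b] by blast
    show ?thesis
      using q leaf.hyps(3,4)
      by (intro exI[of _ "e # q"]) (auto simp: successively_Cons)
  qed
  show ?case
  proof (cases "a = e")
    case True
    then show ?thesis
      using from_e leaf.prems by (cases "b = e") (auto intro: exI[of _ "[e]"])
  next
    case False
    then have a: "a \<in> U" using leaf.prems by auto
    show ?thesis
    proof (cases "b = e")
      case True
      then show ?thesis using to_e[OF a] by simp
    next
      case False
      then have "b \<in> U" using leaf.prems by auto
      from leaf.IH[OF a this] show ?thesis by blast
    qed
  qed
qed

text \<open>
  A maximal grown part is everything: connectedness supplies a vertex adjacent to it, and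
  acyclicity makes the adjacency unique.
\<close>

lemma is_tree_tree_on:
  fixes adj :: "'v::finite \<Rightarrow> 'v \<Rightarrow> bool"
  assumes t: "is_tree adj"
  shows "tree_on adj r UNIV"
proof -
  have sym: "\<And>u v. adj u v \<Longrightarrow> adj v u"
    and conn: "\<And>u v. adj\<^sup>*\<^sup>* u v" and acyc: "\<And>p. \<not> is_cycle adj p"
    using t unfolding is_tree_def by blast+
  have "\<exists>U. tree_on adj r U \<and> (\<forall>W. tree_on adj r W \<longrightarrow> card W \<le> card U)"
    by (rule ex_has_greatest_nat[of _ "{r}" _ "Suc (card (UNIV :: 'v set))"])
       (auto intro: tree_on.root simp: less_Suc_eq_le card_mono)
  then obtain U where U: "tree_on adj r U" and max: "\<And>W. tree_on adj r W \<Longrightarrow> card W \<le> card U" by blast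
  have "r \<in> U" using U by (induction rule: tree_on.induct) auto
  have "v \<in> U" for v
  proof (rule ccontr)
    assume v: "v \<notin> U"
    have "\<exists>p e. p \<in> U \<and> e \<notin> U \<and> adj p e"
      using conn[of r v] v \<open>r \<in> U\<close>
    proof (induction rule: rtranclp_induct)
      case (step y z)
      then show ?case by blast
    qed simp
    then obtain p e where pe: "p \<in> U" "e \<notin> U" "adj p e" by blast
    have "w = p" if w: "w \<in> U" "adj e w" for w
    proof (rule ccontr)
      assume "w \<noteq> p"
      obtain q where q: "q \<noteq> []" "distinct q" "successively adj q" "set q \<subseteq> U" "hd q = w" "last q = p"
        using tree_on_path[OF U sym w(1) pe(1)] by blast
      have "length q \<ge> 2"
        using q(1,5,6) \<open>w \<noteq> p\<close> by (cases q; cases "tl q") auto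
      then have "is_cycle adj (e # q)"
        using q pe w by (auto simp: is_cycle_def successively_Cons)
      then show False using acyc by blast
    qed
    then have "tree_on adj r (insert e U)"
      using tree_on.leaf[OF U pe(1,2) sym[OF pe(3)]] by blast
    from max[OF this] pe(2) show False by simp
  qed
  then show ?thesis using U by (metis UNIV_eq_I)
qed

lemma (in graph) even_sum_card_nbrs:
  assumes "tree_on adj r U"
  shows "even (\<Sum>u\<in>U. card (nbrs U u))"
  using assms
proof (induction rule: tree_on.induct)
  case root
  have "nbrs {r} r = {}" using adj_irrefl by (auto simp: nbrs_def)
  then show ?case by simp
next
  case (leaf U p e)
  have lf: "leaf_of e p U" using leaf.hyps unfolding leaf_of_def by blast
  note nb = nbrs_leaf[OF lf]
  have "(\<Sum>u\<in>insert e U. card (nbrs (insert e U) u)) = 1 + (\<Sum>u\<in>U. card (nbrs (insert e U) u))"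
    using leaf.hyps(3) by (simp add: nb(1))
  also have "(\<Sum>u\<in>U. card (nbrs (insert e U) u)) = (\<Sum>u\<in>U. card (nbrs U u) + (if u = p then 1 else 0))"
    using nb(2,3,4) by (intro sum.cong) auto
  also have "\<dots> = (\<Sum>u\<in>U. card (nbrs U u)) + 1"
    using leaf.hyps(2) by (simp add: sum.distrib)
  finally show ?case using leaf.IH by simp
qed

section \<open>The intersection form\<close>

text \<open>
  The functional equation \<open>(1 - 1/X)^(k-2) = (-1)^k X^(2-k) (1 - X)^(k-2)\<close> on coefficients.
\<close>

lemma binom_coeff_infinity_reflect:
  "binom_coeff inv_sq_infinity k n = (-1) ^ k * binom_coeff inv_sq_zero k (int k - 2 - n)"
proof (induction k arbitrary: n)
  case 0
  then show ?case by (simp add: inv_sq_infinity_def inv_sq_zero_def)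
next
  case (Suc k)
  have "int k - 2 - (n - 1) = int (Suc k) - 2 - n" "int (Suc k) - 2 - n - 1 = int k - 2 - n" by auto
  then show ?case by (simp only: binom_coeff.simps Suc power_Suc) (simp add: algebra_simps)
qed

locale resolution =
  fixes \<Gamma> :: "'v::finite weighted_graph"
  assumes qhs: "QHS_resolution_graph \<Gamma>"
begin

abbreviation adj where "adj \<equiv> adjacent \<Gamma>"

definition wt :: "'v \<Rightarrow> int" where "wt v = - self_int \<Gamma> v"

lemma tree: "is_tree adj" and neg_def: "x \<noteq> 0 \<Longrightarrow> int_form \<Gamma> x x < 0"
  using qhs by (auto simp: QHS_resolution_graph_def)

lemma adj_sym': "adj u v \<Longrightarrow> adj v u" and adj_irrefl': "\<not> adj v v" and adj_conn: "adj\<^sup>*\<^sup>* u v"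
  using tree by (auto simp: is_tree_def)

sublocale graph adj
  by unfold_locales (auto intro: adj_sym' simp: adj_irrefl')

lemma card_nbrs_UNIV: "card (nbrs UNIV u) = valency \<Gamma> u"
  by (auto simp: nbrs_def valency_def)

text \<open>
  The coordinate of \<open>x\<close> with respect to the dual basis \<open>E_dual\<close>, that is \<open>-(x, E\<^sub>v)\<close>.
\<close>

definition coord :: "real^'v \<Rightarrow> 'v \<Rightarrow> real" where
  "coord x v = of_int (wt v) * x $ v - (\<Sum>w\<in>nbrs UNIV v. x $ w)"

definition coordZ :: "('v \<Rightarrow> int) \<Rightarrow> 'v \<Rightarrow> int" where
  "coordZ y v = wt v * y v - (\<Sum>w\<in>nbrs UNIV v. y w)"

lemma coord_of_int: "coord (\<chi> v. of_int (y v)) u = of_int (coordZ y u)"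
  by (simp add: coord_def coordZ_def)

lemma coord_add: "coord (x + y) v = coord x v + coord y v"
  and coord_diff: "coord (x - y) v = coord x v - coord y v"
  and coord_minus: "coord (- x) v = - coord x v"
  and coord_scaleR: "coord (c *\<^sub>R x) v = c * coord x v"
  and coord_0: "coord 0 v = 0"
  by (simp_all add: coord_def sum.distrib sum_subtractf sum_negf right_diff_distrib distrib_left
      sum_distrib_left[symmetric] mult.left_commute)

lemma coord_sum: "coord (\<Sum>i\<in>S. f i) v = (\<Sum>i\<in>S. coord (f i) v)"
  by (induction S rule: infinite_finite_induct) (auto simp: coord_add coord_0)

lemma coordZ_add: "coordZ (\<lambda>v. y v + z v) u = coordZ y u + coordZ z u"
  by (simp add: coordZ_def sum.distrib distrib_left)

lemma int_matrix_nth: "int_matrix \<Gamma> $ u $ v = (if u = v then of_int (self_int \<Gamma> u) else if adj u v then 1 else 0)"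
  by (simp add: int_matrix_def)

lemma int_matrix_sym: "int_matrix \<Gamma> $ u $ v = int_matrix \<Gamma> $ v $ u"
  using adj_sym' by (auto simp: int_matrix_nth)

lemma int_form_sum: "int_form \<Gamma> x y = (\<Sum>u\<in>UNIV. \<Sum>v\<in>UNIV. x $ u * int_matrix \<Gamma> $ u $ v * y $ v)"
  by (simp add: int_form_def inner_vec_def matrix_vector_mult_def sum_distrib_left mult.assoc)

lemma row_sum: "(\<Sum>u\<in>UNIV. x $ u * int_matrix \<Gamma> $ u $ v) = - coord x v"
proof -
  have "(\<Sum>u\<in>UNIV. x $ u * int_matrix \<Gamma> $ u $ v)
      = (\<Sum>u\<in>UNIV. (if u = v then of_int (self_int \<Gamma> v) * x $ v else 0) + (if u \<in> nbrs UNIV v then x $ u else 0))"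
    using adj_sym' adj_irrefl' by (intro sum.cong) (auto simp: int_matrix_nth nbrs_def)
  also have "\<dots> = - coord x v"
    by (simp add: sum.distrib coord_def wt_def sum.If_cases)
  finally show ?thesis .
qed

lemma int_form_coord: "int_form \<Gamma> x y = - (\<Sum>v\<in>UNIV. coord x v * y $ v)"
proof -
  have "int_form \<Gamma> x y = (\<Sum>v\<in>UNIV. (\<Sum>u\<in>UNIV. x $ u * int_matrix \<Gamma> $ u $ v) * y $ v)"
    unfolding int_form_sum by (subst sum.swap) (simp add: sum_distrib_right)
  then show ?thesis by (simp add: row_sum sum_negf)
qed

lemma int_form_E: "int_form \<Gamma> x (E v) = - coord x v"
proof -
  have "(\<Sum>u\<in>UNIV. coord x u * E v $ u) = (\<Sum>u\<in>UNIV. if u = v then coord x u else 0)"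
    by (intro sum.cong) (auto simp: E_def axis_def)
  then show ?thesis by (simp add: int_form_coord)
qed

lemma coord_E: "coord (E v) u = (if u = v then of_int (wt v) else if adj u v then - 1 else 0)"
proof -
  have nth: "E v $ w = (if w = v then 1 else 0)" for w by (simp add: E_def axis_def)
  have "(\<Sum>w\<in>nbrs UNIV u. E v $ w) = (if v \<in> nbrs UNIV u then 1 else 0)"
    unfolding nth by (rule sum.delta) simp
  then show ?thesis using adj_irrefl'[of u] by (auto simp: coord_def nth nbrs_def)
qed

lemma wt_pos: "wt v > 0"
proof -
  have "E v \<noteq> 0" by (metis E_def axis_eq_0_iff zero_neq_one)
  from neg_def[OF this] show ?thesis by (simp add: int_form_E coord_E)
qed

text \<open>
  Pair \<open>x = p - n\<close> with its negative part \<open>n\<close>. The off-diagonal entries being nonnegative,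
  \<open>(n, n)\<close> cannot be negative, so \<open>n = 0\<close>.
\<close>

lemma coord_nonneg_imp:
  assumes "\<And>v. coord x v \<ge> 0"
  shows "x $ v \<ge> 0"
proof -
  define n :: "real^'v" where "n = (\<chi> v. max 0 (- x $ v))"
  define p :: "real^'v" where "p = (\<chi> v. max 0 (x $ v))"
  have x: "x = p - n" by (simp add: vec_eq_iff n_def p_def max_def)
  have "int_form \<Gamma> x n \<le> 0"
    unfolding int_form_coord using assms by (simp add: sum_nonneg n_def)
  moreover have "int_form \<Gamma> x n = int_form \<Gamma> p n - int_form \<Gamma> n n"
    unfolding x int_form_coord coord_diff by (simp add: sum_subtractf algebra_simps)
  moreover have "int_form \<Gamma> p n \<ge> 0"
    unfolding int_form_sum by (intro sum_nonneg) (auto simp: int_matrix_nth p_def n_def max_def intro: mult_nonneg_nonpos)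
  ultimately have "\<not> int_form \<Gamma> n n < 0" by linarith
  then have "n = 0" using neg_def by blast
  then have "n $ v = 0" by simp
  then show ?thesis by (simp add: n_def max_def split: if_splits)
qed

lemma coord_inj:
  assumes "\<And>v. coord x v = coord y v"
  shows "x = y"
proof -
  have "int_form \<Gamma> (x - y) (x - y) = 0" unfolding int_form_coord coord_diff using assms by simp
  then have "x - y = 0" using neg_def[of "x - y"] by force
  then show ?thesis by simp
qed

lemma coord_surj: "\<exists>x. \<forall>v. coord x v = a v"
proof -
  let ?f = "\<lambda>x. (\<chi> v. coord x v) :: real^'v"
  have lin: "linear ?f"
    by (intro linearI) (simp_all add: vec_eq_iff coord_add coord_scaleR)
  have "inj ?f" by (intro injI coord_inj) (simp add: vec_eq_iff)
  then have "surj ?f" using linear_injective_imp_surjective[OF lin] by blast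
  then obtain x where "?f x = (\<chi> v. a v)" by (metis surjD)
  then show ?thesis by (auto simp: vec_eq_iff)
qed

text \<open>
  A common denominator of the dual lattice; the absolute value of the determinant serves, by
  Cramer's rule.
\<close>

definition denom :: int where "denom = (SOME d. d > 0 \<and> (\<forall>x. (\<forall>v. coord x v \<in> \<int>) \<longrightarrow> (\<forall>v. of_int d * x $ v \<in> \<int>)))"

lemma det_Ints:
  fixes A :: "real^'n::finite^'n"
  assumes "\<And>i j. A $ i $ j \<in> \<int>"
  shows "det A \<in> \<int>"
  unfolding det_def using assms by (intro Ints_sum Ints_mult Ints_prod) auto

lemma denom: "denom > 0" "(\<And>v. coord x v \<in> \<int>) \<Longrightarrow> of_int denom * x $ v \<in> \<int>"
proof -
  let ?A = "- int_matrix \<Gamma>"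
  have Ax: "?A *v x = (\<chi> v. coord x v)" for x
  proof -
    have "(?A *v x) $ v = - (\<Sum>u\<in>UNIV. x $ u * int_matrix \<Gamma> $ u $ v)" for v
      unfolding matrix_vector_mult_def by (simp add: sum_negf int_matrix_sym[of v] mult.commute)
    then show ?thesis by (simp add: vec_eq_iff row_sum)
  qed
  have Ints: "?A $ i $ j \<in> \<int>" for i j by (simp add: int_matrix_nth)
  have "det ?A \<noteq> 0"
  proof -
    have "inj ((*v) ?A)" by (intro injI coord_inj) (simp add: Ax vec_eq_iff)
    then show ?thesis
      using invertible_det_nz invertible_left_inverse matrix_left_invertible_injective by blast
  qed
  moreover obtain z where z: "det ?A = of_int z" using det_Ints[of ?A] Ints Ints_cases by metis
  ultimately have z0: "z \<noteq> 0" by auto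
  have "of_int \<bar>z\<bar> * x $ v \<in> \<int>" if c: "\<forall>v. coord x v \<in> \<int>" for x v
  proof -
    let ?B = "\<chi> i j. if j = v then coord x i else ?A $ i $ j"
    have "x = (\<chi> k. det (\<chi> i j. if j = k then (\<chi> v. coord x v) $ i else ?A $ i $ j) / det ?A)"
      using cramer[OF \<open>det ?A \<noteq> 0\<close>, of x "\<chi> v. coord x v"] Ax by simp
    from arg_cong[OF this, of "\<lambda>z. z $ v"] have "x $ v = det ?B / det ?A"
      by (simp cong: if_cong)
    then have "of_int z * x $ v = det ?B" using z z0 by simp
    moreover have "det ?B \<in> \<int>" using c Ints by (intro det_Ints) auto
    ultimately have "of_int z * x $ v \<in> \<int>" by simp
    then show ?thesis by (cases "z > 0") (auto simp: abs_if)
  qed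
  then have "\<exists>d>0. \<forall>x. (\<forall>v. coord x v \<in> \<int>) \<longrightarrow> (\<forall>v. of_int d * x $ v \<in> \<int>)"
    using z0 by (intro exI[of _ "\<bar>z\<bar>"]) auto
  from someI_ex[OF this] show "denom > 0" "(\<And>v. coord x v \<in> \<int>) \<Longrightarrow> of_int denom * x $ v \<in> \<int>"
    unfolding denom_def by blast+
qed

lemma dual_latt_iff: "x \<in> dual_latt \<Gamma> \<longleftrightarrow> (\<forall>v. coord x v \<in> \<int>)"
proof
  assume x: "x \<in> dual_latt \<Gamma>"
  have "E v \<in> latt" for v by (simp add: latt_def E_def axis_def)
  then have "int_form \<Gamma> x (E v) \<in> \<int>" for v using x unfolding dual_latt_def by blast
  then show "\<forall>v. coord x v \<in> \<int>" by (simp add: int_form_E)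
next
  assume c: "\<forall>v. coord x v \<in> \<int>"
  have "x $ v \<in> \<rat>" for v
  proof -
    have "of_int denom * x $ v \<in> \<rat>" using denom(2)[of x v] c Ints_subset_Rats by blast
    then have "(of_int denom * x $ v) / of_int denom \<in> \<rat>" by (intro Rats_divide) auto
    then show ?thesis using denom(1) by simp
  qed
  moreover have "int_form \<Gamma> x l \<in> \<int>" if "l \<in> latt" for l
    unfolding int_form_coord using c that by (intro Ints_minus Ints_sum Ints_mult) (auto simp: latt_def)
  ultimately show "x \<in> dual_latt \<Gamma>" by (simp add: dual_latt_def)
qed

lemma E_dual_coord: "coord (E_dual \<Gamma> u) v = (if u = v then 1 else 0)"
proof -
  obtain x where x: "\<forall>v. coord x v = (if u = v then 1 else 0)" using coord_surj[of "\<lambda>v. if u = v then 1 else 0"] by blast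
  have "E_dual \<Gamma> u = x"
    unfolding E_dual_def
  proof (rule the_equality)
    show "x \<in> dual_latt \<Gamma> \<and> (\<forall>v. int_form \<Gamma> x (E v) = (if u = v then -1 else 0))"
      using x by (auto simp: dual_latt_iff int_form_E)
  next
    fix z assume "z \<in> dual_latt \<Gamma> \<and> (\<forall>v. int_form \<Gamma> z (E v) = (if u = v then -1 else 0))"
    then have "coord z v = coord x v" for v using x by (simp add: int_form_E split: if_splits)
        (metis add.inverse_inverse)
    then show "z = x" by (rule coord_inj)
  qed
  then show ?thesis using x by simp
qed

lemma expand_E_dual: "x = (\<Sum>u\<in>UNIV. coord x u *\<^sub>R E_dual \<Gamma> u)"
proof (rule coord_inj)
  fix v
  have "coord (\<Sum>u\<in>UNIV. coord x u *\<^sub>R E_dual \<Gamma> u) v = (\<Sum>u\<in>UNIV. if u = v then coord x u else 0)"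
    unfolding coord_sum by (intro sum.cong) (auto simp: coord_scaleR E_dual_coord)
  then show "coord x v = coord (\<Sum>u\<in>UNIV. coord x u *\<^sub>R E_dual \<Gamma> u) v" by simp
qed

lemma nth_expand: "x $ v = (\<Sum>u\<in>UNIV. coord x u * E_dual \<Gamma> u $ v)"
  using arg_cong[OF expand_E_dual[of x], of "\<lambda>z. z $ v"] by simp

text \<open>
  The entries are nonnegative, and a vanishing entry would force all neighbouring entries to
  vanish and hence, by connectedness, the whole vector.
\<close>

lemma E_dual_pos: "E_dual \<Gamma> u $ v > 0"
proof -
  let ?x = "E_dual \<Gamma> u"
  have nn: "?x $ w \<ge> 0" for w by (rule coord_nonneg_imp) (simp add: E_dual_coord)
  have step: "?x $ z = 0" if "?x $ w = 0" "adj w z" for w z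
  proof -
    have "(\<Sum>z\<in>nbrs UNIV w. ?x $ z) \<le> 0"
      using E_dual_coord[of u w] that(1) by (simp add: coord_def split: if_splits)
    moreover have "(\<Sum>z\<in>nbrs UNIV w. ?x $ z) \<ge> ?x $ z"
      using that(2) nn by (intro member_le_sum) (auto simp: nbrs_def)
    ultimately show ?thesis using nn[of z] by linarith
  qed
  have "?x $ v \<noteq> 0"
  proof
    assume 0: "?x $ v = 0"
    have "?x $ w = 0" for w
      using adj_conn[of v w]
    proof (induction rule: rtranclp_induct)
      case base show ?case by (rule 0)
    next
      case (step y z) show ?case by (rule \<open>\<And>w z. \<lbrakk>?x $ w = 0; adj w z\<rbrakk> \<Longrightarrow> ?x $ z = 0\<close>) (use step in auto)
    qed
    then have "?x = 0" by (simp add: vec_eq_iff)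
    then show False using E_dual_coord[of u u] by (simp add: coord_0)
  qed
  then show ?thesis using nn[of v] by simp
qed

section \<open>Counting coefficients\<close>

definition coeff :: "('v \<Rightarrow> int) \<Rightarrow> real" where
  "coeff A = (\<Prod>u\<in>UNIV. binom_coeff inv_sq_zero (valency \<Gamma> u) (A u))"

definition lattice_count :: "'v set \<Rightarrow> ('v \<Rightarrow> int) \<Rightarrow> real" where
  "lattice_count I A = Sum_any (\<lambda>y. if \<forall>i\<in>I. y i < 0 then coeff (\<lambda>u. A u + coordZ y u) else 0)"

lemma coeff_nonzero: "coeff A \<noteq> 0 \<Longrightarrow> A u \<ge> 0"
proof (rule ccontr)
  assume "coeff A \<noteq> 0" "\<not> A u \<ge> 0"
  then have "binom_coeff inv_sq_zero (valency \<Gamma> u) (A u) = 0" by (intro binom_coeff_zero_neg) auto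
  then have "coeff A = 0" unfolding coeff_def by (intro prod_zero) auto
  with \<open>coeff A \<noteq> 0\<close> show False by simp
qed

lemma coordZ_inj: "coordZ y = coordZ z \<Longrightarrow> y = z"
proof -
  assume eq: "coordZ y = coordZ z"
  have "coord (\<chi> v. of_int (y v)) u = coord (\<chi> v. of_int (z v)) u" for u
    by (simp only: coord_of_int eq)
  then have "(\<chi> v. real_of_int (y v)) = (\<chi> v. of_int (z v))" by (rule coord_inj)
  then show "y = z" by (simp add: vec_eq_iff fun_eq_iff)
qed

text \<open>
  The exponents are nonnegative on the support, and \<open>y i < 0\<close> bounds a combination of them with
  positive coefficients, the entries \<open>E_dual u $ i\<close>.
\<close>

lemma finite_coeff_support:
  "finite {y. y i < 0 \<and> coeff (\<lambda>u. A u + coordZ y u) \<noteq> 0}"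
proof -
  define C where "C = (\<Sum>u\<in>UNIV. of_int (A u) * E_dual \<Gamma> u $ i)"
  let ?S = "{y. y i < 0 \<and> coeff (\<lambda>u. A u + coordZ y u) \<noteq> 0}"
  have "coordZ ` ?S \<subseteq> (\<Pi> u\<in>UNIV. {- A u .. \<lceil>C / E_dual \<Gamma> u $ i\<rceil> - A u})"
  proof (clarsimp)
    fix y u assume y: "y i < 0" "coeff (\<lambda>u. A u + coordZ y u) \<noteq> 0"
    have nn: "A w + coordZ y w \<ge> 0" for w using coeff_nonzero[OF y(2), of w] .
    let ?f = "\<lambda>w. of_int (A w + coordZ y w) * E_dual \<Gamma> w $ i"
    have "(\<Sum>w\<in>UNIV. ?f w) = C + of_int (y i)"
      using nth_expand[of "\<chi> v. of_int (y v)" i]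
      by (simp add: C_def coord_of_int distrib_right sum.distrib)
    moreover have "?f u \<le> (\<Sum>w\<in>UNIV. ?f w)"
    proof (rule member_le_sum)
      fix w show "0 \<le> ?f w" using nn[of w] E_dual_pos[of w i]
        by (intro mult_nonneg_nonneg) (simp_all only: of_int_0_le_iff less_imp_le)
    qed auto
    ultimately have "?f u \<le> C" using y(1) by linarith
    then have "of_int (A u + coordZ y u) \<le> C / E_dual \<Gamma> u $ i" using E_dual_pos[of u i] by (simp add: field_simps)
    then show "- A u \<le> coordZ y u \<and> coordZ y u \<le> \<lceil>C / E_dual \<Gamma> u $ i\<rceil> - A u"
      using nn[of u] by linarith
  qed
  moreover have "finite (\<Pi>\<^sub>E u\<in>UNIV. {- A u .. \<lceil>C / E_dual \<Gamma> u $ i\<rceil> - A u})"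
    by (intro finite_PiE) auto
  ultimately have "finite (coordZ ` ?S)" by (simp add: PiE_UNIV_domain finite_subset)
  then show ?thesis by (rule finite_imageD) (auto intro: inj_onI coordZ_inj)
qed

lemma lattice_count_finite:
  assumes "I \<noteq> {}"
  shows "finite {y. (if \<forall>i\<in>I. y i < 0 then coeff (\<lambda>u. A u + coordZ y u) else 0) \<noteq> 0}"
proof -
  obtain i where "i \<in> I" using assms by blast
  then have "{y. (if \<forall>i\<in>I. y i < 0 then coeff (\<lambda>u. A u + coordZ y u) else 0) \<noteq> 0}
      \<subseteq> {y. y i < 0 \<and> coeff (\<lambda>u. A u + coordZ y u) \<noteq> 0}" by auto
  then show ?thesis using finite_coeff_support by (rule finite_subset)
qed

text \<open>
  The vector \<open>wt u - 2\<close> consists of the dual coordinates of \<open>Z_K\<close>. The second count is the dual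
  one after the substitution \<open>y \<mapsto> - y - 1\<close>, which exchanges the expansions at zero and infinity; the
  signs \<open>(-1)^val\<close> cancel because the valencies have an even sum.
\<close>

theorem lattice_count_reciprocity:
  assumes "I \<noteq> {}"
  shows "\<exists>p D. quasi_poly p \<and> (\<forall>A. (\<forall>u. A u \<ge> D) \<longrightarrow> lattice_count I A = p A) \<and>
      (\<forall>A. (\<forall>u. A u \<le> 0) \<longrightarrow> lattice_count I (\<lambda>u. wt u - 2 - A u) = p A)"
proof -
  obtain r where rI: "r \<in> I" using assms by blast
  have tr: "tree_on adj r UNIV" by (rule is_tree_tree_on[OF tree])
  \<comment> \<open>\<open>h\<close> is the positive vector all of whose dual coordinates are 1.\<close>
  obtain hv where hv: "\<forall>v. coord hv v = 1" using coord_surj[of "\<lambda>_. 1"] by blast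
  define h where "h = (\<lambda>v. hv $ v)"
  define \<epsilon> where "\<epsilon> = Min (range (\<lambda>v. 1 / h v))"
  have h_pos: "h v > 0" for v
    unfolding h_def nth_expand[of hv v] using E_dual_pos hv by (simp add: sum_pos)
  have \<epsilon>: "\<epsilon> > 0" "\<And>v. \<epsilon> \<le> 1 / h v"
    unfolding \<epsilon>_def using h_pos by (auto simp: Min_gr_iff)
  interpret S: slope_graph adj h \<epsilon> I
    by unfold_locales (auto simp: h_pos \<epsilon>)
  have slope_wt: "S.slope UNIV u \<le> of_int (wt u)" for u
  proof -
    have "of_int (wt u) * h u = 1 + (\<Sum>w\<in>nbrs UNIV u. h w)"
      using hv by (simp add: coord_def h_def algebra_simps)
    then have "of_int (wt u) = 1 / h u + (\<Sum>w\<in>nbrs UNIV u. h w) / h u"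
      using h_pos[of u] by (simp add: field_simps)
    then show ?thesis using \<epsilon>(2)[of u] by (simp add: S.slope_def)
  qed
  define \<kappa> where "\<kappa> = (\<lambda>(A :: 'v \<Rightarrow> int) u t. point (A u + wt u * t))"
  \<comment> \<open>Any upper bound of all slopes would do; the sum is convenient.\<close>
  define D where "D = (\<Sum>u\<in>UNIV. S.slope UNIV u)"
  have D: "D \<ge> S.slope UNIV u" for u
    unfolding D_def using S.slope_pos by (intro member_le_sum) (auto intro: less_imp_le)
  have D0: "D \<ge> 0" unfolding D_def using S.slope_pos by (intro sum_nonneg) (auto intro: less_imp_le)
  have le: "S.slope UNIV u * of_int t \<le> of_int (wt u * t)" if "t \<ge> 0" for u t
    using slope_wt[of u] that by (simp add: mult_right_mono)
  have ge: "of_int (wt u * t) \<le> S.slope UNIV u * of_int t" if "t \<le> 0" for u t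
    using slope_wt[of u] that by (simp add: mult_right_mono_neg)
  have bound: "slope_bound (S.slope UNIV u) L M (\<kappa> A u)" if "- L \<le> of_int (A u)" "of_int (A u) \<le> M" for u A L M
    unfolding slope_bound_def
  proof (intro conjI allI impI ballI)
    fix t :: int and a assume t: "0 \<le> t" and "a \<in> supp (\<kappa> A u t)"
    then have "a = A u + wt u * t" by (simp add: \<kappa>_def)
    then show "S.slope UNIV u * of_int t - L \<le> of_int a" using le[OF t, of u] that(1) by simp
  next
    fix t :: int and a assume t: "t \<le> 0" and "a \<in> supp (\<kappa> A u t)"
    then have "a = A u + wt u * t" by (simp add: \<kappa>_def)
    then show "of_int a \<le> S.slope UNIV u * of_int t + M" using ge[OF t, of u] that(2) by simp
  qed
  have mass1: "mass (\<kappa> A u t) = 1" for A u t by (simp add: \<kappa>_def)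
  have state: "S.bounded_state UNIV (\<lambda>_. 1) L M (\<kappa> A)"
    if "\<And>u. - L u \<le> of_int (A u)" "\<And>u. of_int (A u) \<le> M u" "\<And>u. M u \<ge> 0" for A L M
    unfolding S.bounded_state_def using that bound mass1 by blast
  have span: "kernel_span (S.slope UNIV u) (\<lambda>A. \<kappa> A u)" for u
  proof (rule kernel_span.base)
    have 1: "\<kappa> A u (t + 1) = point (wt u) * \<kappa> A u t" for A t
      by (simp add: \<kappa>_def mult_single algebra_simps)
    have 2: "\<kappa> (\<lambda>u. A u + 1 * n u) u t
        = point (\<Sum>w\<in>UNIV. n w * (if w = u then 1 else 0)) * \<kappa> A u t" for A n t
    proof -
      have "(\<Sum>w\<in>UNIV. n w * (if w = u then 1 else 0)) = (\<Sum>w\<in>UNIV. if w = u then n w else 0)"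
        by (intro sum.cong) auto
      then show ?thesis by (simp add: \<kappa>_def mult_single algebra_simps)
    qed
    have "\<exists>N>0. \<exists>B s. S.slope UNIV u * of_int N \<le> of_int B \<and>
      (\<forall>A t. \<kappa> A u (t + N) = point B * \<kappa> A u t) \<and>
      (\<forall>A n t. \<kappa> (\<lambda>u. A u + N * n u) u t = point (\<Sum>w\<in>UNIV. n w * s w) * \<kappa> A u t)"
      by (rule exI[of _ 1], rule conjI, simp, rule exI[of _ "wt u"],
          rule exI[of _ "\<lambda>w. if w = u then 1 else 0"], intro conjI allI, use slope_wt in simp, rule 1, rule 2)
    moreover have "\<exists>L M. M \<ge> 0 \<and> slope_bound (S.slope UNIV u) L M (\<kappa> A u)" for A
      by (rule exI[of _ "- of_int (A u)"], rule exI[of _ "max 0 (of_int (A u))"]) (auto intro!: bound)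
    ultimately show "shift_kernel (S.slope UNIV u) (\<lambda>A. \<kappa> A u)"
      unfolding shift_kernel_def using mass1 by blast
  qed
  have comp: "S.compatible D (\<lambda>A. \<forall>u. of_int (A u) \<ge> D) (\<lambda>A. \<forall>u. A u \<le> 0) UNIV (\<lambda>_. 1) \<kappa> \<kappa> \<kappa>"
    unfolding S.compatible_def
  proof (intro conjI ballI allI impI span refl)
    fix A :: "'v \<Rightarrow> int" assume A: "\<forall>u. of_int (A u) \<ge> D"
    have "S.bounded_state UNIV (\<lambda>_. 1) (\<lambda>_. - D) (\<lambda>u. of_int (A u)) (\<kappa> A)"
    proof (rule state)
      fix u show "0 \<le> real_of_int (A u)" using D0 A by (meson order_trans)
    qed (use A in auto)
    then show "\<exists>M. S.bounded_state UNIV (\<lambda>_. 1) (\<lambda>_. - D) M (\<kappa> A) \<and>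
        S.bounded_state UNIV (\<lambda>_. 1) (\<lambda>_. - D) M (\<kappa> A)" by blast
  next
    fix A :: "'v \<Rightarrow> int" assume A: "\<forall>u. A u \<le> 0"
    have "S.bounded_state UNIV (\<lambda>_. 1) (\<lambda>u. - of_int (A u)) (\<lambda>_. 0) (\<kappa> A)"
      by (rule state) (use A in auto)
    then show "\<exists>L. S.bounded_state UNIV (\<lambda>_. 1) L (\<lambda>_. 0) (\<kappa> A) \<and>
        S.bounded_state UNIV (\<lambda>_. 1) L (\<lambda>_. 0) (\<kappa> A)" by blast
  qed
  have zero: "S.zero_term UNIV (\<kappa> A) y
      = (if \<forall>i\<in>I. y i < 0 then coeff (\<lambda>u. A u + coordZ y u) else 0)" for A y
  proof (cases "\<forall>i\<in>I. y i < 0")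
    case True
    then show ?thesis
      by (simp add: state_sum_term_def \<kappa>_def coeff_def S.strict_ind_def card_nbrs_UNIV coordZ_def add_diff_eq)
  next
    case False
    then obtain i where i: "i \<in> I" "\<not> y i < 0" by blast
    then have "S.strict_ind i (y i) = 0" by (simp add: S.strict_ind_def)
    then show ?thesis using False unfolding state_sum_term_def by (auto intro!: prod_zero)
  qed
  let ?A' = "\<lambda>(A :: 'v \<Rightarrow> int) u. wt u - 2 - A u"
  have inf: "S.infinity_term UNIV (\<kappa> A) y
      = (if \<forall>i\<in>I. - y i - 1 < 0 then coeff (\<lambda>u. ?A' A u + coordZ (\<lambda>v. - y v - 1) u) else 0)" for A y
  proof (cases "\<forall>i\<in>I. - y i - 1 < 0")
    case True
    have c: "coordZ (\<lambda>v. - y v - 1) u = - coordZ y u - wt u + int (valency \<Gamma> u)" for u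
      by (simp add: coordZ_def sum_subtractf sum_negf algebra_simps card_nbrs_UNIV[symmetric])
    have "(\<Prod>u\<in>UNIV. (-1::real) ^ valency \<Gamma> u) = (-1) ^ (\<Sum>u\<in>UNIV. valency \<Gamma> u)"
      by (simp add: power_sum)
    also have "\<dots> = 1"
      using even_sum_card_nbrs[OF tr] by (simp add: card_nbrs_UNIV)
    finally have sign: "(\<Prod>u\<in>UNIV. (-1::real) ^ valency \<Gamma> u) = 1" .
    have "S.infinity_term UNIV (\<kappa> A) y
        = (\<Prod>u\<in>UNIV. binom_coeff inv_sq_infinity (valency \<Gamma> u) (A u + coordZ y u))"
      using True unfolding state_sum_term_def
      by (intro trans[OF if_P] prod.cong)
         (force simp: \<kappa>_def S.weak_ind_def card_nbrs_UNIV coordZ_def add_diff_eq)+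
    also have "\<dots> = (\<Prod>u\<in>UNIV. (-1) ^ valency \<Gamma> u) *
        (\<Prod>u\<in>UNIV. binom_coeff inv_sq_zero (valency \<Gamma> u) (?A' A u + coordZ (\<lambda>v. - y v - 1) u))"
      unfolding prod.distrib[symmetric] binom_coeff_infinity_reflect c
      by (intro prod.cong refl arg_cong2[where f = "(*)"] arg_cong2[where f = "binom_coeff inv_sq_zero"]) auto
    finally show ?thesis using True by (simp add: sign coeff_def)
  next
    case False
    then obtain i where i: "i \<in> I" "\<not> - y i - 1 < 0" by blast
    then have "S.weak_ind i (y i) = 0" by (auto simp: S.weak_ind_def)
    then have "S.infinity_term UNIV (\<kappa> A) y = 0"
      unfolding state_sum_term_def by (auto intro!: prod_zero)
    then show ?thesis using False by auto
  qed
  let ?F = "\<lambda>A y. if \<forall>i\<in>I. y i < 0 then coeff (\<lambda>u. A u + coordZ y u) else 0"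
  have bij: "bij (\<lambda>y v. - y v - (1::int))"
    by (rule o_bij[of "\<lambda>y v. - y v - 1"]) (auto simp: fun_eq_iff)
  have inf': "S.infinity_term UNIV (\<kappa> A) = ?F (?A' A) \<circ> (\<lambda>y v. - y v - 1)" for A
    by (rule ext) (simp only: inf o_def)
  have fin_inf: "finite {y. S.infinity_term UNIV (\<kappa> A) y \<noteq> 0}" for A
  proof -
    have "{y. S.infinity_term UNIV (\<kappa> A) y \<noteq> 0}
        = (\<lambda>y v. - y v - 1) -` {y. ?F (?A' A) y \<noteq> 0}" unfolding inf' by (auto simp only: o_def)
    then show ?thesis
      using finite_vimageI[OF lattice_count_finite[OF assms] bij_is_inj[OF bij]] by simp
  qed
  have sum_inf: "Sum_any (S.infinity_term UNIV (\<kappa> A)) = lattice_count I (?A' A)" for A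
    unfolding lattice_count_def using Sum_any.reindex_cong[OF bij inf'[symmetric]] by simp
  have fin_zero: "finite {y. S.zero_term UNIV (\<kappa> A) y \<noteq> 0}" for A
    unfolding zero by (rule lattice_count_finite[OF assms])
  have sum_zero: "Sum_any (S.zero_term UNIV (\<kappa> A)) = lattice_count I A" for A
    unfolding lattice_count_def zero[symmetric] by simp
  obtain p where p: "quasi_poly p"
      "\<And>A. \<forall>u. of_int (A u) \<ge> D \<Longrightarrow> lattice_count I A = p A"
      "\<And>A. \<forall>u. A u \<le> 0 \<Longrightarrow> lattice_count I (?A' A) = p A"
    using S.state_sum_reciprocity[OF tr rI D0 D comp] fin_zero fin_inf sum_zero sum_inf by auto
  have "lattice_count I A = p A" if "\<forall>u. A u \<ge> \<lceil>D\<rceil>" for A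
    using that by (intro p(2)) (simp add: ceiling_le_iff)
  then show ?thesis using p(1,3) by blast
qed

end

section \<open>Uniqueness of expansions at the origin\<close>

lemma monomial_exp:
  assumes "\<And>v. t $ v > 0"
  shows "monomial l t = exp (\<Sum>v\<in>UNIV. l $ v * ln (t $ v))"
  unfolding monomial_def using assms
  by (simp add: exp_sum powr_def order_less_imp_not_eq2[OF assms])

lemma monomial_pos: "(\<And>v. t $ v > 0) \<Longrightarrow> monomial l t > 0"
  by (simp add: monomial_exp)

lemma monomial_add: "(\<And>v. t $ v > 0) \<Longrightarrow> monomial (l + m) t = monomial l t * monomial m t"
  by (simp add: monomial_exp exp_add[symmetric] distrib_right sum.distrib)

lemma lattice_box_finite:
  fixes T :: "(real^'v::finite) set"
  assumes d: "d > 0" and T: "\<And>l v. l \<in> T \<Longrightarrow> 0 \<le> l $ v \<and> l $ v \<le> c \<and> d * l $ v \<in> \<int>"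
  shows "finite T"
proof -
  let ?f = "\<lambda>(l :: real^'v) v. \<lfloor>d * l $ v\<rfloor>"
  have fl: "of_int \<lfloor>d * l $ v\<rfloor> = d * l $ v" if "l \<in> T" for l v
    using T[OF that, of v] by (auto elim: Ints_cases)
  have "?f ` T \<subseteq> (\<Pi>\<^sub>E v\<in>UNIV. {0..\<lceil>d * c\<rceil>})"
  proof (clarsimp simp: PiE_UNIV_domain)
    fix l v assume l: "l \<in> T"
    have "0 \<le> d * l $ v" "d * l $ v \<le> d * c" using T[OF l, of v] d by auto
    then show "0 \<le> d * l $ v \<and> \<lfloor>d * l $ v\<rfloor> \<le> \<lceil>d * c\<rceil>" by linarith
  qed
  moreover have "finite (\<Pi>\<^sub>E v\<in>(UNIV :: 'v set). {0..\<lceil>d * c\<rceil>})" by (intro finite_PiE) auto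
  ultimately have "finite (?f ` T)" by (rule finite_subset)
  moreover have "inj_on ?f T"
  proof (rule inj_onI)
    fix l m assume lm: "l \<in> T" "m \<in> T" "?f l = ?f m"
    have "d * l $ v = d * m $ v" for v
      using fl[OF lm(1), of v] fl[OF lm(2), of v] fun_cong[OF lm(3), of v] by metis
    then show "l = m" using d by (simp add: vec_eq_iff)
  qed
  ultimately show ?thesis by (rule finite_imageD)
qed

text \<open>
  Among the exponents of minimal degree choose one, \<open>l0\<close>, of maximal norm, and tilt the degree
  slightly in its direction. By the Cauchy-Schwarz inequality \<open>l0\<close> becomes the unique minimum among
  the exponents of its degree, and discreteness of the degrees protects it against the others.
\<close>

lemma leading_exponent:
  fixes S :: "(real^'v::finite) set"
  assumes d: "d > 0" and S: "\<And>l v. l \<in> S \<Longrightarrow> 0 \<le> l $ v \<and> d * l $ v \<in> \<int>" and "S \<noteq> {}"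
  obtains \<omega> l0 \<gamma> where "\<And>v. \<omega> $ v \<ge> 1 / 2" "l0 \<in> S" "\<gamma> > 0"
    "\<And>l. l \<in> S \<Longrightarrow> l \<noteq> l0 \<Longrightarrow> \<omega> \<bullet> l \<ge> \<omega> \<bullet> l0 + \<gamma>"
proof -
  define deg where "deg = (\<lambda>l :: real^'v. \<Sum>v\<in>UNIV. l $ v)"
  have deg_int: "d * deg l \<in> \<int>" if "l \<in> S" for l
    unfolding deg_def sum_distrib_left using S[OF that] by (intro Ints_sum) auto
  have deg_nn: "deg l \<ge> 0" if "l \<in> S" for l
    unfolding deg_def using S[OF that] by (intro sum_nonneg) auto
  have le_deg: "l $ v \<le> deg l" if "l \<in> S" for l v
    unfolding deg_def using S[OF that] by (intro member_le_sum) auto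
  obtain l1 where l1: "l1 \<in> S" "\<And>l. l \<in> S \<Longrightarrow> nat \<lfloor>d * deg l1\<rfloor> \<le> nat \<lfloor>d * deg l\<rfloor>"
    using ex_has_least_nat[of "\<lambda>l. l \<in> S" _ "\<lambda>l. nat \<lfloor>d * deg l\<rfloor>"] \<open>S \<noteq> {}\<close> by blast
  define c where "c = deg l1"
  have c0: "c \<ge> 0" using deg_nn l1 by (simp add: c_def)
  have c_dich: "deg l = c \<or> deg l \<ge> c + 1 / d" if l: "l \<in> S" for l
  proof -
    obtain i j where ij: "d * deg l = of_int i" "d * c = of_int j"
      using deg_int[OF l] deg_int[OF l1(1)] by (auto simp: c_def elim!: Ints_cases)
    have "d * deg l \<ge> 0" "d * c \<ge> 0" using deg_nn[OF l] c0 d by auto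
    then have "i \<ge> 0" "j \<ge> 0" using ij by auto
    then have "j \<le> i" using l1(2)[OF l] ij by (simp add: c_def)
    then consider "i = j" | "i \<ge> j + 1" by linarith
    then show ?thesis
    proof cases
      case 1 then have "d * deg l = d * c" using ij by simp
      then show ?thesis using d by simp
    next
      case 2 then have "real_of_int i \<ge> of_int j + 1" by linarith
      then have "d * deg l \<ge> d * c + 1" using ij by simp
      then show ?thesis using d by (simp add: field_simps)
    qed
  qed
  define T where "T = {l \<in> S. deg l = c}"
  have "finite T"
    using S le_deg d by (intro lattice_box_finite[of d T c]) (auto simp: T_def)
  moreover have "l1 \<in> T" using l1 by (simp add: T_def c_def)
  ultimately have "Max (norm ` T) \<in> norm ` T" "\<And>l. l \<in> T \<Longrightarrow> norm l \<le> Max (norm ` T)"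
    by (auto intro!: Max_in Max_ge)
  then obtain l0 where l0: "l0 \<in> T" "\<And>l. l \<in> T \<Longrightarrow> norm l \<le> norm l0" by (metis imageE)
  have l0S: "l0 \<in> S" and degl0: "deg l0 = c" using l0 by (auto simp: T_def)
  \<comment> \<open>The tilt is so small that all components of \<open>\<omega>\<close> stay above \<open>1 / 2\<close> and
     that a difference of \<open>1 / d\<close> in degree is at most halved.\<close>
  define \<eta> where "\<eta> = 1 / (2 * (c + 1) * (d * c + 1))"
  have dc: "d * c \<ge> 0" using d c0 by simp
  have \<eta>: "\<eta> > 0" unfolding \<eta>_def using c0 dc by (intro divide_pos_pos mult_pos_pos) auto
  define \<omega> :: "real^'v" where "\<omega> = (\<chi> v. 1 - \<eta> * l0 $ v)"
  have \<omega>l: "\<omega> \<bullet> l = deg l - \<eta> * (l0 \<bullet> l)" for l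
    by (simp add: \<omega>_def inner_vec_def deg_def left_diff_distrib sum_subtractf sum_distrib_left mult.assoc)
  have \<eta>c: "\<eta> * c * (d * c + 1) \<le> 1 / 2"
  proof -
    have "\<eta> * c * (d * c + 1) = c / (2 * (c + 1))"
    proof -
      have "d * c + 1 \<noteq> 0" using dc by linarith
      then show ?thesis unfolding \<eta>_def by simp
    qed
    also have "\<dots> \<le> 1 / 2" using c0 by (simp add: field_simps)
    finally show ?thesis .
  qed
  have \<eta>c1: "\<eta> * c \<le> 1 / 2"
  proof -
    have "\<eta> * c * 1 \<le> \<eta> * c * (d * c + 1)" using \<eta> c0 dc by (intro mult_left_mono) auto
    then show ?thesis using \<eta>c by simp
  qed
  define \<gamma> where "\<gamma> = min (\<eta> / (2 * d\<^sup>2)) (1 / (2 * d))"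
  show thesis
  proof (rule that)
    fix v
    have "\<eta> * l0 $ v \<le> \<eta> * c" using le_deg[OF l0S, of v] degl0 \<eta> by (intro mult_left_mono) auto
    then show "\<omega> $ v \<ge> 1 / 2" using \<eta>c1 by (simp add: \<omega>_def)
  next
    show "l0 \<in> S" by fact
    show "\<gamma> > 0" unfolding \<gamma>_def using \<eta> d by simp
    fix l assume l: "l \<in> S" "l \<noteq> l0"
    from c_dich[OF l(1)] show "\<omega> \<bullet> l \<ge> \<omega> \<bullet> l0 + \<gamma>"
    proof
      assume dl: "deg l = c"
      then have "norm l \<le> norm l0" using l l0(2) by (simp add: T_def)
      then have "l \<bullet> l \<le> l0 \<bullet> l0" by (simp add: dot_square_norm)
      moreover have "(l0 - l) \<bullet> (l0 - l) = l0 \<bullet> l0 + l \<bullet> l - 2 * (l0 \<bullet> l)"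
        by (simp add: inner_diff_left inner_diff_right inner_commute)
      ultimately have 1: "(l0 - l) \<bullet> (l0 - l) \<le> 2 * (l0 \<bullet> l0 - l0 \<bullet> l)"
        by (simp add: right_diff_distrib)
      obtain v where v: "l0 $ v \<noteq> l $ v" using l(2) by (metis vec_eq_iff)
      obtain i j where ij: "d * l0 $ v = of_int i" "d * l $ v = of_int j"
        using S[OF l(1), of v] S[OF l0S, of v] by (auto elim!: Ints_cases)
      have "d * l0 $ v \<noteq> d * l $ v" using v d by simp
      then have "i \<noteq> j" using ij by auto
      then have "1 \<le> \<bar>i - j\<bar>" by linarith
      then have "1 \<le> \<bar>d * (l0 $ v - l $ v)\<bar>" using ij by (simp add: right_diff_distrib)
      then have "1 \<le> (d * (l0 $ v - l $ v))\<^sup>2" using abs_le_square_iff[of 1 "d * (l0 $ v - l $ v)"] by simp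
      then have "1 \<le> d\<^sup>2 * (l0 $ v - l $ v)\<^sup>2" by (simp add: power_mult_distrib)
      moreover have "(l0 $ v - l $ v)\<^sup>2 \<le> (l0 - l) \<bullet> (l0 - l)"
        unfolding inner_vec_def power2_eq_square by (rule order_trans[OF _ member_le_sum[of v]]) auto
      ultimately have "1 / d\<^sup>2 \<le> (l0 - l) \<bullet> (l0 - l)"
        using d by (simp add: field_simps) (smt (verit, best) mult_left_mono zero_le_power2)
      then have "1 / d\<^sup>2 \<le> 2 * (l0 \<bullet> l0 - l0 \<bullet> l)" using 1 by (rule order_trans)
      from divide_right_mono[OF this, of 2] have "1 / d\<^sup>2 / 2 \<le> l0 \<bullet> l0 - l0 \<bullet> l" by simp
      then have "\<eta> * (1 / d\<^sup>2 / 2) \<le> \<eta> * (l0 \<bullet> l0 - l0 \<bullet> l)" using \<eta> by (intro mult_left_mono) auto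
      moreover have "\<gamma> \<le> \<eta> * (1 / d\<^sup>2 / 2)" unfolding \<gamma>_def by (auto simp: min_def field_simps)
      ultimately show ?thesis using dl degl0 by (simp add: \<omega>l right_diff_distrib)
    next
      assume dl: "deg l \<ge> c + 1 / d"
      have "l0 \<bullet> l \<le> (\<Sum>v\<in>UNIV. c * l $ v)"
        unfolding inner_vec_def using le_deg[OF l0S] degl0 S[OF l(1)]
        by (intro sum_mono) (auto intro: mult_right_mono)
      then have "l0 \<bullet> l \<le> c * deg l" by (simp add: deg_def sum_distrib_left)
      then have "\<eta> * (l0 \<bullet> l) \<le> \<eta> * (c * deg l)" using \<eta> by (intro mult_left_mono) auto
      then have "\<omega> \<bullet> l \<ge> deg l * (1 - \<eta> * c)" by (simp add: \<omega>l algebra_simps)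
      moreover have "deg l * (1 - \<eta> * c) \<ge> (c + 1 / d) * (1 - \<eta> * c)"
        using dl \<eta>c1 by (intro mult_right_mono) auto
      moreover have "(c + 1 / d) * (1 - \<eta> * c) \<ge> c + 1 / (2 * d)"
      proof -
        have "\<eta> * c * (c + 1 / d) = (\<eta> * c * (d * c + 1)) / d" using d by (simp add: field_simps)
        also have "\<dots> \<le> (1 / 2) / d" using \<eta>c d by (intro divide_right_mono) auto
        finally show ?thesis using d by (simp add: algebra_simps)
      qed
      moreover have "\<omega> \<bullet> l0 \<le> c" using \<eta> degl0 by (simp add: \<omega>l)
      moreover have "\<gamma> \<le> 1 / (2 * d)" by (simp add: \<gamma>_def)
      ultimately show ?thesis by linarith
    qed
  qed
qed

text \<open>
  Along the curve \<open>t\<^sub>v = s^\<omega>\<^sub>v\<close> the term of the leading exponent dominates all others as \<open>s\<close>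
  tends to \<open>0\<close>, uniformly because the exponents have a gap \<open>\<gamma>\<close>.
\<close>

lemma has_sum_zero_imp_coefficients_zero:
  fixes b :: "real^'v::finite \<Rightarrow> real"
  assumes d: "d > 0" and N: "\<And>l v. l \<in> N \<Longrightarrow> 0 \<le> l $ v \<and> d * l $ v \<in> \<int>"
    and \<epsilon>: "\<epsilon> > 0"
    and sum: "\<And>t. (\<And>v. 0 < t $ v \<and> t $ v < \<epsilon>) \<Longrightarrow> ((\<lambda>l. b l * monomial l t) has_sum 0) N"
    and l: "l \<in> N"
  shows "b l = 0"
proof (rule ccontr)
  assume "b l \<noteq> 0"
  define S where "S = {l \<in> N. b l \<noteq> 0}"
  have "S \<noteq> {}" using l \<open>b l \<noteq> 0\<close> by (auto simp: S_def)
  then obtain \<omega> :: "real^'v" and l0 \<gamma> where \<omega>: "\<And>v. \<omega> $ v \<ge> 1 / 2" and l0: "l0 \<in> S" and \<gamma>: "\<gamma> > 0"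
      and gap: "\<And>l. l \<in> S \<Longrightarrow> l \<noteq> l0 \<Longrightarrow> \<omega> \<bullet> l \<ge> \<omega> \<bullet> l0 + \<gamma>"
    using leading_exponent[OF d, of S] N unfolding S_def by (metis (no_types, lifting) mem_Collect_eq)
  define e where "e = \<omega> \<bullet> l0"
  \<comment> \<open>Since \<open>\<omega> \<ge> 1 / 2\<close>, the square root of the parameter bounds the curve.\<close>
  define s0 where "s0 = (min \<epsilon> 1 / 2)\<^sup>2"
  have s0: "0 < s0" "s0 < 1"
  proof -
    have m: "0 < min \<epsilon> 1 / 2" "min \<epsilon> 1 / 2 \<le> 1 / 2" using \<epsilon> by auto
    then have "(min \<epsilon> 1 / 2)\<^sup>2 \<le> (1 / 2)\<^sup>2" by (intro power_mono) auto
    then show "0 < s0" "s0 < 1" unfolding s0_def using m by (auto simp: power2_eq_square)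
  qed
  have root: "s0 powr (1 / 2) < \<epsilon>"
  proof -
    have "s0 powr (1 / 2) = min \<epsilon> 1 / 2" unfolding s0_def using \<epsilon> by (simp add: powr_half_sqrt)
    moreover have "min \<epsilon> 1 / 2 < \<epsilon>" using \<epsilon> by (simp add: min_def)
    ultimately show ?thesis by linarith
  qed
  define tt :: "real \<Rightarrow> real^'v" where "tt = (\<lambda>s. \<chi> v. s powr (\<omega> $ v))"
  have tt: "0 < tt s $ v \<and> tt s $ v < \<epsilon>" if "0 < s" "s \<le> s0" for s v
  proof -
    have "s powr (\<omega> $ v) \<le> s powr (1 / 2)" using that s0 \<omega>[of v] by (intro powr_mono') auto
    also have "\<dots> \<le> s0 powr (1 / 2)" using that by (intro powr_mono2) auto
    finally show ?thesis using root that by (simp add: tt_def)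
  qed
  have mon: "monomial l (tt s) = s powr (\<omega> \<bullet> l)" if "0 < s" for s l
  proof -
    have "monomial l (tt s) = (\<Prod>v\<in>UNIV. s powr (\<omega> $ v * l $ v))"
      by (simp add: monomial_def tt_def powr_powr)
    also have "\<dots> = s powr (\<Sum>v\<in>UNIV. \<omega> $ v * l $ v)" using that by (simp add: powr_sum)
    finally show ?thesis by (simp add: inner_vec_def)
  qed
  have hs: "((\<lambda>l. b l * s powr (\<omega> \<bullet> l)) has_sum 0) N" if "0 < s" "s \<le> s0" for s
    using sum[OF tt[OF that]] by (simp add: mon[OF that(1)])
  define C where "C = infsum (\<lambda>l. \<bar>b l * s0 powr (\<omega> \<bullet> l)\<bar>) (N - {l0})"
  have abs0: "(\<lambda>l. \<bar>b l * s0 powr (\<omega> \<bullet> l)\<bar>) summable_on (N - {l0})"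
  proof -
    have "(\<lambda>l. b l * s0 powr (\<omega> \<bullet> l)) summable_on N" using hs[of s0] s0 by (auto intro: has_sum_imp_summable)
    then have "(\<lambda>l. b l * s0 powr (\<omega> \<bullet> l)) summable_on (N - {l0})"
      by (rule summable_on_subset_banach) auto
    from iffD1[OF summable_on_iff_abs_summable_on_real this] show ?thesis by simp
  qed
  have C0: "C \<ge> 0" unfolding C_def by (intro infsum_nonneg) auto
  have key: "\<bar>b l0\<bar> * s powr e \<le> (s / s0) powr (e + \<gamma>) * C" if s: "0 < s" "s \<le> s0" for s
  proof -
    let ?f = "\<lambda>l. b l * s powr (\<omega> \<bullet> l)"
    have "l0 \<in> N" using l0 by (simp add: S_def)
    have "(?f has_sum (0 - ?f l0)) (N - {l0})"
      by (rule has_sum_Diff[OF hs[OF s]]) (use \<open>l0 \<in> N\<close> in \<open>auto intro!: has_sum_finiteI\<close>)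
    then have eq: "infsum ?f (N - {l0}) = - ?f l0" and sm: "?f summable_on (N - {l0})"
      by (auto simp: infsumI has_sum_imp_summable)
    have sma: "(\<lambda>l. \<bar>?f l\<bar>) summable_on (N - {l0})"
      using iffD1[OF summable_on_iff_abs_summable_on_real sm] by simp
    have "\<bar>b l0\<bar> * s powr e = \<bar>infsum ?f (N - {l0})\<bar>" by (simp add: eq e_def abs_mult)
    also have "\<dots> \<le> infsum (\<lambda>l. \<bar>?f l\<bar>) (N - {l0})"
      using norm_infsum_bound[of ?f "N - {l0}"] sma by simp
    also have "\<dots> \<le> infsum (\<lambda>l. (s / s0) powr (e + \<gamma>) * \<bar>b l * s0 powr (\<omega> \<bullet> l)\<bar>) (N - {l0})"
    proof (rule infsum_mono[OF sma summable_on_cmult_right[OF abs0]])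
      fix l assume l: "l \<in> N - {l0}"
      show "\<bar>?f l\<bar> \<le> (s / s0) powr (e + \<gamma>) * \<bar>b l * s0 powr (\<omega> \<bullet> l)\<bar>"
      proof (cases "b l = 0")
        case False
        then have "\<omega> \<bullet> l \<ge> e + \<gamma>" using gap[of l] l by (auto simp: S_def e_def)
        then have "(s / s0) powr (\<omega> \<bullet> l) \<le> (s / s0) powr (e + \<gamma>)"
          using s s0 by (intro powr_mono') auto
        moreover have "s powr (\<omega> \<bullet> l) = (s / s0) powr (\<omega> \<bullet> l) * s0 powr (\<omega> \<bullet> l)"
          using s s0 by (simp add: powr_divide)
        ultimately show ?thesis
          by (simp add: abs_mult mult_left_mono mult_right_mono mult.left_commute)
      qed simp
    qed
    also have "\<dots> = (s / s0) powr (e + \<gamma>) * C"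
      unfolding C_def by (rule infsum_cmult_right) (use abs0 in auto)
    finally show ?thesis .
  qed
  define K where "K = C / s0 powr (e + \<gamma>)"
  have K0: "K \<ge> 0" unfolding K_def using C0 by simp
  have key2: "\<bar>b l0\<bar> \<le> K * s powr \<gamma>" if s: "0 < s" "s \<le> s0" for s
  proof -
    have "\<bar>b l0\<bar> * s powr e \<le> (K * s powr \<gamma>) * s powr e"
      using key[OF s] s s0 by (simp add: K_def powr_divide powr_add field_simps)
    then show ?thesis using s by simp
  qed
  have bl0: "\<bar>b l0\<bar> > 0" using l0 by (simp add: S_def)
  define q where "q = \<bar>b l0\<bar> / (2 * (K + 1))"
  have q: "q > 0" unfolding q_def using bl0 K0 by simp
  define s where "s = min s0 (q powr (1 / \<gamma>))"
  have s: "0 < s" "s \<le> s0" using s0 q by (auto simp: s_def)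
  have "s powr \<gamma> \<le> (q powr (1 / \<gamma>)) powr \<gamma>" using s \<gamma> by (intro powr_mono2) (auto simp: s_def)
  also have "\<dots> = q" using \<gamma> q by (simp add: powr_powr)
  finally have "K * s powr \<gamma> \<le> K * q" using K0 by (rule mult_left_mono)
  also have "\<dots> < \<bar>b l0\<bar>"
  proof -
    have "K * \<bar>b l0\<bar> \<ge> 0" using K0 by simp
    then have "K * \<bar>b l0\<bar> < \<bar>b l0\<bar> * (2 * (K + 1))" using bl0 by (simp add: distrib_left distrib_right mult.commute)
    then show ?thesis unfolding q_def using K0 by (simp add: field_simps)
  qed
  finally show False using key2[OF s] by simp
qed

section \<open>The coefficients of the zeta function\<close>

lemma has_sum_binom_coeff:
  assumes x: "0 < x" "x < (1::real)"
  shows "((\<lambda>n. binom_coeff inv_sq_zero k (int n) * x ^ n) has_sum ((1 - x) powi (int k - 2))) UNIV"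
proof (induction k)
  case 0
  have "(\<lambda>n. of_nat (Suc n) * x ^ n) sums (1 / (1 - x)^2)"
    using x by (intro geometric_deriv_sums) auto
  then have "((\<lambda>n. of_nat (Suc n) * x ^ n) has_sum (1 / (1 - x)^2)) UNIV"
    using x by (intro sums_nonneg_imp_has_sum) auto
  moreover have "(1 - x) powi (int 0 - 2) = 1 / (1 - x)^2"
    by (simp add: power_int_def field_simps)
  ultimately show ?case by (simp add: inv_sq_zero_def add.commute)
next
  case (Suc k)
  let ?f = "\<lambda>n. binom_coeff inv_sq_zero k (int n) * x ^ n"
  let ?g = "\<lambda>n. binom_coeff inv_sq_zero k (int n - 1) * x ^ n"
  let ?S = "(1 - x) powi (int k - 2)"
  have "((\<lambda>n. x * ?f n) has_sum (x * ?S)) UNIV" by (rule has_sum_cmult_right[OF Suc])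
  then have "((\<lambda>n. ?g (Suc n)) has_sum (x * ?S)) UNIV" by (simp add: mult_ac)
  then have "(?g has_sum (x * ?S)) (range Suc)"
    by (subst has_sum_reindex) (auto simp: o_def)
  moreover have "?g 0 = 0" by (simp add: binom_coeff_zero_neg)
  moreover have "(UNIV :: nat set) = insert 0 (range Suc)" by (metis UNIV_nat_eq)
  ultimately have "(?g has_sum (x * ?S)) UNIV"
    using has_sum_insert[of 0 "range Suc" ?g] by fastforce
  from has_sum_add[OF Suc has_sum_uminusI[OF this]]
  have "((\<lambda>n. ?f n + - ?g n) has_sum (?S + - (x * ?S))) UNIV" by simp
  moreover have "(1 - x) powi (int (Suc k) - 2) = ?S + - (x * ?S)"
  proof -
    have "(1 - x) powi (int (Suc k) - 2) = (1 - x) powi ((int k - 2) + 1)" by simp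
    also have "\<dots> = (1 - x) powi (int k - 2) * (1 - x)" using x by (subst power_int_add) auto
    finally show ?thesis by (simp add: algebra_simps)
  qed
  ultimately show ?case by (simp add: left_diff_distrib)
qed

context resolution
begin

definition zcoeff :: "real^'v \<Rightarrow> real" where
  "zcoeff l = (if l \<in> dual_latt \<Gamma> then coeff (\<lambda>u. \<lfloor>coord l u\<rfloor>) else 0)"

lemma zcoeff_nonzero: "zcoeff l \<noteq> 0 \<Longrightarrow> l \<in> dual_latt \<Gamma>" "zcoeff l \<noteq> 0 \<Longrightarrow> coord l u \<ge> 0" "zcoeff l \<noteq> 0 \<Longrightarrow> l $ v \<ge> 0"
proof -
  show "zcoeff l \<noteq> 0 \<Longrightarrow> l \<in> dual_latt \<Gamma>" by (auto simp: zcoeff_def split: if_splits)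
  show c: "coord l u \<ge> 0" if "zcoeff l \<noteq> 0" for u
    using that coeff_nonzero[of "\<lambda>u. \<lfloor>coord l u\<rfloor>" u] by (auto simp: zcoeff_def split: if_splits)
  show "l $ v \<ge> 0" if "zcoeff l \<noteq> 0" using coord_nonneg_imp c that by blast
qed

abbreviation exponents :: "(real^'v) set" where
  "exponents \<equiv> {l \<in> dual_latt \<Gamma>. \<forall>v. 0 \<le> l $ v}"

lemma taylor_unique:
  assumes a0: "\<And>l. l \<notin> exponents \<Longrightarrow> a l = 0" and \<epsilon>: "\<epsilon> > 0"
    and a: "\<And>t. (\<And>v. 0 < t $ v \<and> t $ v < \<epsilon>) \<Longrightarrow> ((\<lambda>l. a l * monomial l t) has_sum F t) exponents"
  shows "taylor_at_origin \<Gamma> F = a"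
  unfolding taylor_at_origin_def
proof (rule the_equality)
  show "(\<forall>l. l \<notin> exponents \<longrightarrow> a l = 0) \<and>
     (\<exists>\<epsilon>>0. \<forall>t. (\<forall>v. 0 < t $ v \<and> t $ v < \<epsilon>) \<longrightarrow> ((\<lambda>l. a l * monomial l t) has_sum F t) exponents)"
    using assms by blast
next
  fix a' assume a': "(\<forall>l. l \<notin> exponents \<longrightarrow> a' l = 0) \<and>
     (\<exists>\<epsilon>>0. \<forall>t. (\<forall>v. 0 < t $ v \<and> t $ v < \<epsilon>) \<longrightarrow> ((\<lambda>l. a' l * monomial l t) has_sum F t) exponents)"
  then obtain \<delta> where \<delta>: "\<delta> > 0"
    "\<And>t. (\<And>v. 0 < t $ v \<and> t $ v < \<delta>) \<Longrightarrow> ((\<lambda>l. a' l * monomial l t) has_sum F t) exponents" by blast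
  have "a' l - a l = 0" if l: "l \<in> exponents" for l
  proof (rule has_sum_zero_imp_coefficients_zero[where N = exponents and d = "of_int denom" and \<epsilon> = "min \<epsilon> \<delta>"])
    fix t :: "real^'v" assume t: "\<And>v. 0 < t $ v \<and> t $ v < min \<epsilon> \<delta>"
    have "((\<lambda>l. a' l * monomial l t) has_sum F t) exponents" "((\<lambda>l. a l * monomial l t) has_sum F t) exponents"
      using t by (auto intro!: a \<delta>(2))
    from has_sum_add[OF this(1) has_sum_uminusI[OF this(2)]]
    show "((\<lambda>l. (a' l - a l) * monomial l t) has_sum 0) exponents" by (simp add: left_diff_distrib)
  next
    fix l v assume "l \<in> exponents"
    then show "0 \<le> l $ v \<and> of_int denom * l $ v \<in> \<int>" using denom(2)[of l v] by (simp add: dual_latt_iff)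
  qed (use l denom(1) \<epsilon> \<delta>(1) in simp_all)
  then have "a' l = a l" for l using a0[of l] a' by (cases "l \<in> exponents") fastforce+
  then show "a' = a" by blast
qed

lemma monomial_coord:
  assumes "\<And>v. t $ v > 0"
  shows "monomial l t = (\<Prod>u\<in>UNIV. monomial (E_dual \<Gamma> u) t powr coord l u)"
proof -
  have "(\<Sum>v\<in>UNIV. l $ v * ln (t $ v)) = (\<Sum>v\<in>UNIV. \<Sum>u\<in>UNIV. coord l u * (E_dual \<Gamma> u $ v * ln (t $ v)))"
    by (simp add: nth_expand[of l] sum_distrib_right mult.assoc)
  also have "\<dots> = (\<Sum>u\<in>UNIV. coord l u * (\<Sum>v\<in>UNIV. E_dual \<Gamma> u $ v * ln (t $ v)))"
    by (subst sum.swap) (simp add: sum_distrib_left)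
  finally have eq: "(\<Sum>v\<in>UNIV. l $ v * ln (t $ v))
      = (\<Sum>u\<in>UNIV. coord l u * (\<Sum>v\<in>UNIV. E_dual \<Gamma> u $ v * ln (t $ v)))" .
  have "monomial (E_dual \<Gamma> u) t powr coord l u
      = exp (coord l u * (\<Sum>v\<in>UNIV. E_dual \<Gamma> u $ v * ln (t $ v)))" for u
    unfolding monomial_exp[OF assms] powr_def by simp
  then show ?thesis
    unfolding monomial_exp[OF assms, of l] eq by (simp add: exp_sum)
qed

text \<open>
  Multiply the binomial series of the vertices. The product of their sums is nonzero, and an
  infinite sum that does not exist is \<open>0\<close> by convention; so the computed value of the product
  series already shows that it converges.
\<close>

lemma zeta_has_sum:
  assumes t: "\<And>v. 0 < t $ v \<and> t $ v < 1"
  shows "((\<lambda>l. zcoeff l * monomial l t) has_sum zeta_fun \<Gamma> t) exponents"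
proof -
  define X where "X = (\<lambda>u. monomial (E_dual \<Gamma> u) t)"
  have tp: "\<And>v. t $ v > 0" using t by blast
  have X: "0 < X u" "X u < 1" for u
  proof -
    show "0 < X u" unfolding X_def by (rule monomial_pos[OF tp])
    have "(\<Sum>v\<in>UNIV. E_dual \<Gamma> u $ v * - ln (t $ v)) > 0"
      using t E_dual_pos by (intro sum_pos) (auto intro!: mult_pos_neg)
    then show "X u < 1" by (simp add: X_def monomial_exp[OF tp] sum_negf)
  qed
  let ?f = "\<lambda>u n. binom_coeff inv_sq_zero (valency \<Gamma> u) (int n) * X u ^ n"
  have hs: "(?f u has_sum ((1 - X u) powi (int (valency \<Gamma> u) - 2))) UNIV" for u
    by (rule has_sum_binom_coeff[OF X])
  have "(\<lambda>n. norm (?f u n)) summable_on UNIV" for u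
    by (rule iffD1[OF summable_on_iff_abs_summable_on_real has_sum_imp_summable[OF hs]])
  then have "infsum (\<lambda>g. \<Prod>u\<in>UNIV. ?f u (g u)) (PiE UNIV (\<lambda>_. UNIV)) = (\<Prod>u\<in>UNIV. infsum (?f u) UNIV)"
    by (intro infsum_prod_PiE_abs) auto
  moreover have zX: "zeta_fun \<Gamma> t = (\<Prod>u\<in>UNIV. (1 - X u) powi (int (valency \<Gamma> u) - 2))"
    by (simp add: zeta_fun_def X_def)
  then have "(\<Prod>u\<in>UNIV. infsum (?f u) UNIV) = zeta_fun \<Gamma> t"
    by (simp add: infsumI[OF hs])
  ultimately have inf: "infsum (\<lambda>g. \<Prod>u\<in>UNIV. ?f u (g u)) UNIV = zeta_fun \<Gamma> t" by simp
  have "zeta_fun \<Gamma> t \<noteq> 0"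
  proof -
    have "1 - X u \<noteq> 0" for u using X(2)[of u] by simp
    then show ?thesis unfolding zX by (simp add: power_int_not_zero)
  qed
  then have "(\<lambda>g. \<Prod>u\<in>UNIV. ?f u (g u)) summable_on UNIV"
    using infsum_not_exists[of "\<lambda>g. \<Prod>u\<in>UNIV. ?f u (g u)" UNIV] inf by fastforce
  then have hsum: "((\<lambda>g. \<Prod>u\<in>UNIV. ?f u (g u)) has_sum zeta_fun \<Gamma> t) UNIV"
    using inf by (simp add: has_sum_iff)
  define j where "j = (\<lambda>g :: 'v \<Rightarrow> nat. \<Sum>u\<in>UNIV. of_nat (g u) *\<^sub>R E_dual \<Gamma> u)"
  have cj: "coord (j g) u = of_nat (g u)" for g u
  proof -
    have "coord (j g) u = (\<Sum>w\<in>UNIV. if w = u then of_nat (g u) else 0)"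
      unfolding j_def coord_sum by (intro sum.cong) (auto simp: coord_scaleR E_dual_coord)
    then show ?thesis by simp
  qed
  let ?N = "{l \<in> dual_latt \<Gamma>. \<forall>u. 0 \<le> coord l u}"
  have "((\<lambda>g. \<Prod>u\<in>UNIV. ?f u (g u)) has_sum zeta_fun \<Gamma> t) UNIV
      \<longleftrightarrow> ((\<lambda>l. zcoeff l * monomial l t) has_sum zeta_fun \<Gamma> t) ?N"
  proof (rule has_sum_reindex_bij_witness[where i = "\<lambda>l u. nat \<lfloor>coord l u\<rfloor>" and j = j])
    fix g show "(\<lambda>u. nat \<lfloor>coord (j g) u\<rfloor>) = g" by (simp add: cj)
    show "j g \<in> ?N" by (simp add: dual_latt_iff cj)
    show "zcoeff (j g) * monomial (j g) t = (\<Prod>u\<in>UNIV. ?f u (g u))"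
    proof -
      have "monomial (j g) t = (\<Prod>u\<in>UNIV. X u ^ g u)"
        unfolding X_def by (subst monomial_coord[OF tp]) (simp add: cj powr_realpow[OF X(1)[unfolded X_def]])
      then show ?thesis by (simp add: zcoeff_def dual_latt_iff cj coeff_def prod.distrib)
    qed
  next
    fix l assume l: "l \<in> ?N"
    show "j (\<lambda>u. nat \<lfloor>coord l u\<rfloor>) = l"
    proof (rule coord_inj)
      fix u
      obtain i where "coord l u = of_int i" using l dual_latt_iff[of l] by (metis (no_types, lifting) Ints_cases mem_Collect_eq)
      moreover have "coord l u \<ge> 0" using l by auto
      ultimately show "coord (j (\<lambda>u. nat \<lfloor>coord l u\<rfloor>)) u = coord l u" by (simp add: cj)
    qed
  qed auto
  then have "((\<lambda>l. zcoeff l * monomial l t) has_sum zeta_fun \<Gamma> t) ?N" using hsum by simp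
  moreover have "((\<lambda>l. zcoeff l * monomial l t) has_sum zeta_fun \<Gamma> t) exponents
      \<longleftrightarrow> ((\<lambda>l. zcoeff l * monomial l t) has_sum zeta_fun \<Gamma> t) ?N"
  proof (rule has_sum_cong_neutral)
    fix l assume "l \<in> exponents - ?N"
    then show "zcoeff l * monomial l t = 0" using zcoeff_nonzero(2)[of l] by fastforce
  next
    fix l assume "l \<in> ?N - exponents"
    then show "zcoeff l * monomial l t = 0" using coord_nonneg_imp[of l] by auto
  qed simp
  ultimately show ?thesis by simp
qed

theorem Z_series_eq: "Z_series \<Gamma> = zcoeff"
  unfolding Z_series_def
proof (rule taylor_unique[where \<epsilon> = 1])
  fix l assume "l \<notin> exponents" then show "zcoeff l = 0"
    using zcoeff_nonzero(1)[of l] zcoeff_nonzero(3)[of l] by blast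
qed (auto intro!: zeta_has_sum)

theorem twisted_Z_series_eq:
  assumes l0: "l0 \<in> lipman \<Gamma>"
  shows "twisted_Z_series \<Gamma> l0 = (\<lambda>l. zcoeff (l - l0))"
  unfolding twisted_Z_series_def
proof (rule taylor_unique[where \<epsilon> = 1])
  have l0d: "l0 \<in> dual_latt \<Gamma>" using l0 by (simp add: lipman_def)
  have l0c: "coord l0 u \<ge> 0" for u using l0 by (simp add: lipman_def int_form_E)
  have l0n: "l0 $ v \<ge> 0" for v using coord_nonneg_imp l0c by blast
  have dual_add: "l + m \<in> dual_latt \<Gamma>" if "l \<in> dual_latt \<Gamma>" "m \<in> dual_latt \<Gamma>" for l m
    using that by (simp add: dual_latt_iff coord_add)
  show "zcoeff (l - l0) = 0" if "l \<notin> exponents" for l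
  proof (rule ccontr)
    assume nz: "zcoeff (l - l0) \<noteq> 0"
    have "l - l0 \<in> dual_latt \<Gamma>" "\<And>v. (l - l0) $ v \<ge> 0" using zcoeff_nonzero[OF nz] by auto
    then have "l - l0 + l0 \<in> dual_latt \<Gamma>" "\<And>v. 0 \<le> (l - l0) $ v + l0 $ v"
      using l0d l0n by (blast intro: dual_add, intro add_nonneg_nonneg)
    then show False using that by simp
  qed
  show "((\<lambda>l. zcoeff (l - l0) * monomial l t) has_sum twisted_zeta_fun \<Gamma> l0 t) exponents"
    if t: "\<And>v. 0 < t $ v \<and> t $ v < 1" for t
  proof -
    have tp: "\<And>v. t $ v > 0" using t by blast
    have "((\<lambda>l. monomial l0 t * (zcoeff l * monomial l t)) has_sum twisted_zeta_fun \<Gamma> l0 t) exponents"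
      unfolding twisted_zeta_fun_def by (rule has_sum_cmult_right[OF zeta_has_sum[OF t]])
    then have "((\<lambda>l. zcoeff (l + l0 - l0) * monomial (l + l0) t) has_sum twisted_zeta_fun \<Gamma> l0 t) exponents"
      by (simp add: monomial_add[OF tp] mult_ac)
    then have "((\<lambda>l. zcoeff (l - l0) * monomial l t) has_sum twisted_zeta_fun \<Gamma> l0 t) ((\<lambda>l. l + l0) ` exponents)"
      by (subst has_sum_reindex) (auto simp: o_def)
    moreover have "((\<lambda>l. zcoeff (l - l0) * monomial l t) has_sum twisted_zeta_fun \<Gamma> l0 t) exponents \<longleftrightarrow>
      ((\<lambda>l. zcoeff (l - l0) * monomial l t) has_sum twisted_zeta_fun \<Gamma> l0 t) ((\<lambda>l. l + l0) ` exponents)"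
    proof (rule has_sum_cong_neutral)
      fix l assume l: "l \<in> (\<lambda>l. l + l0) ` exponents - exponents"
      then show "zcoeff (l - l0) * monomial l t = 0"
        using l0d l0n by (auto intro!: dual_add add_nonneg_nonneg)
    next
      fix l assume l: "l \<in> exponents - (\<lambda>l. l + l0) ` exponents"
      have "l - l0 \<notin> exponents" using l by (metis (no_types, lifting) DiffE diff_add_cancel image_eqI)
      then have "zcoeff (l - l0) = 0" using zcoeff_nonzero[of "l - l0"] by auto
      then show "zcoeff (l - l0) * monomial l t = 0" by simp
    qed simp
    ultimately show ?thesis by simp
  qed
qed simp

end

section \<open>Additive subgroups of finite index\<close>

definition additive_subgroup :: "'a::ab_group_add set \<Rightarrow> bool" where
  "additive_subgroup A \<longleftrightarrow> 0 \<in> A \<and> (\<forall>x\<in>A. \<forall>y\<in>A. x + y \<in> A) \<and> (\<forall>x\<in>A. - x \<in> A)"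

lemma add_group_simps [simp]:
  "carrier (add_group A) = A" "x \<otimes>\<^bsub>add_group A\<^esub> y = x + y" "\<one>\<^bsub>add_group A\<^esub> = 0"
  by (simp_all add: add_group_def)

lemma add_group_comm_group: "additive_subgroup A \<Longrightarrow> comm_group (add_group A)"
  by (rule comm_groupI) (auto simp: additive_subgroup_def add_ac intro: bexI[of _ "- _"])

lemma add_group_inv:
  assumes "additive_subgroup A" "x \<in> A"
  shows "inv\<^bsub>add_group A\<^esub> x = - x"
proof -
  interpret comm_group "add_group A" by (rule add_group_comm_group) fact
  show ?thesis using assms by (intro inv_equality) (auto simp: additive_subgroup_def)
qed

lemma subgroup_add_group:
  assumes "additive_subgroup A"
  shows "subgroup M (add_group A) \<longleftrightarrow> additive_subgroup M \<and> M \<subseteq> A"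
proof
  assume "subgroup M (add_group A)"
  then interpret M: subgroup M "add_group A" .
  have sub: "M \<subseteq> A" using M.subset by simp
  have "x + y \<in> M" if "x \<in> M" "y \<in> M" for x y using M.m_closed[OF that] by simp
  moreover have "- x \<in> M" if "x \<in> M" for x
  proof -
    have "inv\<^bsub>add_group A\<^esub> x = - x" using sub that by (intro add_group_inv[OF assms]) auto
    moreover have "inv\<^bsub>add_group A\<^esub> x \<in> M" by (rule M.m_inv_closed[OF that])
    ultimately show ?thesis by (rule subst)
  qed
  ultimately show "additive_subgroup M \<and> M \<subseteq> A"
    using sub M.one_closed by (simp add: additive_subgroup_def)
next
  assume M: "additive_subgroup M \<and> M \<subseteq> A"
  show "subgroup M (add_group A)"
  proof
    fix x assume "x \<in> M"
    then show "inv\<^bsub>add_group A\<^esub> x \<in> M"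
      using M by (subst add_group_inv[OF assms]) (auto simp: additive_subgroup_def)
  qed (use M in \<open>auto simp: additive_subgroup_def\<close>)
qed

lemma r_coset_add_group: "M #>\<^bsub>add_group A\<^esub> a = (\<lambda>m. m + a) ` M"
  by (auto simp: r_coset_def)

lemma mem_coset:
  assumes "additive_subgroup M"
  shows "y \<in> M #>\<^bsub>add_group A\<^esub> a \<longleftrightarrow> y - a \<in> M"
  by (auto simp: r_coset_add_group image_iff) (metis diff_add_cancel)

lemma scaleR_nat_mem: "additive_subgroup A \<Longrightarrow> x \<in> A \<Longrightarrow> of_nat n *\<^sub>R (x::'a::real_vector) \<in> A"
  by (induction n) (auto simp: additive_subgroup_def scaleR_left_distrib)

text \<open>
  By the pigeonhole principle two multiples of \<open>x\<close> lie in the same coset.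
\<close>

lemma finite_index_multiple:
  fixes x :: "'a::real_vector"
  assumes "finite_index_sublattice M A" "additive_subgroup A" "x \<in> A"
  shows "\<exists>k>0. of_nat k *\<^sub>R x \<in> M"
proof -
  have fin: "finite (rcosets\<^bsub>add_group A\<^esub> M)" and M: "additive_subgroup M"
    using assms by (auto simp: finite_index_sublattice_def subgroup_add_group)
  let ?f = "\<lambda>n::nat. M #>\<^bsub>add_group A\<^esub> (of_nat n *\<^sub>R x)"
  have "range ?f \<subseteq> rcosets\<^bsub>add_group A\<^esub> M"
    using scaleR_nat_mem[OF assms(2,3)] by (auto simp: RCOSETS_def)
  then have "\<not> inj ?f" using fin finite_subset range_inj_infinite by blast
  then have "\<exists>i j. i < j \<and> ?f i = ?f j" unfolding inj_def by (metis nat_neq_iff)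
  then obtain i j where ij: "i < j" "?f i = ?f j" by blast
  have "of_nat j *\<^sub>R x \<in> ?f j" using M by (auto simp: mem_coset additive_subgroup_def)
  then have "of_nat j *\<^sub>R x \<in> ?f i" using ij(2) by simp
  then have "of_nat j *\<^sub>R x - of_nat i *\<^sub>R x \<in> M" by (simp add: mem_coset[OF M])
  then have "of_nat (j - i) *\<^sub>R x \<in> M" using ij(1) by (simp add: of_nat_diff scaleR_left_diff_distrib)
  then show ?thesis using ij(1) by (intro exI[of _ "j - i"]) auto
qed

text \<open>
  Two polynomials in one real variable that agree at all large integers are equal. This
  transports equalities from deep in the cone to the origin of a ray.
\<close>

lemma polynomials_agree_on_ray:
  fixes P :: "'a::real_normed_vector \<Rightarrow> real" and Q :: "'b::real_normed_vector \<Rightarrow> real"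
  assumes P: "real_polynomial_function P" and Q: "real_polynomial_function Q"
    and eq: "\<And>n::nat. n \<ge> n0 \<Longrightarrow> P (a + of_nat n *\<^sub>R y) = Q (b + of_nat n *\<^sub>R w)"
  shows "P a = Q b"
proof -
  have ray: "real_polynomial_function (\<lambda>s::real. S (c + s *\<^sub>R v))" if "real_polynomial_function S"
    for S :: "'c::real_normed_vector \<Rightarrow> real" and c v
  proof -
    have "polynomial_function (\<lambda>s::real. c + s *\<^sub>R v)"
      by (intro polynomial_function_add polynomial_function_const
          polynomial_function_bounded_linear bounded_linear_scaleR_left)
    from real_polynomial_function_compose[OF this that] show ?thesis by (simp add: o_def)
  qed
  have "real_polynomial_function (\<lambda>s::real. P (a + s *\<^sub>R y) - Q (b + s *\<^sub>R w))"
    by (intro real_polynomial_function_diff ray P Q)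
  then obtain c n where f: "(\<lambda>s::real. P (a + s *\<^sub>R y) - Q (b + s *\<^sub>R w)) = (\<lambda>s. \<Sum>i\<le>n. c i * s ^ i)"
    unfolding real_polynomial_function_iff_sum by blast
  have "real ` {n0..} \<subseteq> {s. (\<Sum>i\<le>n. c i * s ^ i) = 0}"
    using eq fun_cong[OF f] by (auto simp: image_iff) (metis cancel_comm_monoid_add_class.diff_cancel)
  moreover have "infinite (real ` {n0..})"
    by (simp add: finite_image_iff inj_on_def infinite_Ici)
  ultimately have "\<not> finite {s. (\<Sum>i\<le>n. c i * s ^ i) = 0}" using finite_subset by blast
  then have "\<forall>i\<le>n. c i = 0" using polyfun_finite_roots[of c n] by blast
  then have "P (a + 0 *\<^sub>R y) - Q (b + 0 *\<^sub>R w) = 0" using fun_cong[OF f, of 0] by simp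
  then show ?thesis by simp
qed

context resolution
begin

section \<open>The lattices of the resolution\<close>

lemma latt_additive: "additive_subgroup (latt :: (real^'v) set)"
  by (auto simp: additive_subgroup_def latt_def)

lemma dual_additive: "additive_subgroup (dual_latt \<Gamma>)"
  by (auto simp: additive_subgroup_def dual_latt_iff coord_0 coord_add coord_minus)

lemma latt_subset_dual: "latt \<subseteq> dual_latt \<Gamma>"
  by (auto simp: latt_def dual_latt_iff coord_def intro!: Ints_diff Ints_mult Ints_sum)

lemma H_class_mem: "y \<in> H_class \<Gamma> x \<longleftrightarrow> y - x \<in> latt"
  unfolding H_class_def by (rule mem_coset[OF latt_additive])

lemma H_class_eq: "H_class \<Gamma> x = H_class \<Gamma> y" if "x - y \<in> latt"
proof -
  have "u - x \<in> latt \<longleftrightarrow> u - y \<in> latt" for u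
  proof -
    have "u - y = (u - x) + (x - y)" "u - x = (u - y) + - (x - y)" by simp_all
    then show ?thesis using that latt_additive unfolding additive_subgroup_def by metis
  qed
  then show ?thesis by (auto simp: H_class_mem)
qed

lemma H_group_normal: "latt \<lhd> add_group (dual_latt \<Gamma>)"
  using comm_group.subgroup_imp_normal[OF add_group_comm_group[OF dual_additive]]
    subgroup_add_group[OF dual_additive] latt_additive latt_subset_dual by blast

lemma H_mult: "x \<in> dual_latt \<Gamma> \<Longrightarrow> y \<in> dual_latt \<Gamma> \<Longrightarrow>
    H_class \<Gamma> x \<otimes>\<^bsub>H_group \<Gamma>\<^esub> H_class \<Gamma> y = H_class \<Gamma> (x + y)"
  using normal.rcos_sum[OF H_group_normal, of x y] by (simp add: H_group_def H_class_def)

lemma H_one: "\<one>\<^bsub>H_group \<Gamma>\<^esub> = H_class \<Gamma> 0"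
  by (auto simp: H_group_def H_class_mem)

lemma H_inv:
  assumes "x \<in> dual_latt \<Gamma>"
  shows "inv\<^bsub>H_group \<Gamma>\<^esub> (H_class \<Gamma> x) = H_class \<Gamma> (- x)"
proof -
  have "inv\<^bsub>H_group \<Gamma>\<^esub> (H_class \<Gamma> x) = set_inv\<^bsub>add_group (dual_latt \<Gamma>)\<^esub> (H_class \<Gamma> x)"
    unfolding H_group_def
    by (rule normal.inv_FactGroup[OF H_group_normal])
       (use assms in \<open>auto simp: carrier_FactGroup H_class_def\<close>)
  also have "\<dots> = H_class \<Gamma> (- x)"
    using normal.rcos_inv[OF H_group_normal, of x] assms
    by (simp add: H_class_def add_group_inv[OF dual_additive])
  finally show ?thesis .
qed

lemma r_rep:
  shows "r_rep (H_class \<Gamma> x) - x \<in> latt" and "H_class \<Gamma> x = latt \<Longrightarrow> r_rep (H_class \<Gamma> x) = 0"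
proof -
  define r :: "real^'v" where "r = (\<chi> v. frac (x $ v))"
  have "r_rep (H_class \<Gamma> x) = r"
    unfolding r_rep_def
  proof (rule the_equality)
    have "r - x \<in> latt" by (simp add: latt_def r_def frac_def)
    then show "r \<in> H_class \<Gamma> x \<and> (\<forall>v. 0 \<le> r $ v \<and> r $ v < 1)"
      by (simp add: H_class_mem r_def frac_lt_1)
  next
    fix s assume s: "s \<in> H_class \<Gamma> x \<and> (\<forall>v. 0 \<le> s $ v \<and> s $ v < 1)"
    have "s $ v = frac (x $ v)" for v
    proof -
      have "s $ v - x $ v \<in> \<int>" using s by (auto simp: H_class_mem latt_def)
      then have "x $ v - s $ v \<in> \<int>" by (metis Ints_minus minus_diff_eq)
      then show ?thesis using s frac_unique_iff by metis
    qed
    then show "s = r" by (simp add: r_def vec_eq_iff)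
  qed
  then show 1: "r_rep (H_class \<Gamma> x) - x \<in> latt" by (simp add: latt_def r_def frac_def)
  assume "H_class \<Gamma> x = latt"
  then have "x \<in> latt" using H_class_mem[of x x] by (simp add: latt_def)
  then show "r_rep (H_class \<Gamma> x) = 0"
    using \<open>r_rep (H_class \<Gamma> x) = r\<close> by (simp add: r_def latt_def vec_eq_iff)
qed

lemma H_class_0: "H_class \<Gamma> 0 = latt"
  by (auto simp: H_class_mem)

lemma Z_K: "Z_K \<Gamma> \<in> dual_latt \<Gamma>" "coord (Z_K \<Gamma>) v = of_int (wt v - 2)"
proof -
  obtain x where x: "\<forall>v. coord x v = of_int (wt v - 2)" using coord_surj[of "\<lambda>v. of_int (wt v - 2)"] by blast
  have E: "int_form \<Gamma> (E v) (E v) = - of_int (wt v)" for v by (simp add: int_form_E coord_E)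
  have "Z_K \<Gamma> = x"
    unfolding Z_K_def
  proof (rule the_equality)
    show "x \<in> dual_latt \<Gamma> \<and> (\<forall>v. int_form \<Gamma> x (E v) = int_form \<Gamma> (E v) (E v) + 2)"
      using x by (simp add: dual_latt_iff E) (simp add: int_form_E)
  next
    fix y assume y: "y \<in> dual_latt \<Gamma> \<and> (\<forall>v. int_form \<Gamma> y (E v) = int_form \<Gamma> (E v) (E v) + 2)"
    have "coord y v = coord x v" for v
    proof -
      have "- coord y v = - of_int (wt v) + 2" using y by (simp add: E) (simp add: int_form_E)
      then show ?thesis using x by simp
    qed
    then show "y = x" by (rule coord_inj)
  qed
  then show "Z_K \<Gamma> \<in> dual_latt \<Gamma>" "coord (Z_K \<Gamma>) v = of_int (wt v - 2)"
    using x by (auto simp: dual_latt_iff)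
qed

lemma lipman_real_iff: "x \<in> lipman_real \<Gamma> \<longleftrightarrow> (\<forall>u. coord x u \<ge> 0)"
proof
  assume "x \<in> lipman_real \<Gamma>"
  moreover have "convex_cone hull (range (E_dual \<Gamma>)) \<subseteq> {x. \<forall>u. coord x u \<ge> 0}"
    by (rule hull_minimal) (auto simp: E_dual_coord convex_cone_iff coord_0 coord_add coord_scaleR)
  ultimately show "\<forall>u. coord x u \<ge> 0" by (auto simp: lipman_real_def)
next
  assume c: "\<forall>u. coord x u \<ge> 0"
  have "(\<Sum>u\<in>S. coord x u *\<^sub>R E_dual \<Gamma> u) \<in> lipman_real \<Gamma>" for S
    unfolding lipman_real_def
  proof (induction S rule: infinite_finite_induct)
    case (insert u S)
    have "coord x u *\<^sub>R E_dual \<Gamma> u \<in> convex_cone hull range (E_dual \<Gamma>)"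
      using c by (intro convex_cone_hull_mul hull_inc) auto
    then show ?case using insert by (simp add: convex_cone_hull_add)
  qed (auto intro: convex_cone_hull_contains_0)
  then show "x \<in> lipman_real \<Gamma>" by (metis expand_E_dual)
qed

section \<open>Counting functions of the coefficients\<close>

definition int_vec :: "('v \<Rightarrow> int) \<Rightarrow> real^'v" where "int_vec y = (\<chi> v. of_int (y v))"

definition icoord :: "real^'v \<Rightarrow> 'v \<Rightarrow> int" where "icoord x u = \<lfloor>coord x u\<rfloor>"

text \<open>
  Both counting functions select \<open>l\<close> by a condition \<open>B\<close> on the set of vertices at which
  \<open>l < x\<close>, namely containing \<open>I\<close> or meeting \<open>I\<close>. Here the sum is written in terms of
  \<open>y = l - x\<close> and of the dual coordinates \<open>A\<close> of \<open>x\<close>.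
\<close>

definition region_count :: "('v set \<Rightarrow> bool) \<Rightarrow> ('v \<Rightarrow> int) \<Rightarrow> real" where
  "region_count B A = Sum_any (\<lambda>y. if B {v. y v < 0} then coeff (\<lambda>u. A u + coordZ y u) else 0)"

definition class_count :: "('v set \<Rightarrow> bool) \<Rightarrow> (real^'v \<Rightarrow> real) \<Rightarrow> (real^'v) set \<Rightarrow> real^'v \<Rightarrow> real" where
  "class_count B a h x = (\<Sum>l | l \<in> h \<and> a l \<noteq> 0 \<and> B {v. l $ v < x $ v}. a l)"

lemma q_count_class_count: "q_count a h I x = class_count (\<lambda>S. I \<subseteq> S) a h x"
  unfolding q_count_def class_count_def prec_on_def by (intro sum.cong) auto

lemma Q_count_class_count: "Q_count a h I x = class_count (\<lambda>S. I \<inter> S \<noteq> {}) a h x"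
  unfolding Q_count_def class_count_def ge_on_def by (intro sum.cong) (auto simp: not_le)

lemma latt_int_vec: "l \<in> latt \<Longrightarrow> \<exists>y. l = int_vec y"
  unfolding latt_def int_vec_def
  by (rule exI[of _ "\<lambda>v. \<lfloor>l $ v\<rfloor>"]) (auto simp: vec_eq_iff elim!: Ints_cases)

lemma int_vec_latt: "int_vec y \<in> latt" by (simp add: latt_def int_vec_def)

lemma icoord_int_vec: "icoord (x + int_vec y) u = icoord x u + coordZ y u"
  by (simp add: icoord_def coord_add int_vec_def coord_of_int)

lemma icoord_of_int: "x \<in> dual_latt \<Gamma> \<Longrightarrow> of_int (icoord x u) = coord x u"
  by (auto simp: icoord_def dual_latt_iff elim: Ints_cases)

lemma class_count_region_count:
  assumes x: "x \<in> dual_latt \<Gamma>"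
  shows "class_count B zcoeff (H_class \<Gamma> x) x = region_count B (icoord x)"
proof -
  let ?Y = "{y. B {v. y v < 0} \<and> coeff (\<lambda>u. icoord x u + coordZ y u) \<noteq> 0}"
  have zc: "zcoeff (x + int_vec y) = coeff (\<lambda>u. icoord x u + coordZ y u)" for y
  proof -
    have "x + int_vec y \<in> dual_latt \<Gamma>"
      using x dual_additive int_vec_latt[of y] latt_subset_dual by (auto simp: additive_subgroup_def)
    then show ?thesis by (simp add: zcoeff_def icoord_def[symmetric] icoord_int_vec)
  qed
  have "class_count B zcoeff (H_class \<Gamma> x) x = (\<Sum>y\<in>?Y. coeff (\<lambda>u. icoord x u + coordZ y u))"
    unfolding class_count_def
  proof (rule sum.reindex_bij_witness[where i = "\<lambda>y. x + int_vec y" and j = "\<lambda>l v. \<lfloor>l $ v - x $ v\<rfloor>"])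
    fix l assume l: "l \<in> {l. l \<in> H_class \<Gamma> x \<and> zcoeff l \<noteq> 0 \<and> B {v. l $ v < x $ v}}"
    then obtain y where "l - x = int_vec y" using latt_int_vec by (auto simp: H_class_mem)
    then have y: "l = x + int_vec y" by (simp add: algebra_simps)
    then show "x + int_vec (\<lambda>v. \<lfloor>l $ v - x $ v\<rfloor>) = l" by (simp add: int_vec_def)
    have fl: "(\<lambda>v. \<lfloor>l $ v - x $ v\<rfloor>) = y" by (simp add: y int_vec_def)
    have "{v. l $ v < x $ v} = {v. y v < 0}" by (simp add: y int_vec_def)
    then show "(\<lambda>v. \<lfloor>l $ v - x $ v\<rfloor>) \<in> ?Y" using l zc unfolding fl by (simp add: y)
    show "coeff (\<lambda>u. icoord x u + coordZ (\<lambda>v. \<lfloor>l $ v - x $ v\<rfloor>) u) = zcoeff l"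
      unfolding fl by (simp add: y zc)
  next
    fix y assume y: "y \<in> ?Y"
    show "(\<lambda>v. \<lfloor>(x + int_vec y) $ v - x $ v\<rfloor>) = y" by (simp add: int_vec_def)
    have "{v. (x + int_vec y) $ v < x $ v} = {v. y v < 0}" by (simp add: int_vec_def)
    then show "x + int_vec y \<in> {l. l \<in> H_class \<Gamma> x \<and> zcoeff l \<noteq> 0 \<and> B {v. l $ v < x $ v}}"
      using y zc by (simp add: H_class_mem int_vec_latt)
  qed
  also have "\<dots> = region_count B (icoord x)"
    unfolding region_count_def Sum_any.expand_set by (rule sum.cong) (auto split: if_splits)
  finally show ?thesis .
qed

lemma class_count_twisted:
  "class_count B (\<lambda>l. a (l - l0)) (H_class \<Gamma> x) y = class_count B a (H_class \<Gamma> (x - l0)) (y - l0)"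
  unfolding class_count_def
  by (rule sum.reindex_bij_witness[where i = "\<lambda>l. l + l0" and j = "\<lambda>l. l - l0"])
     (auto simp: H_class_mem algebra_simps)

definition depends_on :: "'v set \<Rightarrow> ('v set \<Rightarrow> bool) \<Rightarrow> bool" where
  "depends_on I B \<longleftrightarrow> (\<forall>S T. S \<inter> I = T \<inter> I \<longrightarrow> B S = B T)"

lemma class_count_cong:
  assumes "depends_on I B" "\<And>v. v \<in> I \<Longrightarrow> x $ v = y $ v"
  shows "class_count B a h x = class_count B a h y"
proof -
  have "B {v. l $ v < x $ v} = B {v. l $ v < y $ v}" for l :: "real^'v"
  proof -
    have "{v. l $ v < x $ v} \<inter> I = {v. l $ v < y $ v} \<inter> I" using assms(2) by auto
    then show ?thesis using assms(1) unfolding depends_on_def by blast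
  qed
  then show ?thesis by (simp add: class_count_def)
qed

text \<open>
  Counting functions depend on their argument through its coordinates in \<open>I\<close> only.
\<close>

lemma region_count_invariant:
  assumes B: "depends_on I B" and w: "\<And>i. i \<in> I \<Longrightarrow> w i = 0"
  shows "region_count B (\<lambda>u. A u + coordZ w u) = region_count B A"
proof -
  have "bij (\<lambda>y v. y v - w v)" by (rule o_bij[of "\<lambda>y v. y v + w v"]) (auto simp: fun_eq_iff)
  then show ?thesis
    unfolding region_count_def
  proof (rule Sum_any.reindex_cong, intro ext, goal_cases)
    case (1 y)
    have "{v. y v - w v < 0} \<inter> I = {v. y v < 0} \<inter> I" using w by auto
    then have "B {v. y v - w v < 0} = B {v. y v < 0}" using B unfolding depends_on_def by blast
    moreover have "A u + coordZ w u + coordZ (\<lambda>v. y v - w v) u = A u + coordZ y u" for u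
      using coordZ_add[of w "\<lambda>v. y v - w v" u] by simp
    ultimately show ?case by (simp only: o_def)
  qed
qed

text \<open>
  The argument of \<open>F\<close> in the last clause belongs to \<open>Z_K - x\<close> when \<open>A\<close> belongs to \<open>x\<close>.
\<close>

definition reciprocal :: "(('v \<Rightarrow> int) \<Rightarrow> real) \<Rightarrow> (('v \<Rightarrow> int) \<Rightarrow> real) \<Rightarrow> bool" where
  "reciprocal F p \<longleftrightarrow> quasi_poly p \<and> (\<exists>D. \<forall>A. (\<forall>u. A u \<ge> D) \<longrightarrow> F A = p A) \<and>
      (\<forall>A. (\<forall>u. A u \<le> 0) \<longrightarrow> F (\<lambda>u. wt u - 2 - A u) = p A)"

lemma reciprocal_lattice_count: "I \<noteq> {} \<Longrightarrow> \<exists>p. reciprocal (region_count (\<lambda>S. I \<subseteq> S)) p"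
proof -
  assume "I \<noteq> {}"
  then obtain p D where "quasi_poly p" "\<forall>A. (\<forall>u. A u \<ge> D) \<longrightarrow> lattice_count I A = p A"
      "\<forall>A. (\<forall>u. A u \<le> 0) \<longrightarrow> lattice_count I (\<lambda>u. wt u - 2 - A u) = p A"
    using lattice_count_reciprocity[of I] by blast
  then have "reciprocal (lattice_count I) p" unfolding reciprocal_def by blast
  moreover have "region_count (\<lambda>S. I \<subseteq> S) = lattice_count I"
    by (simp add: region_count_def lattice_count_def subset_eq fun_eq_iff)
  ultimately show ?thesis by auto
qed

lemma reciprocal_add:
  assumes "reciprocal F p" "reciprocal G q"
  shows "reciprocal (\<lambda>A. F A + c * G A) (\<lambda>A. p A + c * q A)"
proof -
  obtain D where D: "\<forall>A. (\<forall>u. A u \<ge> D) \<longrightarrow> F A = p A" using assms by (auto simp: reciprocal_def)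
  obtain D' where D': "\<forall>A. (\<forall>u. A u \<ge> D') \<longrightarrow> G A = q A" using assms by (auto simp: reciprocal_def)
  have "quasi_poly (\<lambda>A. p A + c * q A)"
    using assms by (intro quasi_poly_add quasi_poly_scale) (auto simp: reciprocal_def)
  moreover have "\<forall>A. (\<forall>u. A u \<ge> max D D') \<longrightarrow> F A + c * G A = p A + c * q A"
    using D D' by simp
  moreover have "\<forall>A. (\<forall>u. A u \<le> 0) \<longrightarrow>
      F (\<lambda>u. wt u - 2 - A u) + c * G (\<lambda>u. wt u - 2 - A u) = p A + c * q A"
    using assms by (simp add: reciprocal_def)
  ultimately show ?thesis unfolding reciprocal_def by blast
qed

text \<open>
  Inclusion and exclusion one vertex at a time; the additional requirement \<open>K \<subseteq> S\<close> makes the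
  intersection term an instance of the induction hypothesis.
\<close>

lemma reciprocal_union_count:
  assumes "I \<noteq> {}"
  shows "\<exists>p. reciprocal (region_count (\<lambda>S. I \<inter> S \<noteq> {})) p"
proof -
  have fin: "finite {y. (if K \<subseteq> {v. y v < 0} \<and> J \<inter> {v. y v < 0} \<noteq> {} then coeff (\<lambda>u. A u + coordZ y u) else 0) \<noteq> 0}"
    for K J A
  proof (rule finite_subset)
    show "finite (\<Union>j\<in>J. {y. y j < 0 \<and> coeff (\<lambda>u. A u + coordZ y u) \<noteq> 0})"
      by (intro finite_UN_I finite_coeff_support) auto
  qed (auto split: if_splits)
  have "\<exists>p. reciprocal (region_count (\<lambda>S. K \<subseteq> S \<and> J \<inter> S \<noteq> {})) p" for K J
    using finite[of J]
  proof (induction J arbitrary: K rule: finite_induct)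
    case empty
    have "quasi_poly (\<lambda>A :: 'v \<Rightarrow> int. 0)"
      unfolding quasi_poly_def
      by (intro exI[of _ 1]) (auto intro!: exI[of _ "\<lambda>_. 0"] real_polynomial_function.intros(2))
    then have "reciprocal (region_count (\<lambda>S. K \<subseteq> S \<and> {} \<inter> S \<noteq> {})) (\<lambda>_. 0)"
      by (simp add: reciprocal_def region_count_def)
    then show ?case by blast
  next
    case (insert j J)
    obtain p1 where p1: "reciprocal (region_count (\<lambda>S. K \<subseteq> S \<and> J \<inter> S \<noteq> {})) p1" using insert.IH by blast
    obtain p2 where p2: "reciprocal (region_count (\<lambda>S. insert j K \<subseteq> S \<and> J \<inter> S \<noteq> {})) p2" using insert.IH by blast
    obtain p3 where p3: "reciprocal (region_count (\<lambda>S. insert j K \<subseteq> S)) p3"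
      using reciprocal_lattice_count[of "insert j K"] by blast
    have "region_count (\<lambda>S. K \<subseteq> S \<and> insert j J \<inter> S \<noteq> {}) A
        = region_count (\<lambda>S. K \<subseteq> S \<and> J \<inter> S \<noteq> {}) A
          + 1 * region_count (\<lambda>S. insert j K \<subseteq> S) A
          + (- 1) * region_count (\<lambda>S. insert j K \<subseteq> S \<and> J \<inter> S \<noteq> {}) A" for A
    proof -
      let ?c = "\<lambda>y. coeff (\<lambda>u. A u + coordZ y u)"
      let ?f = "\<lambda>B y. if B {v. y v < 0} then ?c y else 0"
      have e: "region_count (\<lambda>S. insert j K \<subseteq> S) A = region_count (\<lambda>S. insert j K \<subseteq> S \<and> {j} \<inter> S \<noteq> {}) A"
        unfolding region_count_def by (intro Sum_any.cong) auto
      have s1: "region_count (\<lambda>S. K \<subseteq> S \<and> insert j J \<inter> S \<noteq> {}) A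
            + region_count (\<lambda>S. insert j K \<subseteq> S \<and> J \<inter> S \<noteq> {}) A
          = Sum_any (\<lambda>y. ?f (\<lambda>S. K \<subseteq> S \<and> insert j J \<inter> S \<noteq> {}) y + ?f (\<lambda>S. insert j K \<subseteq> S \<and> J \<inter> S \<noteq> {}) y)"
        unfolding region_count_def by (rule Sum_any.distrib[symmetric]) (rule fin)+
      have s2: "region_count (\<lambda>S. K \<subseteq> S \<and> J \<inter> S \<noteq> {}) A
            + region_count (\<lambda>S. insert j K \<subseteq> S \<and> {j} \<inter> S \<noteq> {}) A
          = Sum_any (\<lambda>y. ?f (\<lambda>S. K \<subseteq> S \<and> J \<inter> S \<noteq> {}) y + ?f (\<lambda>S. insert j K \<subseteq> S \<and> {j} \<inter> S \<noteq> {}) y)"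
        unfolding region_count_def by (rule Sum_any.distrib[symmetric]) (rule fin)+
      have "region_count (\<lambda>S. K \<subseteq> S \<and> insert j J \<inter> S \<noteq> {}) A
            + region_count (\<lambda>S. insert j K \<subseteq> S \<and> J \<inter> S \<noteq> {}) A
          = region_count (\<lambda>S. K \<subseteq> S \<and> J \<inter> S \<noteq> {}) A
            + region_count (\<lambda>S. insert j K \<subseteq> S \<and> {j} \<inter> S \<noteq> {}) A"
        unfolding s1 s2 by (intro Sum_any.cong) auto
      then show ?thesis using e by simp
    qed
    then have "region_count (\<lambda>S. K \<subseteq> S \<and> insert j J \<inter> S \<noteq> {})
        = (\<lambda>A. region_count (\<lambda>S. K \<subseteq> S \<and> J \<inter> S \<noteq> {}) A
          + 1 * region_count (\<lambda>S. insert j K \<subseteq> S) A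
          + (- 1) * region_count (\<lambda>S. insert j K \<subseteq> S \<and> J \<inter> S \<noteq> {}) A)" by (rule ext)
    then show ?case
      using reciprocal_add[OF reciprocal_add[OF p1 p3, of 1] p2, of "-1"] by (metis (no_types))
  qed
  from this[of "{}" I] show ?thesis by simp
qed

section \<open>Quasi-polynomials on the projected lattice\<close>

abbreviation proj_latt :: "'v set \<Rightarrow> (real^'v) set" where "proj_latt I \<equiv> proj I ` latt"
abbreviation proj_cone :: "'v set \<Rightarrow> (real^'v) set" where "proj_cone I \<equiv> proj I ` lipman_real \<Gamma>"

lemma proj_nth: "proj I x $ v = (if v \<in> I then x $ v else 0)"
proof -
  have "(x $ u *\<^sub>R E u) $ v = (if u = v then x $ u else 0)" for u by (simp add: E_def axis_def)
  then have "proj I x $ v = (\<Sum>u\<in>I. if u = v then x $ u else 0)"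
    unfolding proj_def by (simp only: sum_component)
  then show ?thesis by simp
qed

lemma proj_proj [simp]: "proj I (proj I x) = proj I x"
  by (simp add: vec_eq_iff proj_nth)

lemma proj_linear: "proj I (x + y) = proj I x + proj I y" "proj I (c *\<^sub>R x) = c *\<^sub>R proj I x"
  "proj I (- x) = - proj I x" "proj I 0 = 0" "proj I (x - y) = proj I x - proj I y"
  by (simp_all add: vec_eq_iff proj_nth)

lemma proj_in_latt: "l \<in> latt \<Longrightarrow> proj I l \<in> latt"
  by (simp add: latt_def proj_nth)

lemma proj_latt_iff: "l \<in> proj_latt I \<longleftrightarrow> l \<in> latt \<and> proj I l = l"
  by (metis image_iff proj_in_latt proj_proj)

lemma proj_latt_additive: "additive_subgroup (proj_latt I)"
  unfolding additive_subgroup_def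
proof (intro conjI ballI)
  show "0 \<in> proj_latt I" by (simp only: proj_latt_iff proj_linear) (simp add: latt_def)
next
  fix x y assume "x \<in> proj_latt I" "y \<in> proj_latt I"
  then show "x + y \<in> proj_latt I"
    using latt_additive by (simp only: proj_latt_iff proj_linear additive_subgroup_def)
next
  fix x assume "x \<in> proj_latt I"
  then show "- x \<in> proj_latt I"
    using latt_additive by (simp only: proj_latt_iff proj_linear additive_subgroup_def)
qed

lemma int_vec_proj_latt: "(\<And>v. v \<notin> I \<Longrightarrow> m v = 0) \<Longrightarrow> int_vec m \<in> proj_latt I"
  unfolding proj_latt_iff using int_vec_latt[of m] by (auto simp: vec_eq_iff proj_nth int_vec_def)

lemma coset_eq:
  assumes "additive_subgroup M" "a - b \<in> M"
  shows "M #>\<^bsub>add_group A\<^esub> a = M #>\<^bsub>add_group A\<^esub> b"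
proof -
  have "u - a \<in> M \<longleftrightarrow> u - b \<in> M" for u
  proof -
    have "u - b = (u - a) + (a - b)" "u - a = (u - b) + - (a - b)" by simp_all
    then show ?thesis using assms unfolding additive_subgroup_def by metis
  qed
  then show ?thesis by (simp add: set_eq_iff mem_coset[OF assms(1)])
qed

lemma finite_index_self:
  assumes "additive_subgroup A"
  shows "finite_index_sublattice A A"
proof -
  have "rcosets\<^bsub>add_group A\<^esub> A \<subseteq> {A #>\<^bsub>add_group A\<^esub> 0}"
    using coset_eq[OF assms, of _ 0] by (auto simp: RCOSETS_def)
  then show ?thesis
    using assms by (auto simp: finite_index_sublattice_def subgroup_add_group intro: finite_subset)
qed

lemma additive_subgroup_scaleR:
  fixes A :: "'a::real_vector set"
  assumes A: "additive_subgroup A"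
  shows "additive_subgroup ((\<lambda>x. c *\<^sub>R x) ` A)"
  unfolding additive_subgroup_def
proof (intro conjI ballI)
  have "c *\<^sub>R (0 :: 'a) \<in> (\<lambda>x. c *\<^sub>R x) ` A"
    using A unfolding additive_subgroup_def by blast
  then show "0 \<in> (\<lambda>x. c *\<^sub>R x) ` A" by simp
next
  fix x y assume "x \<in> (\<lambda>x. c *\<^sub>R x) ` A" "y \<in> (\<lambda>x. c *\<^sub>R x) ` A"
  then obtain a b where "a \<in> A" "b \<in> A" "x = c *\<^sub>R a" "y = c *\<^sub>R b" by blast
  moreover from this have "a + b \<in> A" "x + y = c *\<^sub>R (a + b)"
    using A unfolding additive_subgroup_def by (simp_all add: scaleR_right_distrib)
  ultimately show "x + y \<in> (\<lambda>x. c *\<^sub>R x) ` A" by blast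
next
  fix x assume "x \<in> (\<lambda>x. c *\<^sub>R x) ` A"
  then obtain a where "a \<in> A" "x = c *\<^sub>R a" by blast
  then have "- a \<in> A" "- x = c *\<^sub>R (- a)" using A unfolding additive_subgroup_def by simp_all
  then show "- x \<in> (\<lambda>x. c *\<^sub>R x) ` A" by blast
qed

lemma finite_index_scaled:
  assumes N: "N > 0"
  shows "finite_index_sublattice ((\<lambda>x. of_int N *\<^sub>R x) ` proj_latt I) (proj_latt I)"
proof -
  let ?L = "proj_latt I"
  let ?M = "(\<lambda>x. of_int N *\<^sub>R x) ` ?L"
  have sub: "?M \<subseteq> ?L"
  proof
    fix y assume "y \<in> ?M"
    then obtain x where "x \<in> ?L" "y = of_int N *\<^sub>R x" by blast
    then show "y \<in> ?L" by (simp only: proj_latt_iff proj_linear) (simp add: latt_def)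
  qed
  have M: "additive_subgroup ?M"
    by (rule additive_subgroup_scaleR[OF proj_latt_additive])
  have "rcosets\<^bsub>add_group ?L\<^esub> ?M
      \<subseteq> (\<lambda>a. ?M #>\<^bsub>add_group ?L\<^esub> a) ` {a \<in> ?L. \<forall>v. 0 \<le> a $ v \<and> a $ v \<le> of_int N}"
  proof
    fix c assume "c \<in> rcosets\<^bsub>add_group ?L\<^esub> ?M"
    then obtain a where a: "a \<in> ?L" "c = ?M #>\<^bsub>add_group ?L\<^esub> a" by (auto simp: RCOSETS_def)
    obtain m where m: "a = int_vec m" using a(1) latt_int_vec by (auto simp: proj_latt_iff)
    have m0: "m v = 0" if "v \<notin> I" for v
    proof -
      have "a $ v = 0" using a(1) that proj_nth[of I a v] by (auto simp: proj_latt_iff)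
      then show ?thesis by (simp add: m int_vec_def)
    qed
    let ?b = "int_vec (\<lambda>v. m v mod N)"
    have b: "?b \<in> ?L"
      using m0 by (intro int_vec_proj_latt) simp
    have q: "int_vec (\<lambda>v. m v div N) \<in> ?L"
      using m0 by (intro int_vec_proj_latt) simp
    have "a - ?b = of_int N *\<^sub>R int_vec (\<lambda>v. m v div N)"
    proof -
      have "of_int (m v) - of_int (m v mod N) = real_of_int N * of_int (m v div N)" for v
        by (metis add_diff_cancel_right' mult_div_mod_eq of_int_add of_int_mult)
      then show ?thesis by (simp add: m vec_eq_iff int_vec_def)
    qed
    then have "a - ?b \<in> ?M" using q by blast
    then have "c = ?M #>\<^bsub>add_group ?L\<^esub> ?b" using a(2) coset_eq[OF M] by metis
    moreover have "0 \<le> ?b $ v \<and> ?b $ v \<le> of_int N" for v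
      using N by (simp add: int_vec_def less_imp_le)
    ultimately show "c \<in> (\<lambda>a. ?M #>\<^bsub>add_group ?L\<^esub> a) ` {a \<in> ?L. \<forall>v. 0 \<le> a $ v \<and> a $ v \<le> of_int N}"
      using b by blast
  qed
  moreover have "finite {a \<in> ?L. \<forall>v. 0 \<le> a $ v \<and> a $ v \<le> of_int N}"
    by (rule lattice_box_finite[of 1 _ "of_int N"]) (auto simp: latt_def proj_nth)
  ultimately have "finite (rcosets\<^bsub>add_group ?L\<^esub> ?M)" by (meson finite_imageI finite_subset)
  then show ?thesis
    using M sub by (simp add: finite_index_sublattice_def subgroup_add_group[OF proj_latt_additive])
qed

text \<open>
  The direction is a positive combination of all generators, so it lies in the interior of the cone
  and absorbs every translation.
\<close>

lemma ray_enters_cone: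
  assumes c: "proj I c = c" and ls: "ls \<in> proj_cone I" and m: "m > 0"
  defines "y \<equiv> proj I (m *\<^sub>R (\<Sum>u\<in>UNIV. E_dual \<Gamma> u))"
  shows "\<exists>n0. \<forall>n::nat. n \<ge> n0 \<longrightarrow> c + of_nat n *\<^sub>R y \<in> (\<lambda>k. ls + k) ` proj_cone I"
proof -
  obtain s where s: "s \<in> lipman_real \<Gamma>" "ls = proj I s" using ls by blast
  define n0 where "n0 = nat \<lceil>(\<Sum>u\<in>UNIV. \<bar>coord (c - s) u\<bar>) / m\<rceil>"
  have "c + of_nat n *\<^sub>R y \<in> (\<lambda>k. ls + k) ` proj_cone I" if n: "n \<ge> n0" for n :: nat
  proof -
    let ?w = "(c - s) + (of_nat n * m) *\<^sub>R (\<Sum>u\<in>UNIV. E_dual \<Gamma> u)"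
    have "coord ?w u \<ge> 0" for u
    proof -
      have "coord ?w u = coord (c - s) u + of_nat n * m"
        by (simp add: coord_add coord_scaleR coord_sum E_dual_coord)
      moreover have "(\<Sum>u\<in>UNIV. \<bar>coord (c - s) u\<bar>) / m \<le> of_nat n" using n unfolding n0_def by linarith
      then have "(\<Sum>u\<in>UNIV. \<bar>coord (c - s) u\<bar>) \<le> of_nat n * m" using m by (simp add: field_simps)
      moreover have "\<bar>coord (c - s) u\<bar> \<le> (\<Sum>u\<in>UNIV. \<bar>coord (c - s) u\<bar>)" by (rule member_le_sum) auto
      ultimately show ?thesis by linarith
    qed
    then have "?w \<in> lipman_real \<Gamma>" by (simp add: lipman_real_iff)
    moreover have "c + of_nat n *\<^sub>R y = ls + proj I ?w"
      by (simp add: y_def s(2) proj_linear c)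
    ultimately show ?thesis by blast
  qed
  then show ?thesis by blast
qed

text \<open>
  Some positive multiple of an interior direction lies in all sublattices involved. Along the
  ray from \<open>c\<close> in this direction both sides are polynomial and agree from some point on.
\<close>

lemma quasi_polynomial_unique:
  assumes \<Lambda>: "finite_index_sublattice \<Lambda> (proj_latt I)"
    and 1: "is_quasi_polynomial_of (proj_cone I) I h F \<Lambda> g1"
    and 2: "is_quasi_polynomial_of (proj_cone I) I h F (proj_latt I) g2"
    and c: "c \<in> \<Lambda>"
  shows "g1 c = g2 c"
proof -
  let ?L = "proj_latt I"
  have \<Lambda>a: "additive_subgroup \<Lambda>" and \<Lambda>L: "\<Lambda> \<subseteq> ?L"
    using \<Lambda> by (auto simp: finite_index_sublattice_def subgroup_add_group[OF proj_latt_additive])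
  obtain M1 where M1: "finite_index_sublattice M1 \<Lambda>"
    "\<And>c. c \<in> rcosets\<^bsub>add_group \<Lambda>\<^esub> M1 \<Longrightarrow> \<exists>p. real_polynomial_function p \<and> (\<forall>x\<in>c. g1 x = p x)"
    using 1 unfolding is_quasi_polynomial_of_def quasi_polynomial_on_def by blast
  obtain M2 where M2: "finite_index_sublattice M2 ?L"
    "\<And>c. c \<in> rcosets\<^bsub>add_group ?L\<^esub> M2 \<Longrightarrow> \<exists>p. real_polynomial_function p \<and> (\<forall>x\<in>c. g2 x = p x)"
    using 2 unfolding is_quasi_polynomial_of_def quasi_polynomial_on_def by blast
  have M1a: "additive_subgroup M1" "M1 \<subseteq> \<Lambda>"
    using M1(1) by (auto simp: finite_index_sublattice_def subgroup_add_group[OF \<Lambda>a])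
  have M2a: "additive_subgroup M2" "M2 \<subseteq> ?L"
    using M2(1) by (auto simp: finite_index_sublattice_def subgroup_add_group[OF proj_latt_additive])
  obtain ls1 where ls1: "ls1 \<in> proj_cone I"
    "\<And>l. l \<in> \<Lambda> \<Longrightarrow> l \<in> (\<lambda>k. ls1 + k) ` proj_cone I \<Longrightarrow> g1 l = F (proj I (r_rep h) + l)"
    using 1 unfolding is_quasi_polynomial_of_def by blast
  obtain ls2 where ls2: "ls2 \<in> proj_cone I"
    "\<And>l. l \<in> ?L \<Longrightarrow> l \<in> (\<lambda>k. ls2 + k) ` proj_cone I \<Longrightarrow> g2 l = F (proj I (r_rep h) + l)"
    using 2 unfolding is_quasi_polynomial_of_def by blast
  let ?s = "\<Sum>u\<in>UNIV. E_dual \<Gamma> u"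
  have "of_int denom *\<^sub>R ?s \<in> latt"
    unfolding latt_def using denom(2)[of ?s] by (simp add: coord_sum E_dual_coord)
  then have y0: "proj I (of_int denom *\<^sub>R ?s) \<in> ?L" by blast
  obtain k0 where k0: "k0 > 0" "of_nat k0 *\<^sub>R proj I (of_int denom *\<^sub>R ?s) \<in> \<Lambda>"
    using finite_index_multiple[OF \<Lambda> proj_latt_additive y0] by blast
  obtain k1 where k1: "k1 > 0" "of_nat k1 *\<^sub>R (of_nat k0 *\<^sub>R proj I (of_int denom *\<^sub>R ?s)) \<in> M1"
    using finite_index_multiple[OF M1(1) \<Lambda>a k0(2)] by blast
  obtain k2 where k2: "k2 > 0"
    "of_nat k2 *\<^sub>R (of_nat k1 *\<^sub>R (of_nat k0 *\<^sub>R proj I (of_int denom *\<^sub>R ?s))) \<in> M2"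
    using finite_index_multiple[OF M2(1) proj_latt_additive subsetD[OF \<Lambda>L subsetD[OF M1a(2) k1(2)]]] by blast
  \<comment> \<open>A multiple of the sum of the generators that lies in both sublattices.\<close>
  define m where "m = real k2 * real k1 * real k0 * of_int denom"
  define y where "y = proj I (m *\<^sub>R ?s)"
  have m: "m > 0" using k0 k1 k2 denom(1) by (simp add: m_def)
  have y_eq: "y = of_nat k2 *\<^sub>R (of_nat k1 *\<^sub>R (of_nat k0 *\<^sub>R proj I (of_int denom *\<^sub>R ?s)))"
    by (simp add: y_def m_def proj_linear mult.assoc)
  have yM: "y \<in> M1" "y \<in> M2"
    using scaleR_nat_mem[OF M1a(1) k1(2), of k2] k2(2) by (simp_all only: y_eq)
  have cL: "c \<in> ?L" using c \<Lambda>L by blast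
  then have cI: "proj I c = c" by (simp only: proj_latt_iff)
  obtain p1 where p1: "real_polynomial_function p1" "\<And>x. x \<in> M1 #>\<^bsub>add_group \<Lambda>\<^esub> c \<Longrightarrow> g1 x = p1 x"
    using M1(2)[of "M1 #>\<^bsub>add_group \<Lambda>\<^esub> c"] c by (auto simp: RCOSETS_def)
  obtain p2 where p2: "real_polynomial_function p2" "\<And>x. x \<in> M2 #>\<^bsub>add_group ?L\<^esub> c \<Longrightarrow> g2 x = p2 x"
    using M2(2)[of "M2 #>\<^bsub>add_group ?L\<^esub> c"] cL by (auto simp: RCOSETS_def)
  have on1: "g1 (c + of_nat n *\<^sub>R y) = p1 (c + of_nat n *\<^sub>R y)" for n
    by (rule p1(2)) (simp add: mem_coset[OF M1a(1)] scaleR_nat_mem[OF M1a(1) yM(1)])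
  have on2: "g2 (c + of_nat n *\<^sub>R y) = p2 (c + of_nat n *\<^sub>R y)" for n
    by (rule p2(2)) (simp add: mem_coset[OF M2a(1)] scaleR_nat_mem[OF M2a(1) yM(2)])
  obtain n1 where n1: "\<And>n. n \<ge> n1 \<Longrightarrow> c + of_nat n *\<^sub>R y \<in> (\<lambda>k. ls1 + k) ` proj_cone I"
    using ray_enters_cone[OF cI ls1(1) m] unfolding y_def by blast
  obtain n2 where n2: "\<And>n. n \<ge> n2 \<Longrightarrow> c + of_nat n *\<^sub>R y \<in> (\<lambda>k. ls2 + k) ` proj_cone I"
    using ray_enters_cone[OF cI ls2(1) m] unfolding y_def by blast
  have "p1 c = p2 c"
  proof (rule polynomials_agree_on_ray[OF p1(1) p2(1)])
    fix n :: nat assume n: "n \<ge> max n1 n2"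
    have mem: "c + of_nat n *\<^sub>R y \<in> \<Lambda>"
      using c scaleR_nat_mem[OF M1a(1) yM(1), of n] M1a(2) \<Lambda>a by (auto simp: additive_subgroup_def)
    then have "g1 (c + of_nat n *\<^sub>R y) = g2 (c + of_nat n *\<^sub>R y)"
      using ls1(2)[OF mem n1] ls2(2)[OF subsetD[OF \<Lambda>L mem] n2] n by simp
    then show "p1 (c + of_nat n *\<^sub>R y) = p2 (c + of_nat n *\<^sub>R y)" by (simp only: on1 on2)
  qed
  then show ?thesis using on1[of 0] on2[of 0] by simp
qed

section \<open>The quasi-polynomial of a counting function\<close>

text \<open>
  The two sides agree deep in the cone, where they are counts, hence along the whole ray in the
  direction of the all-one vector.
\<close>

lemma reciprocal_invariant:
  assumes B: "depends_on I B" and p: "reciprocal (region_count B) p" and w: "\<And>i. i \<in> I \<Longrightarrow> w i = 0"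
  shows "p (\<lambda>u. A u + coordZ w u) = p A"
proof -
  obtain D where D: "\<And>A. (\<And>u. A u \<ge> D) \<Longrightarrow> region_count B A = p A" using p by (auto simp: reciprocal_def)
  obtain N where N: "N > 0" "\<And>A. \<exists>P :: real^'v \<Rightarrow> real. real_polynomial_function P \<and>
      (\<forall>n. p (\<lambda>u. A u + N * n u) = P (\<chi> u. of_int (n u)))"
    using p unfolding reciprocal_def quasi_poly_def by blast
  obtain P1 :: "real^'v \<Rightarrow> real" where P1: "real_polynomial_function P1"
      "\<And>n. p (\<lambda>u. A u + N * n u) = P1 (\<chi> u. of_int (n u))" using N(2)[of A] by blast
  obtain P2 :: "real^'v \<Rightarrow> real" where P2: "real_polynomial_function P2"
      "\<And>n. p (\<lambda>u. A u + coordZ w u + N * n u) = P2 (\<chi> u. of_int (n u))"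
    using N(2)[of "\<lambda>u. A u + coordZ w u"] by blast
  define S where "S = \<bar>D\<bar> + (\<Sum>u\<in>UNIV. \<bar>A u\<bar> + \<bar>coordZ w u\<bar>)"
  have S: "\<bar>D\<bar> + (\<bar>A u\<bar> + \<bar>coordZ w u\<bar>) \<le> S" for u
    unfolding S_def by (intro add_left_mono member_le_sum) auto
  have "P1 0 = P2 0"
  proof (rule polynomials_agree_on_ray[OF P1(1) P2(1), of "nat S" 0 "\<chi> u. 1" 0 "\<chi> u. 1"])
    fix n :: nat assume "n \<ge> nat S"
    then have nS: "int n \<ge> S" by linarith
    have "N * int n \<ge> int n" using mult_right_mono[of 1 N "int n"] N(1) by simp
    then have big: "N * int n \<ge> S" using nS by linarith
    let ?A = "\<lambda>u. A u + N * int n"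
    have "p ?A = region_count B ?A" using S big by (intro D[symmetric]) (smt (verit, best))
    also have "\<dots> = region_count B (\<lambda>u. ?A u + coordZ w u)"
      by (rule region_count_invariant[OF B w, symmetric])
    also have "\<dots> = p (\<lambda>u. ?A u + coordZ w u)" using S big by (intro D) (smt (verit, best))
    finally have "p (\<lambda>u. A u + N * int n) = p (\<lambda>u. A u + coordZ w u + N * int n)"
      by (simp add: add_ac)
    moreover have "(\<chi> u. of_int (int n)) = of_nat n *\<^sub>R ((\<chi> u. 1) :: real^'v)" by (simp add: vec_eq_iff)
    ultimately show "P1 (0 + of_nat n *\<^sub>R (\<chi> u. 1)) = P2 (0 + of_nat n *\<^sub>R (\<chi> u. 1))"
      using P1(2)[of "\<lambda>_. int n"] P2(2)[of "\<lambda>_. int n"] by simp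
  qed
  moreover have "(\<chi> u. of_int 0) = (0 :: real^'v)" by (simp add: vec_eq_iff)
  ultimately show ?thesis using P1(2)[of "\<lambda>_. 0"] P2(2)[of "\<lambda>_. 0"] by simp
qed

lemma reciprocal_quasi_polynomial_on:
  assumes p: "quasi_poly p"
  shows "quasi_polynomial_on (proj_latt I) (\<lambda>l. p (icoord (r + l)))"
proof -
  let ?L = "proj_latt I"
  obtain N where N: "N > 0" "\<And>A. \<exists>P :: real^'v \<Rightarrow> real. real_polynomial_function P \<and>
      (\<forall>n. p (\<lambda>u. A u + N * n u) = P (\<chi> u. of_int (n u)))"
    using p unfolding quasi_poly_def by blast
  let ?M = "(\<lambda>x. of_int N *\<^sub>R x) ` ?L"
  have M: "additive_subgroup ?M"
    using finite_index_scaled[OF N(1), of I]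
    by (simp add: finite_index_sublattice_def subgroup_add_group[OF proj_latt_additive])
  have "\<exists>P. real_polynomial_function P \<and> (\<forall>x\<in>c. p (icoord (r + x)) = P x)"
    if "c \<in> rcosets\<^bsub>add_group ?L\<^esub> ?M" for c
  proof -
    obtain a where a: "a \<in> ?L" "c = ?M #>\<^bsub>add_group ?L\<^esub> a" using \<open>c \<in> _\<close> by (auto simp: RCOSETS_def)
    obtain P :: "real^'v \<Rightarrow> real" where P: "real_polynomial_function P"
        "\<And>n. p (\<lambda>u. icoord (r + a) u + N * n u) = P (\<chi> u. of_int (n u))" using N(2) by blast
    let ?T = "\<lambda>x :: real^'v. (\<chi> u. coord x u) :: real^'v"
    have lin: "bounded_linear ?T"
      by (intro linear_conv_bounded_linear[THEN iffD1] linearI) (simp_all add: vec_eq_iff coord_add coord_scaleR)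
    have "polynomial_function (\<lambda>x. (1 / of_int N) *\<^sub>R (?T x - ?T a))"
      by (intro polynomial_function_cmul polynomial_function_diff polynomial_function_const
          polynomial_function_bounded_linear lin)
    from real_polynomial_function_compose[OF this P(1)]
    have "real_polynomial_function (\<lambda>x. P ((1 / of_int N) *\<^sub>R (?T x - ?T a)))" by (simp add: o_def)
    moreover have "p (icoord (r + x)) = P ((1 / of_int N) *\<^sub>R (?T x - ?T a))" if x: "x \<in> c" for x
    proof -
      obtain \<mu> where \<mu>: "\<mu> \<in> ?L" "x - a = of_int N *\<^sub>R \<mu>" using x by (auto simp: a(2) mem_coset[OF M])
      obtain m where m: "\<mu> = int_vec m" using \<mu>(1) latt_int_vec by (auto simp: proj_latt_iff)
      have xa: "x = a + int_vec (\<lambda>v. N * m v)" using \<mu>(2) by (simp add: m int_vec_def vec_eq_iff algebra_simps)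
      have cN: "coordZ (\<lambda>v. N * m v) u = N * coordZ m u" for u
        by (simp add: coordZ_def sum_distrib_left right_diff_distrib mult.left_commute)
      have "icoord (r + x) = (\<lambda>u. icoord (r + a) u + N * coordZ m u)"
        using icoord_int_vec[of "r + a" "\<lambda>v. N * m v"] by (simp add: fun_eq_iff xa cN add.assoc)
      then have "p (icoord (r + x)) = P (\<chi> u. of_int (coordZ m u))" using P(2) by simp
      moreover have "coord x u - coord a u = of_int N * of_int (coordZ m u)" for u
        by (simp add: xa coord_add int_vec_def coord_of_int[of "\<lambda>v. N * m v", simplified] cN)
      then have "(1 / of_int N) *\<^sub>R (?T x - ?T a) = (\<chi> u. of_int (coordZ m u))"
        using N(1) by (simp add: vec_eq_iff)
      ultimately show ?thesis by simp
    qed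
    ultimately show ?thesis by blast
  qed
  then show ?thesis
    unfolding quasi_polynomial_on_def using finite_index_scaled[OF N(1)] by blast
qed

text \<open>
  A point of the projected lattice in the translated cone is the projection of a real point deep
  in the full cone, but in general its own dual coordinates are not large. Rounding the
  coordinates outside \<open>I\<close> gives a deep lattice point with the same projection, and neither \<open>p\<close> nor
  the count distinguishes the two.
\<close>

lemma reciprocal_deep:
  assumes B: "depends_on I B" and p: "reciprocal (region_count B) p"
  shows "\<exists>ls\<in>proj_cone I. \<forall>l\<in>proj_latt I. l \<in> (\<lambda>k. ls + k) ` proj_cone I \<longrightarrow>
           p (icoord (r + l)) = region_count B (icoord (r + l))"
proof -
  obtain D where D: "\<And>A. (\<And>u. A u \<ge> D) \<Longrightarrow> region_count B A = p A" using p by (auto simp: reciprocal_def)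
  have nonneg: "0 \<le> \<bar>real_of_int D\<bar> + of_int (wt u) + \<bar>coord r u\<bar> + 1" for u
    using wt_pos[of u] by simp
  define C where "C = (\<Sum>u\<in>UNIV. \<bar>of_int D\<bar> + of_int (wt u) + \<bar>coord r u\<bar> + 1)"
  have C: "\<bar>of_int D\<bar> + of_int (wt u) + \<bar>coord r u\<bar> + 1 \<le> C" for u
    unfolding C_def using nonneg by (intro member_le_sum) auto
  let ?s = "C *\<^sub>R (\<Sum>u\<in>UNIV. E_dual \<Gamma> u)"
  have cs: "coord ?s u = C" for u by (simp add: coord_scaleR coord_sum E_dual_coord)
  have "C \<ge> 0" unfolding C_def using nonneg by (intro sum_nonneg) auto
  then have s: "?s \<in> lipman_real \<Gamma>" by (simp only: lipman_real_iff cs) simp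
  have "p (icoord (r + l)) = region_count B (icoord (r + l))"
    if l: "l \<in> proj_latt I" and lK: "l \<in> (\<lambda>k. proj I ?s + k) ` proj_cone I" for l
  proof -
    obtain k where k: "k \<in> lipman_real \<Gamma>" "l = proj I (?s + k)" using lK by (auto simp: proj_linear)
    let ?w = "?s + k"
    obtain m0 where m0: "l = int_vec m0" using l latt_int_vec by (auto simp: proj_latt_iff)
    have w_eq: "of_int (m0 v) = ?w $ v" if "v \<in> I" for v
    proof -
      have "l $ v = ?w $ v" by (simp only: k(2) proj_nth that if_True)
      moreover have "l $ v = of_int (m0 v)" by (simp only: m0 int_vec_def vec_lambda_beta)
      ultimately show ?thesis by (simp only:)
    qed
    \<comment> \<open>A lattice vector near \<open>?w\<close> with the same coordinates on \<open>I\<close>.\<close>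
    define d where "d = (\<lambda>v. if v \<in> I then 0 else \<lfloor>?w $ v\<rfloor> - m0 v)"
    have near: "of_int (m0 v + d v) \<le> ?w $ v \<and> ?w $ v \<le> of_int (m0 v + d v) + 1" for v
      using w_eq[of v] by (cases "v \<in> I") (simp_all add: d_def)
    have "coord (l + int_vec d) u \<ge> coord ?w u - of_int (wt u)" for u
    proof -
      let ?\<delta> = "l + int_vec d - ?w"
      have \<delta>: "?\<delta> $ v \<le> 0" "?\<delta> $ v \<ge> - 1" for v
        using near[of v] by (simp_all add: m0 int_vec_def)
      have "of_int (wt u) * ?\<delta> $ u \<ge> of_int (wt u) * (- 1)"
        using \<delta>(2)[of u] wt_pos[of u] by (intro mult_left_mono) auto
      moreover have "(\<Sum>v\<in>nbrs UNIV u. ?\<delta> $ v) \<le> 0" using \<delta>(1) by (intro sum_nonpos) auto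
      ultimately have "coord ?\<delta> u \<ge> - of_int (wt u)" unfolding coord_def by linarith
      then show ?thesis unfolding coord_diff by linarith
    qed
    moreover have "coord ?w u \<ge> C" for u using k(1) by (simp add: coord_add cs lipman_real_iff)
    ultimately have "coord (r + (l + int_vec d)) u \<ge> of_int D" for u
      using C[of u] by (simp only: coord_add[of r]) (smt (verit, best))
    then have deep: "icoord (r + (l + int_vec d)) u \<ge> D" for u by (simp add: icoord_def le_floor_iff)
    have lv: "icoord (r + (l + int_vec d)) = (\<lambda>u. icoord (r + l) u + coordZ d u)"
      using icoord_int_vec[of "r + l" d] by (simp add: fun_eq_iff add.assoc)
    have d0: "\<And>i. i \<in> I \<Longrightarrow> d i = 0" by (simp add: d_def)
    have "p (icoord (r + l)) = p (icoord (r + (l + int_vec d)))"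
      unfolding lv by (rule reciprocal_invariant[OF B p d0, symmetric])
    also have "\<dots> = region_count B (icoord (r + (l + int_vec d)))" by (rule D[OF deep, symmetric])
    also have "\<dots> = region_count B (icoord (r + l))"
      unfolding lv by (rule region_count_invariant[OF B d0])
    finally show ?thesis .
  qed
  then show ?thesis using s by blast
qed

text \<open>
  The projected lattice is contained in the lattice, so \<open>p\<close> restricts to a quasi-polynomial on
  it. The base point \<open>r\<close> is the representative of the class for \<open>Z\<close>, and \<open>-l\<^sub>0\<close> for the
  twisted series.
\<close>

lemma counting_quasi_polynomial:
  assumes B: "depends_on I B" and p: "reciprocal (region_count B) p"
    and F: "\<And>l. l \<in> proj_latt I \<Longrightarrow> F (proj I (r_rep h) + l) = region_count B (icoord (r + l))"
  shows "periodic_constant_of (proj_cone I) I h F = p (icoord r)"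
    and "l \<in> latt \<Longrightarrow> quasi_polynomial_value (proj_cone I) I h F l = p (icoord (r + l))"
proof -
  let ?g = "\<lambda>l. p (icoord (r + l))"
  have g: "is_quasi_polynomial_of (proj_cone I) I h F (proj_latt I) ?g"
    unfolding is_quasi_polynomial_of_def
  proof
    show "quasi_polynomial_on (proj_latt I) ?g"
      using p by (intro reciprocal_quasi_polynomial_on) (simp add: reciprocal_def)
    show "\<exists>ls\<in>proj_cone I. \<forall>l\<in>proj_latt I. l \<in> (\<lambda>k. ls + k) ` proj_cone I \<longrightarrow> ?g l = F (proj I (r_rep h) + l)"
      using reciprocal_deep[OF B p, of r] by (simp add: F)
  qed
  have self: "finite_index_sublattice (proj_latt I) (proj_latt I)"
    by (rule finite_index_self[OF proj_latt_additive])
  show "periodic_constant_of (proj_cone I) I h F = p (icoord r)"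
    unfolding periodic_constant_of_def
  proof (rule the_equality)
    show "\<exists>\<Lambda> g. finite_index_sublattice \<Lambda> (proj_latt I) \<and>
        is_quasi_polynomial_of (proj_cone I) I h F \<Lambda> g \<and> p (icoord r) = g 0"
      using self g by (intro exI[of _ "proj_latt I"] exI[of _ ?g]) simp
  next
    fix c assume "\<exists>\<Lambda> g. finite_index_sublattice \<Lambda> (proj_latt I) \<and>
        is_quasi_polynomial_of (proj_cone I) I h F \<Lambda> g \<and> c = g 0"
    then obtain \<Lambda> g1 where 1: "finite_index_sublattice \<Lambda> (proj_latt I)"
        "is_quasi_polynomial_of (proj_cone I) I h F \<Lambda> g1" "c = g1 0" by blast
    have "0 \<in> \<Lambda>"
      using 1(1) by (simp add: finite_index_sublattice_def subgroup_add_group[OF proj_latt_additive]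
          additive_subgroup_def)
    then show "c = p (icoord r)" using quasi_polynomial_unique[OF 1(1,2) g] 1(3) by simp
  qed
  assume l: "l \<in> latt"
  have "p (icoord (r + proj I l)) = p (icoord (r + l))"
  proof -
    obtain m where m: "l - proj I l = int_vec m"
      using latt_int_vec[of "l - proj I l"] l proj_in_latt[OF l, of I] by (auto simp: latt_def)
    have "m i = 0" if "i \<in> I" for i
      using arg_cong[OF m, of "\<lambda>x. x $ i"] that by (simp add: proj_nth int_vec_def)
    then have "p (\<lambda>u. icoord (r + proj I l) u + coordZ m u) = p (icoord (r + proj I l))"
      by (rule reciprocal_invariant[OF B p])
    moreover have "icoord (r + l) = (\<lambda>u. icoord (r + proj I l) u + coordZ m u)"
      using icoord_int_vec[of "r + proj I l" m] by (simp add: fun_eq_iff m[symmetric])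
    ultimately show ?thesis by simp
  qed
  moreover have "quasi_polynomial_value (proj_cone I) I h F l = ?g (proj I l)"
    unfolding quasi_polynomial_value_def
  proof (rule the_equality)
    fix c assume "\<exists>g. is_quasi_polynomial_of (proj_cone I) I h F (proj_latt I) g \<and> c = g (proj I l)"
    then show "c = ?g (proj I l)" using quasi_polynomial_unique[OF self _ g] l by blast
  qed (use g in blast)
  ultimately show "quasi_polynomial_value (proj_cone I) I h F l = p (icoord (r + l))" by simp
qed

lemma class_count_proj:
  assumes B: "depends_on I B" and x: "x \<in> dual_latt \<Gamma>" and l: "l \<in> proj_latt I"
    and y: "\<And>v. v \<in> I \<Longrightarrow> y $ v = (x + l) $ v" and h: "h = H_class \<Gamma> x"
  shows "class_count B zcoeff h y = region_count B (icoord (x + l))"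
proof -
  have ll: "l \<in> latt" using l by (simp add: proj_latt_iff)
  then have xl: "x + l \<in> dual_latt \<Gamma>"
    using x dual_additive latt_subset_dual by (auto simp: additive_subgroup_def)
  have "class_count B zcoeff h y = class_count B zcoeff (H_class \<Gamma> (x + l)) (x + l)"
    unfolding h using H_class_eq[of x "x + l"] ll latt_additive class_count_cong[OF B y]
    by (simp add: additive_subgroup_def)
  then show ?thesis using class_count_region_count[OF xl] by simp
qed

text \<open>
  All three numbers equal \<open>p\<close> at the dual coordinates of \<open>-l\<^sub>0\<close>, which are nonpositive because
  \<open>l\<^sub>0\<close> lies in the Lipman cone.
\<close>

theorem periodic_constant_reciprocity:
  assumes B: "depends_on I B" and p: "reciprocal (region_count B) p" and l0: "l0 \<in> lipman \<Gamma>"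
  defines "h \<equiv> H_class \<Gamma> (- l0)"
  shows "periodic_constant_of (proj_cone I) I latt (class_count B (twisted_Z_series \<Gamma> l0) latt)
       = class_count B (Z_series \<Gamma>) (H_class \<Gamma> (Z_K \<Gamma> + l0)) (Z_K \<Gamma> + l0)"
    and "quasi_polynomial_value (proj_cone I) I h (class_count B (Z_series \<Gamma>) h) (- (l0 + r_rep h))
       = class_count B (Z_series \<Gamma>) (H_class \<Gamma> (Z_K \<Gamma> + l0)) (Z_K \<Gamma> + l0)"
proof -
  have l0d: "l0 \<in> dual_latt \<Gamma>" using l0 by (simp add: lipman_def)
  have l0c: "coord l0 u \<ge> 0" for u using l0 by (simp add: lipman_def int_form_E)
  have md: "- l0 \<in> dual_latt \<Gamma>" using l0d dual_additive by (simp add: additive_subgroup_def)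
  have Zd: "Z_K \<Gamma> + l0 \<in> dual_latt \<Gamma>" using Z_K(1) l0d dual_additive by (simp add: additive_subgroup_def)
  have neg: "icoord (- l0) u \<le> 0" for u using l0c[of u] by (simp add: icoord_def coord_minus floor_le_iff)
  have "icoord (Z_K \<Gamma> + l0) u = wt u - 2 - icoord (- l0) u" for u
  proof -
    have "real_of_int (icoord (Z_K \<Gamma> + l0) u) = of_int (wt u - 2 - icoord (- l0) u)"
      using icoord_of_int[OF Zd, of u] icoord_of_int[OF md, of u] by (simp add: coord_add coord_minus Z_K(2))
    then show ?thesis by linarith
  qed
  then have "region_count B (icoord (Z_K \<Gamma> + l0)) = p (icoord (- l0))"
    using p neg unfolding reciprocal_def by (metis (no_types, lifting) ext)
  then have val: "class_count B (Z_series \<Gamma>) (H_class \<Gamma> (Z_K \<Gamma> + l0)) (Z_K \<Gamma> + l0) = p (icoord (- l0))"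
    by (simp add: Z_series_eq class_count_region_count[OF Zd])
  have "periodic_constant_of (proj_cone I) I latt (class_count B (twisted_Z_series \<Gamma> l0) latt) = p (icoord (- l0))"
  proof (rule counting_quasi_polynomial(1)[OF B p])
    fix l assume l: "l \<in> proj_latt I"
    have r0: "r_rep latt = (0 :: real^'v)" using r_rep(2)[of 0] H_class_0 by simp
    have "class_count B (twisted_Z_series \<Gamma> l0) latt (proj I (r_rep latt) + l)
        = class_count B zcoeff (H_class \<Gamma> (- l0)) (- l0 + l)"
      using class_count_twisted[of B zcoeff l0 0 l]
      by (simp add: r0 proj_linear twisted_Z_series_eq[OF l0] H_class_0)
    also have "\<dots> = region_count B (icoord (- l0 + l))"
      by (rule class_count_proj[OF B md l]) simp_all
    finally show "class_count B (twisted_Z_series \<Gamma> l0) latt (proj I (r_rep latt) + l)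
        = region_count B (icoord (- l0 + l))" .
  qed
  then show "periodic_constant_of (proj_cone I) I latt (class_count B (twisted_Z_series \<Gamma> l0) latt)
       = class_count B (Z_series \<Gamma>) (H_class \<Gamma> (Z_K \<Gamma> + l0)) (Z_K \<Gamma> + l0)"
    using val by simp
  define r where "r = r_rep h"
  have rl: "r - (- l0) \<in> latt" unfolding r_def h_def by (rule r_rep(1))
  have h: "h = H_class \<Gamma> r" unfolding h_def using H_class_eq[OF rl] by simp
  have rd: "r \<in> dual_latt \<Gamma>"
  proof -
    have "(r - (- l0)) + - l0 \<in> dual_latt \<Gamma>"
      using rl md latt_subset_dual dual_additive unfolding additive_subgroup_def by blast
    then show ?thesis by simp
  qed
  have "- (l0 + r) \<in> latt" using rl latt_additive by (simp add: additive_subgroup_def add.commute)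
      (metis add.inverse_inverse diff_minus_eq_add minus_add_distrib uminus_add_conv_diff)
  then have "quasi_polynomial_value (proj_cone I) I h (class_count B (Z_series \<Gamma>) h) (- (l0 + r))
      = p (icoord (r + - (l0 + r)))"
  proof (rule counting_quasi_polynomial(2)[OF B p, rotated])
    fix l assume l: "l \<in> proj_latt I"
    show "class_count B (Z_series \<Gamma>) h (proj I (r_rep h) + l) = region_count B (icoord (r + l))"
      unfolding Z_series_eq by (rule class_count_proj[OF B rd l _ h]) (simp add: r_def proj_nth)
  qed
  then show "quasi_polynomial_value (proj_cone I) I h (class_count B (Z_series \<Gamma>) h) (- (l0 + r_rep h))
       = class_count B (Z_series \<Gamma>) (H_class \<Gamma> (Z_K \<Gamma> + l0)) (Z_K \<Gamma> + l0)"
    using val by (simp add: r_def[symmetric])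
qed

end

theorem corollary5p6:
  fixes \<Gamma> :: "'v::finite weighted_graph" and I :: "'v set"
    and l0 lc0 :: "real^'v" and h0 :: "(real^'v) set"
  assumes "QHS_resolution_graph \<Gamma>"
    and "I \<noteq> {}"
    and "l0 \<in> lipman \<Gamma>"
    and "H_class \<Gamma> l0 = h0"
    and "lc0 = l0 + r_rep (inv\<^bsub>H_group \<Gamma>\<^esub> h0)"
  shows
    "(mpc (proj I ` lipman_real \<Gamma>) (twisted_Z_series \<Gamma> l0) \<one>\<^bsub>H_group \<Gamma>\<^esub> I
        = q_tilde \<Gamma> (inv\<^bsub>H_group \<Gamma>\<^esub> h0) I (- lc0) \<and>
      q_tilde \<Gamma> (inv\<^bsub>H_group \<Gamma>\<^esub> h0) I (- lc0)
        = q_count (Z_series \<Gamma>) (H_class \<Gamma> (Z_K \<Gamma>) \<otimes>\<^bsub>H_group \<Gamma>\<^esub> h0) I (Z_K \<Gamma> + l0)) \<and>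
     (pc (proj I ` lipman_real \<Gamma>) (twisted_Z_series \<Gamma> l0) \<one>\<^bsub>H_group \<Gamma>\<^esub> I
        = Q_tilde \<Gamma> (inv\<^bsub>H_group \<Gamma>\<^esub> h0) I (- lc0) \<and>
      Q_tilde \<Gamma> (inv\<^bsub>H_group \<Gamma>\<^esub> h0) I (- lc0)
        = Q_count (Z_series \<Gamma>) (H_class \<Gamma> (Z_K \<Gamma>) \<otimes>\<^bsub>H_group \<Gamma>\<^esub> h0) I (Z_K \<Gamma> + l0))"
proof -
  interpret resolution \<Gamma> by unfold_locales fact
  have l0d: "l0 \<in> dual_latt \<Gamma>" using assms(3) by (simp add: lipman_def)
  have inv: "inv\<^bsub>H_group \<Gamma>\<^esub> h0 = H_class \<Gamma> (- l0)" using H_inv[OF l0d] assms(4) by simp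
  have one: "\<one>\<^bsub>H_group \<Gamma>\<^esub> = latt" by (simp add: H_one H_class_0)
  have mult: "H_class \<Gamma> (Z_K \<Gamma>) \<otimes>\<^bsub>H_group \<Gamma>\<^esub> h0 = H_class \<Gamma> (Z_K \<Gamma> + l0)"
    using H_mult[OF Z_K(1) l0d] assms(4) by simp
  have q: "q_count a h I = class_count (\<lambda>S. I \<subseteq> S) a h" for a :: "real^'v \<Rightarrow> real" and h
    by (rule ext) (rule q_count_class_count)
  have Q: "Q_count a h I = class_count (\<lambda>S. I \<inter> S \<noteq> {}) a h" for a :: "real^'v \<Rightarrow> real" and h
    by (rule ext) (rule Q_count_class_count)
  have dep: "depends_on I (\<lambda>S. I \<subseteq> S)" "depends_on I (\<lambda>S. I \<inter> S \<noteq> {})"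
    unfolding depends_on_def by blast+
  obtain p where p: "reciprocal (region_count (\<lambda>S. I \<subseteq> S)) p" using reciprocal_lattice_count[OF assms(2)] by blast
  obtain p' where p': "reciprocal (region_count (\<lambda>S. I \<inter> S \<noteq> {})) p'" using reciprocal_union_count[OF assms(2)] by blast
  show ?thesis
    using periodic_constant_reciprocity[OF dep(1) p assms(3)] periodic_constant_reciprocity[OF dep(2) p' assms(3)]
    unfolding mpc_def pc_def q_tilde_def Q_tilde_def q Q inv one mult assms(5) by simp
qed

end
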